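(* Let $\Bbbk$ be a field and $G$ a finite group with a fixed decomposition $G=G_0\times G_1\times\cdots\times G_n$, where $G_0$ is abelian and $G_1,\dots,G_n$ are indecomposable non-abelian groups. A weak $R$-matrix $R=(u,r,p,v)$ of $\mathcal D(G)$ is a quasitriangular structure of $\mathcal D(G)$ if and only if all of the following hold: (1) $A,B\le Z(G)$; (2) $r\in\operatorname{Hom}(G,\widehat G)$ is a bicharacter; (3) $u^*$ and $Sv$ are normal endomorphisms of $G$; (4) for each $1\le i\le n$ exactly one of the following holds: (a) $Sv_i\in\operatorname{Hom}(G_i,Z(G_i))$ and $u^*_i\in\operatorname{Aut}_c(G_i)$; (b) $Sv_i\in\operatorname{Aut}_c(G_i)$ and $u^*_i\in\operatorname{Hom}(G_i,Z(G_i))$. In this case $$R=\sum_{a,b,s\in G} e_s\bowtie ab\otimes r(s)u(e_b)\bowtie p(e_a)v(s).$$ In particular there is a $2^n$-to-$1$ correspondence between quasitriangular structures and central weak $R$-matrices of $\mathcal D(G)$ (a surjection from the set of quasitriangular structures onto the set of central weak $R$-matrices, all of whose fibres have exactly $2^n$ elements). When $G$ is abelian the quasitriangular structures and the central weak $R$-matrices are the same.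
   Context: Double. $\Bbbk^G$ is the algebra of functions $G\to\Bbbk$ with basis $e_g$ ($e_g(h)=\delta_{g,h}$) and unit $1=\varepsilon=\sum_g e_g$; $\Bbbk^{G\,\mathrm{co}}$ is the Hopf algebra $\Bbbk^G$ with opposite coproduct, $\Delta(e_x)=\sum_{s\in G}e_s\otimes e_{xs^{-1}}$. $G$ acts by conjugation: $g\rightharpoonup e_x=e_{gxg^{-1}}$. $\mathcal D(G)$ is $\Bbbk^{G\,\mathrm{co}}\otimes\Bbbk G$ as a coalgebra, with elements $f\bowtie g$ and product $(f\bowtie g)(f'\bowtie g')=f(g\rightharpoonup f')\bowtie gg'$. $\widehat G=\operatorname{Hom}(G,\Bbbk^\times)\subset\Bbbk^G$. Weak $R$-matrices. For a Hopf algebra $H$, a weak $R$-matrix is $R\in H\otimes H$ with $(\Delta\otimes\mathrm{id})(R)=R^{13}R^{23}$, $(\mathrm{id}\otimes\Delta)(R)=R^{13}R^{12}$, $(\varepsilon\otimes\mathrm{id})(R)=1=(\mathrm{id}\otimes\varepsilon)(R)$ (such $R$ is invertible). With $\tau$ the flip, $R$ is a quasitriangular structure if moreover $R\Delta(h)=\tau(\Delta(h))R$ for all $h\in H$; it is a central weak $R$-matrix if instead $R\Delta(h)=\Delta(h)R$ for all $h\in H$. Components. Let $f\# g\in\mathcal D(G)^*$ be the functional $e_s\bowtie h\mapsto\delta_{s,g}f(h)$, and for $R\in\mathcal D(G)\otimes\mathcal D(G)$ let $F(R)(\phi)=(\phi\otimes\mathrm{id})(R)$. For a weak $R$-matrix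 $R$ write $R=(u,r,p,v)$, where, with $(\mathrm{id}\otimes\varepsilon)(f\bowtie g)=f$ and $(\mathrm{ev}_1\otimes\mathrm{id})(f\bowtie g)=f(1)g$: $u(f)=(\mathrm{id}\otimes\varepsilon)F(R)(f\#1)$, $r(g)=(\mathrm{id}\otimes\varepsilon)F(R)(\varepsilon\# g)$, $p(f)=(\mathrm{ev}_1\otimes\mathrm{id})F(R)(f\#1)$, $v(g)=(\mathrm{ev}_1\otimes\mathrm{id})F(R)(\varepsilon\# g)$. Here $u:\Bbbk^{G\,\mathrm{co}}\to\Bbbk^{G\,\mathrm{co}}$ is a unital coalgebra map, $r:\Bbbk G^{\mathrm{op}}\to\Bbbk^{G\,\mathrm{co}}$ is linear, $p:\Bbbk^{G\,\mathrm{co}}\to\Bbbk G$ is a Hopf algebra map, $v:\Bbbk G^{\mathrm{op}}\to\Bbbk G$ is an algebra map preserving counits; they determine $R$. $u^*:\Bbbk G\to\Bbbk G$ is the transpose of $u$; $S$ is the antipode (inversion on group elements), so if $v$ maps $G$ to $G$ then $Sv:g\mapsto v(g)^{-1}$ is a homomorphism $G\to G$. Saying $u^*$ (or $Sv$) is an endomorphism of $G$ means that it is the linear extension of one. $A,B\le G$ are the unique abelian subgroups such that $p$ is the composite of the restriction $\Bbbk^G\to\Bbbk^A$, a Hopf algebra isomorphism $\Bbbk^A\cong\Bbbk B$, and the inclusion $\Bbbk B\subseteq\Bbbk G$. "$r\in\operatorname{Hom}(G,\widehat G)$" means $r(g)\in\widehat G$ for all $g\in G$ and $g\mapsto r(g)$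 is a homomorphism. Groups. An endomorphism $w$ of a group is normal if it commutes with all inner automorphisms. $\operatorname{Aut}_c(K)$ is the group of central automorphisms $w$ of $K$: $x^{-1}w(x)\in Z(K)$ for all $x$. For a map $w:G\to G$, $w_i=\pi_i\circ w\circ\iota_i$ with $\iota_i:G_i\to G$, $\pi_i:G\to G_i$ the canonical injection and projection. Indecomposable means not a direct product of two non-trivial groups. *)

theory Defs
  imports "HOL-Algebra.Product_Groups"
begin

section \<open>Based bialgebras\<close>

text \<open>
  A finite-dimensional space with a chosen basis \<open>B\<close> is represented by the functions into
  the field that vanish outside \<open>B\<close> (\<open>x b\<close> is the coefficient of \<open>b\<close> in \<open>x\<close>).  The tensor product
  of the spaces on \<open>B\<close> and \<open>C\<close> is then the space on \<open>B \<times> C\<close>.  The record holds the structure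
  constants: \<open>bmul H a b c\<close> is the coefficient of \<open>c\<close> in \<open>a b\<close>, and
  \<open>bcomul H a (b, c)\<close> that of \<open>b \<otimes> c\<close> in \<open>\<Delta>(a)\<close>.  The antipode of a Hopf algebra is determined by
  its bialgebra structure and is not recorded.
\<close>

record ('b, 'k) bialg =
  bbasis :: "'b set"
  bmul :: "'b \<Rightarrow> 'b \<Rightarrow> 'b \<Rightarrow> 'k"
  bunit :: "'b \<Rightarrow> 'k"
  bcomul :: "'b \<Rightarrow> 'b \<times> 'b \<Rightarrow> 'k"
  bcounit :: "'b \<Rightarrow> 'k"

definition delta :: "'b \<Rightarrow> 'b \<Rightarrow> 'k::field" where
  "delta a = (\<lambda>b. if b = a then 1 else 0)"

definition bspace :: "('b, 'k::field) bialg \<Rightarrow> ('b \<Rightarrow> 'k) set" where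
  "bspace H = {x. \<forall>b. b \<notin> bbasis H \<longrightarrow> x b = 0}"

definition hmult :: "('b, 'k::field) bialg \<Rightarrow> ('b \<Rightarrow> 'k) \<Rightarrow> ('b \<Rightarrow> 'k) \<Rightarrow> 'b \<Rightarrow> 'k" where
  "hmult H x y = (\<lambda>c. \<Sum>a\<in>bbasis H. \<Sum>b\<in>bbasis H. x a * y b * bmul H a b c)"

definition comult :: "('b, 'k::field) bialg \<Rightarrow> ('b \<Rightarrow> 'k) \<Rightarrow> 'b \<times> 'b \<Rightarrow> 'k" where
  "comult H x = (\<lambda>c. \<Sum>a\<in>bbasis H. x a * bcomul H a c)"

definition counit :: "('b, 'k::field) bialg \<Rightarrow> ('b \<Rightarrow> 'k) \<Rightarrow> 'k" where
  "counit H x = (\<Sum>a\<in>bbasis H. x a * bcounit H a)"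

definition pure_tensor :: "('b \<Rightarrow> 'k::field) \<Rightarrow> ('c \<Rightarrow> 'k) \<Rightarrow> 'b \<times> 'c \<Rightarrow> 'k" where
  "pure_tensor x y = (\<lambda>(b, c). x b * y c)"

definition tensor :: "('b, 'k::field) bialg \<Rightarrow> ('c, 'k) bialg \<Rightarrow> ('b \<times> 'c, 'k) bialg" where
  "tensor H L = \<lparr>
     bbasis = bbasis H \<times> bbasis L,
     bmul = (\<lambda>(a, b) (c, d). pure_tensor (bmul H a c) (bmul L b d)),
     bunit = pure_tensor (bunit H) (bunit L),
     bcomul = (\<lambda>(a, b) ((c, d), (c', d')). bcomul H a (c, c') * bcomul L b (d, d')),
     bcounit = (\<lambda>(a, b). bcounit H a * bcounit L b)\<rparr>"

definition cop :: "('b, 'k::field) bialg \<Rightarrow> ('b, 'k) bialg" where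
  "cop H = H\<lparr>bcomul := (\<lambda>a (b, c). bcomul H a (c, b))\<rparr>"

text \<open>A bialgebra isomorphism of Hopf algebras commutes with the antipodes, so
  \<open>hopf_iso\<close> is the notion of Hopf algebra isomorphism.\<close>

definition hopf_iso ::
  "('b, 'k::field) bialg \<Rightarrow> ('c, 'k) bialg \<Rightarrow> (('b \<Rightarrow> 'k) \<Rightarrow> 'c \<Rightarrow> 'k) \<Rightarrow> bool" where
  "hopf_iso H L f \<longleftrightarrow>
     bij_betw f (bspace H) (bspace L) \<and>
     (\<forall>x\<in>bspace H. \<forall>y\<in>bspace H. f (\<lambda>b. x b + y b) = (\<lambda>c. f x c + f y c)) \<and>
     (\<forall>t. \<forall>x\<in>bspace H. f (\<lambda>b. t * x b) = (\<lambda>c. t * f x c)) \<and>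
     (\<forall>x\<in>bspace H. \<forall>y\<in>bspace H. f (hmult H x y) = hmult L (f x) (f y)) \<and>
     f (bunit H) = bunit L \<and>
     (\<forall>x\<in>bspace H. comult L (f x) =
        (\<lambda>cd. \<Sum>(a, b)\<in>bbasis H \<times> bbasis H.
            comult H x (a, b) * pure_tensor (f (delta a)) (f (delta b)) cd)) \<and>
     (\<forall>x\<in>bspace H. counit L (f x) = counit H x)"


section \<open>Weak $R$-matrices\<close>

definition weak_R_matrices :: "('b, 'k::field) bialg \<Rightarrow> ('b \<times> 'b \<Rightarrow> 'k) set" where
  "weak_R_matrices H = {R \<in> bspace (tensor H H).
     let H3 = tensor H (tensor H H);
         R12 = (\<lambda>(a, b, c). R (a, b) * bunit H c);
         R13 = (\<lambda>(a, b, c). R (a, c) * bunit H b);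
         R23 = (\<lambda>(a, b, c). bunit H a * R (b, c))
     in (\<lambda>(a, b, c). comult H (\<lambda>d. R (d, c)) (a, b)) = hmult H3 R13 R23 \<and>
        (\<lambda>(a, b, c). comult H (\<lambda>d. R (a, d)) (b, c)) = hmult H3 R13 R12 \<and>
        (\<lambda>b. counit H (\<lambda>a. R (a, b))) = bunit H \<and>
        (\<lambda>a. counit H (\<lambda>b. R (a, b))) = bunit H}"

definition flip :: "('b \<times> 'c \<Rightarrow> 'k) \<Rightarrow> 'c \<times> 'b \<Rightarrow> 'k" where
  "flip z = (\<lambda>(a, b). z (b, a))"

definition quasitriangular_structures :: "('b, 'k::field) bialg \<Rightarrow> ('b \<times> 'b \<Rightarrow> 'k) set" where
  "quasitriangular_structures H = {R \<in> weak_R_matrices H. \<forall>h\<in>bspace H.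
     hmult (tensor H H) R (comult H h) = hmult (tensor H H) (flip (comult H h)) R}"

definition central_weak_R_matrices :: "('b, 'k::field) bialg \<Rightarrow> ('b \<times> 'b \<Rightarrow> 'k) set" where
  "central_weak_R_matrices H = {R \<in> weak_R_matrices H. \<forall>h\<in>bspace H.
     hmult (tensor H H) R (comult H h) = hmult (tensor H H) (comult H h) R}"


section \<open>The Drinfeld double of a finite group\<close>

text \<open>The algebra of functions on \<open>G\<close>: \<open>delta x\<close> is $e_x$ and the unit is $\varepsilon$.\<close>

definition fun_alg :: "('g, 'm) monoid_scheme \<Rightarrow> ('g, 'k::field) bialg" where
  "fun_alg G = \<lparr>
     bbasis = carrier G,
     bmul = (\<lambda>x y z. delta x z * delta y z),
     bunit = (\<lambda>x. if x \<in> carrier G then 1 else 0),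
     bcomul = (\<lambda>x (s, t). if s \<in> carrier G \<and> t \<in> carrier G \<and> s \<otimes>\<^bsub>G\<^esub> t = x then 1 else 0),
     bcounit = delta \<one>\<^bsub>G\<^esub>\<rparr>"

definition group_alg :: "('g, 'm) monoid_scheme \<Rightarrow> ('g, 'k::field) bialg" where
  "group_alg G = \<lparr>
     bbasis = carrier G,
     bmul = (\<lambda>g h. delta (g \<otimes>\<^bsub>G\<^esub> h)),
     bunit = delta \<one>\<^bsub>G\<^esub>,
     bcomul = (\<lambda>g. delta (g, g)),
     bcounit = (\<lambda>g. 1)\<rparr>"

definition group_alg_antipode ::
  "('g, 'm) monoid_scheme \<Rightarrow> ('g \<Rightarrow> 'k::field) \<Rightarrow> 'g \<Rightarrow> 'k" where
  "group_alg_antipode G x = (\<lambda>h. \<Sum>g\<in>carrier G. x g * delta (inv\<^bsub>G\<^esub> g) h)"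

text \<open>The action determined by $g \rightharpoonup e_x = e_{gxg^{-1}}$.\<close>

definition conj_act ::
  "('g, 'm) monoid_scheme \<Rightarrow> 'g \<Rightarrow> ('g \<Rightarrow> 'k::field) \<Rightarrow> 'g \<Rightarrow> 'k" where
  "conj_act G g f = (\<lambda>s. \<Sum>x\<in>carrier G. f x * delta (g \<otimes>\<^bsub>G\<^esub> x \<otimes>\<^bsub>G\<^esub> inv\<^bsub>G\<^esub> g) s)"

text \<open>The basis vector \<open>(x, g)\<close> is $e_x \bowtie g$; in general
  $f \bowtie y$, for a function \<open>f\<close> and \<open>y\<close> in the group algebra, is \<open>pure_tensor f y\<close>.\<close>

definition double :: "('g, 'm) monoid_scheme \<Rightarrow> ('g \<times> 'g, 'k::field) bialg" where
  "double G = (tensor (cop (fun_alg G)) (group_alg G))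
     \<lparr>bmul := (\<lambda>(x, g) (y, h).
        pure_tensor (hmult (fun_alg G) (delta x) (conj_act G g (delta y))) (delta (g \<otimes>\<^bsub>G\<^esub> h)))\<rparr>"


section \<open>Components of a weak $R$-matrix\<close>

text \<open>The functional $f \# y$ on the double, for \<open>y\<close> in the group algebra (linear in \<open>y\<close>);
  for \<open>y = delta g\<close> it sends $e_s \bowtie h$ to $\delta_{s,g} f(h)$.\<close>

definition hash :: "('g, 'm) monoid_scheme \<Rightarrow> ('g \<Rightarrow> 'k::field) \<Rightarrow> ('g \<Rightarrow> 'k) \<Rightarrow> ('g \<times> 'g \<Rightarrow> 'k) \<Rightarrow> 'k"
  where "hash G f y z = (\<Sum>(s, h)\<in>carrier G \<times> carrier G. z (s, h) * (y s * f h))"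

text \<open>\<open>F_map R \<phi>\<close> is $(\phi \otimes \mathrm{id})(R)$ for linear \<open>\<phi>\<close>.\<close>

definition F_map :: "('b \<times> 'b \<Rightarrow> 'k) \<Rightarrow> (('b \<Rightarrow> 'k) \<Rightarrow> 'k) \<Rightarrow> 'b \<Rightarrow> 'k" where
  "F_map R \<phi> = (\<lambda>b. \<phi> (\<lambda>a. R (a, b)))"

definition id_counit :: "('g, 'm) monoid_scheme \<Rightarrow> ('g \<times> 'g \<Rightarrow> 'k::field) \<Rightarrow> 'g \<Rightarrow> 'k" where
  "id_counit G z = (\<lambda>s. counit (group_alg G) (\<lambda>h. z (s, h)))"

definition ev1_id :: "('g, 'm) monoid_scheme \<Rightarrow> ('g \<times> 'g \<Rightarrow> 'k::field) \<Rightarrow> 'g \<Rightarrow> 'k" where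
  "ev1_id G z = (\<lambda>h. z (\<one>\<^bsub>G\<^esub>, h))"

definition u_comp where
  "u_comp G R f = id_counit G (F_map R (hash G f (delta \<one>\<^bsub>G\<^esub>)))"

definition r_comp where
  "r_comp G R y = id_counit G (F_map R (hash G (bunit (fun_alg G)) y))"

definition p_comp where
  "p_comp G R f = ev1_id G (F_map R (hash G f (delta \<one>\<^bsub>G\<^esub>)))"

definition v_comp where
  "v_comp G R y = ev1_id G (F_map R (hash G (bunit (fun_alg G)) y))"

text \<open>The transpose is taken for the pairing of functions with the group algebra: the
  coefficient of \<open>s\<close> in the image of \<open>y\<close> is the pairing of $e_s$ with it, that is, of the image of
  $e_s$ with \<open>y\<close>.\<close>

definition transpose_map ::
  "('g, 'm) monoid_scheme \<Rightarrow> (('g \<Rightarrow> 'k::field) \<Rightarrow> 'g \<Rightarrow> 'k) \<Rightarrow> ('g \<Rightarrow> 'k) \<Rightarrow> 'g \<Rightarrow> 'k" where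
  "transpose_map G u y =
     (\<lambda>s. if s \<in> carrier G then \<Sum>g\<in>carrier G. y g * u (delta s) g else 0)"

text \<open>Functions on \<open>B\<close> vanish outside \<open>B\<close>, so the inclusion of the group algebra of \<open>B\<close> into
  that of \<open>G\<close> is the identity.\<close>

definition p_factors_through ::
  "('g, 'm) monoid_scheme \<Rightarrow> (('g \<Rightarrow> 'k::field) \<Rightarrow> 'g \<Rightarrow> 'k) \<Rightarrow> 'g set \<Rightarrow> 'g set \<Rightarrow> bool" where
  "p_factors_through G p A B \<longleftrightarrow>
     subgroup A G \<and> subgroup B G \<and>
     comm_group (G\<lparr>carrier := A\<rparr>) \<and> comm_group (G\<lparr>carrier := B\<rparr>) \<and>
     (\<exists>\<psi>. hopf_iso (fun_alg (G\<lparr>carrier := A\<rparr>)) (group_alg (G\<lparr>carrier := B\<rparr>)) \<psi> \<and>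
        (\<forall>f\<in>bspace (fun_alg G). p f = \<psi> (\<lambda>x. if x \<in> A then f x else 0)))"

definition A_subgroup where
  "A_subgroup G R = fst (THE AB. p_factors_through G (p_comp G R) (fst AB) (snd AB))"

definition B_subgroup where
  "B_subgroup G R = snd (THE AB. p_factors_through G (p_comp G R) (fst AB) (snd AB))"


section \<open>Groups\<close>

definition field_units :: "'k::field monoid" where
  "field_units = \<lparr>carrier = UNIV - {0}, mult = (*), one = 1\<rparr>"

definition character_group :: "('g, 'm) monoid_scheme \<Rightarrow> ('g \<Rightarrow> 'k::field) monoid" where
  "character_group G = \<lparr>
     carrier = hom G field_units \<inter> bspace (fun_alg G),
     mult = hmult (fun_alg G),
     one = bunit (fun_alg G)\<rparr>"

definition center :: "('g, 'm) monoid_scheme \<Rightarrow> 'g set" where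
  "center G = {z \<in> carrier G. \<forall>x\<in>carrier G. z \<otimes>\<^bsub>G\<^esub> x = x \<otimes>\<^bsub>G\<^esub> z}"

definition extends_endo ::
  "('g, 'm) monoid_scheme \<Rightarrow> (('g \<Rightarrow> 'k::field) \<Rightarrow> 'g \<Rightarrow> 'k) \<Rightarrow> ('g \<Rightarrow> 'g) \<Rightarrow> bool" where
  "extends_endo G L w \<longleftrightarrow> w \<in> hom G G \<and>
     (\<forall>y\<in>bspace (group_alg G). L y = (\<lambda>h. \<Sum>g\<in>carrier G. y g * delta (w g) h))"

definition normal_endo :: "('g, 'm) monoid_scheme \<Rightarrow> ('g \<Rightarrow> 'g) \<Rightarrow> bool" where
  "normal_endo G w \<longleftrightarrow> w \<in> hom G G \<and>
     (\<forall>g\<in>carrier G. \<forall>x\<in>carrier G.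
        w (g \<otimes>\<^bsub>G\<^esub> x \<otimes>\<^bsub>G\<^esub> inv\<^bsub>G\<^esub> g) = g \<otimes>\<^bsub>G\<^esub> w x \<otimes>\<^bsub>G\<^esub> inv\<^bsub>G\<^esub> g)"

definition central_auts :: "('g, 'm) monoid_scheme \<Rightarrow> ('g \<Rightarrow> 'g) set" where
  "central_auts G = {w \<in> iso G G. \<forall>x\<in>carrier G. inv\<^bsub>G\<^esub> x \<otimes>\<^bsub>G\<^esub> w x \<in> center G}"

definition homs_to_center :: "('g, 'm) monoid_scheme \<Rightarrow> ('g \<Rightarrow> 'g) set" where
  "homs_to_center G = hom G (G\<lparr>carrier := center G\<rparr>)"

text \<open>Factors of a direct product are isomorphic to subgroups, so letting them range over the
  groups on the type of the elements of \<open>G\<close> loses nothing.\<close>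

definition indecomposable :: "('g, 'm) monoid_scheme \<Rightarrow> bool" where
  "indecomposable G \<longleftrightarrow> \<not> (\<exists>(A :: 'g monoid) (B :: 'g monoid).
     group A \<and> group B \<and> \<not> trivial_group A \<and> \<not> trivial_group B \<and> G \<cong> A \<times>\<times> B)"

text \<open>For an isomorphism \<open>\<theta>\<close> from \<open>product_group {..n} K\<close> onto \<open>G\<close>, the map
  $\pi_i \circ w \circ \iota_i$ on \<open>K i\<close>.\<close>

definition comp_inj :: "(nat \<Rightarrow> ('a, 'm) monoid_scheme) \<Rightarrow> nat \<Rightarrow> ((nat \<Rightarrow> 'a) \<Rightarrow> 'g) \<Rightarrow> nat \<Rightarrow> 'a \<Rightarrow> 'g"
  where "comp_inj K n \<theta> i x = \<theta> (\<lambda>j\<in>{..n}. if j = i then x else \<one>\<^bsub>K j\<^esub>)"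

definition comp_proj :: "(nat \<Rightarrow> ('a, 'm) monoid_scheme) \<Rightarrow> nat \<Rightarrow> ((nat \<Rightarrow> 'a) \<Rightarrow> 'g) \<Rightarrow> nat \<Rightarrow> 'g \<Rightarrow> 'a"
  where "comp_proj K n \<theta> i g = inv_into (carrier (product_group {..n} K)) \<theta> g i"

definition diag_comp ::
  "(nat \<Rightarrow> ('a, 'm) monoid_scheme) \<Rightarrow> nat \<Rightarrow> ((nat \<Rightarrow> 'a) \<Rightarrow> 'g) \<Rightarrow> nat \<Rightarrow> ('g \<Rightarrow> 'g) \<Rightarrow> 'a \<Rightarrow> 'a" where
  "diag_comp K n \<theta> i w = comp_proj K n \<theta> i \<circ> w \<circ> comp_inj K n \<theta> i"

end

theory Submission
  imports Defs
begin

text \<open>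
  Write an element \<open>R\<close> of $\mathcal D(G) \otimes \mathcal D(G)$ through its coefficients
  \<open>R ((s, a), (y, h))\<close> at $e_s \bowtie a \otimes e_y \bowtie h$.  Commutation with coproducts is a
  condition on these coefficients alone (\<open>commutation_iff_support_law\<close>): they are invariant under
  simultaneous conjugation, and a non-zero one forces \<open>s y\<close> (quasitriangular) or \<open>y s\<close> (central) to
  equal \<open>(h\<^sup>-\<^sup>1 y h) (a\<^sup>-\<^sup>1 s a)\<close>.

  The matrix of \<open>p\<close> is a self-dual object, a pairing; the rows and columns that are non-zero form
  the subgroups \<open>A\<close> and \<open>B\<close> (\<open>p_factors_through_iff\<close>).  The support condition at \<open>y = \<one>\<close> and at
  \<open>s = \<one>\<close> makes \<open>A\<close> and \<open>B\<close> central (\<open>support_law_central_pairing\<close>).  Once they are central, the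
  functions $u(e_a)$ are orthogonal idempotents, so their values are 0 and 1 and \<open>\<phi> = u\<^sup>*\<close> is an
  endomorphism of \<open>G\<close>; dually so is \<open>w = S v\<close>, and the coefficients are
  \<open>r(s)(y) P(a \<phi>(y)\<^sup>-\<^sup>1, h w(s))\<close> (\<open>weak_data_structure\<close>).  Conjugation invariance makes \<open>\<phi>\<close> and \<open>w\<close>
  normal with commuting images and \<open>r\<close> a bicharacter (\<open>conj_invariant_normal_data\<close>), and such
  components always define a weak $R$-matrix (\<open>weak_coeffs_R_of\<close>).

  For such components the support condition reads \<open>w(c) \<phi>(c) = c\<close> on commutators \<open>c\<close> in the
  quasitriangular case, and in the central case \<open>w(c) \<phi>(c) = \<one>\<close>, which holds exactly if \<open>w\<close> and
  \<open>\<phi>\<close> have central values.  The first identity can be checked in each factor of \<open>G\<close>, where it makes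
  \<open>w\<close> idempotent on commutators.  By Fitting's lemma \<open>w\<close> is an automorphism of an indecomposable
  factor or nilpotent; in the second case it kills the commutators, \<open>\<phi>\<close> fixes them, and \<open>\<phi>\<close> is an
  automorphism.  The automorphism is central and the other map takes central values
  (\<open>central_aut_dichotomy\<close>, \<open>gcomm_identity_iff\<close>).

  Let \<open>I\<close> be the set of non-abelian factors on which \<open>\<phi>\<close> is the automorphism.  Dividing \<open>\<phi>\<close> by the
  projection onto the factors in \<open>I\<close>, and \<open>w\<close> by the projection onto the other non-abelian factors,
  leaves a central weak $R$-matrix, and this can be reversed for every \<open>I\<close>.  So quasitriangular
  structures correspond to pairs of a central weak $R$-matrix and one of the \<open>2\<^sup>n\<close> sets \<open>I\<close>
  (\<open>twist_correspondence\<close>).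
\<close>

section \<open>Commutators, normal endomorphisms and Fitting's lemma\<close>

context group
begin

lemma inv_cancel_left [simp]:
  "x \<in> carrier G \<Longrightarrow> y \<in> carrier G \<Longrightarrow> inv x \<otimes> (x \<otimes> y) = y"
  "x \<in> carrier G \<Longrightarrow> y \<in> carrier G \<Longrightarrow> x \<otimes> (inv x \<otimes> y) = y"
  by (simp_all add: m_assoc[symmetric])

lemmas group_word = m_assoc inv_mult_group

lemma mult_eq_iff_left:
  "x \<in> carrier G \<Longrightarrow> y \<in> carrier G \<Longrightarrow> z \<in> carrier G \<Longrightarrow> x \<otimes> y = z \<longleftrightarrow> y = inv x \<otimes> z"
  by auto

lemma mult_eq_iff_right:
  "x \<in> carrier G \<Longrightarrow> y \<in> carrier G \<Longrightarrow> z \<in> carrier G \<Longrightarrow> x \<otimes> y = z \<longleftrightarrow> x = z \<otimes> inv y"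
  by (metis inv_solve_right)

end

definition gcomm :: "('g, 'm) monoid_scheme \<Rightarrow> 'g \<Rightarrow> 'g \<Rightarrow> 'g" where
  "gcomm G x y = x \<otimes>\<^bsub>G\<^esub> y \<otimes>\<^bsub>G\<^esub> inv\<^bsub>G\<^esub> x \<otimes>\<^bsub>G\<^esub> inv\<^bsub>G\<^esub> y"

context group
begin

lemma gcomm_closed [simp]:
  "x \<in> carrier G \<Longrightarrow> y \<in> carrier G \<Longrightarrow> gcomm G x y \<in> carrier G"
  by (simp add: gcomm_def)

lemma gcomm_eq_one_iff:
  assumes "x \<in> carrier G" "y \<in> carrier G"
  shows "gcomm G x y = \<one> \<longleftrightarrow> x \<otimes> y = y \<otimes> x"
proof -
  have "gcomm G x y = (x \<otimes> y) \<otimes> inv (y \<otimes> x)"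
    using assms by (simp add: gcomm_def group_word)
  then show ?thesis
    using assms mult_eq_iff_right[of "x \<otimes> y" "inv (y \<otimes> x)" \<one>] by simp
qed

lemma gcomm_one [simp]: "x \<in> carrier G \<Longrightarrow> gcomm G x \<one> = \<one>"
  by (simp add: gcomm_def)

lemma gcomm_inverse_conj:
  assumes "g \<in> carrier G" "x \<in> carrier G" "z \<in> carrier G"
  shows "gcomm G g x = gcomm G g z \<longleftrightarrow> g \<otimes> (inv x \<otimes> z) = (inv x \<otimes> z) \<otimes> g"
proof -
  have "gcomm G g x = gcomm G g z \<longleftrightarrow> x \<otimes> inv g \<otimes> inv x = z \<otimes> inv g \<otimes> inv z"
    using assms by (simp add: gcomm_def m_assoc)
  also have "\<dots> \<longleftrightarrow> inv (x \<otimes> inv g \<otimes> inv x) = inv (z \<otimes> inv g \<otimes> inv z)"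
    using assms by (metis inv_closed inv_inv m_closed)
  also have "\<dots> \<longleftrightarrow> x \<otimes> g \<otimes> inv x = z \<otimes> g \<otimes> inv z"
    using assms by (simp add: group_word)
  also have "\<dots> \<longleftrightarrow> g \<otimes> (inv x \<otimes> z) = (inv x \<otimes> z) \<otimes> g"
  proof
    assume e: "x \<otimes> g \<otimes> inv x = z \<otimes> g \<otimes> inv z"
    have "g \<otimes> (inv x \<otimes> z) = inv x \<otimes> (x \<otimes> g \<otimes> inv x) \<otimes> z" using assms by (simp add: group_word)
    also have "\<dots> = (inv x \<otimes> z) \<otimes> g" using assms unfolding e by (simp add: group_word)
    finally show "g \<otimes> (inv x \<otimes> z) = (inv x \<otimes> z) \<otimes> g" .
  next
    assume e: "g \<otimes> (inv x \<otimes> z) = (inv x \<otimes> z) \<otimes> g"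
    have "x \<otimes> g \<otimes> inv x = x \<otimes> (g \<otimes> (inv x \<otimes> z)) \<otimes> inv z" using assms by (simp add: group_word)
    also have "\<dots> = z \<otimes> g \<otimes> inv z" using assms unfolding e by (simp add: group_word)
    finally show "x \<otimes> g \<otimes> inv x = z \<otimes> g \<otimes> inv z" .
  qed
  finally show ?thesis .
qed

lemma hom_gcomm:
  assumes "group H" "f \<in> hom G H" "x \<in> carrier G" "y \<in> carrier G"
  shows "f (gcomm G x y) = gcomm H (f x) (f y)"
proof -
  interpret h: group_hom G H f using assms is_group by (simp add: group_hom_def group_hom_axioms_def)
  show ?thesis using assms by (simp add: gcomm_def)
qed

text \<open>A commutator \<open>[x, y]\<close> is a quotient of conjugates of \<open>y\<close>, and of \<open>x\<close>; a map that commutes with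
  conjugation may therefore be applied to either entry alone.\<close>

lemma normal_endo_gcomm:
  assumes "normal_endo G f" "x \<in> carrier G" "y \<in> carrier G"
  shows "f (gcomm G x y) = gcomm G x (f y)" "f (gcomm G x y) = gcomm G (f x) y"
proof -
  have f: "f \<in> hom G G" and conj: "\<And>g x. g \<in> carrier G \<Longrightarrow> x \<in> carrier G \<Longrightarrow>
      f (g \<otimes> x \<otimes> inv g) = g \<otimes> f x \<otimes> inv g"
    using assms by (auto simp: normal_endo_def)
  interpret h: group_hom G G f using f is_group by (simp add: group_hom_def group_hom_axioms_def)
  show "f (gcomm G x y) = gcomm G x (f y)"
    using assms(2,3) conj[of x y] by (simp add: gcomm_def)
  have "f (gcomm G x y) = f (x \<otimes> (y \<otimes> inv x \<otimes> inv y))"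
    using assms(2,3) by (simp add: gcomm_def m_assoc)
  then show "f (gcomm G x y) = gcomm G (f x) y"
    using assms(2,3) conj[of y "inv x"] by (simp add: gcomm_def m_assoc)
qed

lemma center_gcomm:
  "z \<in> center G \<longleftrightarrow> z \<in> carrier G \<and> (\<forall>g\<in>carrier G. gcomm G g z = \<one>)"
  by (auto simp: center_def gcomm_eq_one_iff)

lemma centerD:
  assumes "z \<in> center G"
  shows "z \<in> carrier G" and "x \<in> carrier G \<Longrightarrow> z \<otimes> x = x \<otimes> z"
  using assms by (simp_all add: center_def)

lemma centerI:
  "z \<in> carrier G \<Longrightarrow> (\<And>x. x \<in> carrier G \<Longrightarrow> z \<otimes> x = x \<otimes> z) \<Longrightarrow> z \<in> center G"
  by (simp add: center_def)

lemma center_inv: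
  assumes "z \<in> center G"
  shows "inv z \<in> center G"
proof (rule centerI)
  have z: "z \<in> carrier G" using assms by (rule centerD)
  then show "inv z \<in> carrier G" by simp
  fix x assume x: "x \<in> carrier G"
  have "inv (inv x \<otimes> z) = inv (z \<otimes> inv x)" using centerD(2)[OF assms, of "inv x"] x by simp
  then show "inv z \<otimes> x = x \<otimes> inv z" using z x by (simp add: inv_mult_group)
qed

lemma center_mult:
  assumes "y \<in> center G" "z \<in> center G"
  shows "y \<otimes> z \<in> center G"
proof (rule centerI)
  have yz: "y \<in> carrier G" "z \<in> carrier G" using assms by (auto dest: centerD)
  then show "y \<otimes> z \<in> carrier G" by simp
  fix x assume x: "x \<in> carrier G"
  have "y \<otimes> z \<otimes> x = y \<otimes> (x \<otimes> z)" using yz x centerD(2)[OF assms(2) x] by (simp add: m_assoc)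
  also have "\<dots> = y \<otimes> x \<otimes> z" using yz x by (simp add: m_assoc)
  also have "\<dots> = x \<otimes> (y \<otimes> z)" using yz x centerD(2)[OF assms(1) x] by (simp add: m_assoc)
  finally show "y \<otimes> z \<otimes> x = x \<otimes> (y \<otimes> z)" .
qed

lemma homs_to_center_iff:
  "f \<in> homs_to_center G \<longleftrightarrow> f \<in> hom G G \<and> (\<forall>x\<in>carrier G. f x \<in> center G)"
  unfolding homs_to_center_def hom_def by (auto dest: centerD)

lemma normal_endo_into_center:
  assumes "f \<in> hom G G" "\<And>x. x \<in> carrier G \<Longrightarrow> f x \<in> center G"
  shows "normal_endo G f"
proof -
  interpret h: group_hom G G f using assms is_group by (simp add: group_hom_def group_hom_axioms_def)
  have conj: "g \<otimes> f x \<otimes> inv g = f x" if "g \<in> carrier G" "x \<in> carrier G" for g x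
    using centerD(2)[OF assms(2)[OF that(2)] that(1)] that by (metis h.hom_closed inv_solve_right' m_closed)
  have "f (g \<otimes> x \<otimes> inv g) = g \<otimes> f x \<otimes> inv g" if "g \<in> carrier G" "x \<in> carrier G" for g x
    using conj[OF that] conj[of "f g" x] that by simp
  then show ?thesis using assms(1) by (simp add: normal_endo_def)
qed

text \<open>Since \<open>f [g, x] = [g, f x]\<close>, the commutator \<open>[g, x]\<close> is fixed exactly when \<open>g\<close> commutes with
  \<open>x\<^sup>-\<^sup>1 f x\<close>.\<close>

lemma fixes_gcomm_iff:
  assumes "normal_endo G f"
  shows "(\<forall>x\<in>carrier G. \<forall>y\<in>carrier G. f (gcomm G x y) = gcomm G x y) \<longleftrightarrow>
    (\<forall>x\<in>carrier G. inv x \<otimes> f x \<in> center G)"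
proof -
  have f: "\<And>x. x \<in> carrier G \<Longrightarrow> f x \<in> carrier G" using assms by (auto simp: normal_endo_def hom_def)
  have key: "gcomm G g x = f (gcomm G g x) \<longleftrightarrow> g \<otimes> (inv x \<otimes> f x) = (inv x \<otimes> f x) \<otimes> g"
    if "x \<in> carrier G" "g \<in> carrier G" for g x
    unfolding normal_endo_gcomm(1)[OF assms that(2,1)]
    by (rule gcomm_inverse_conj[OF that(2,1) f[OF that(1)]])
  show ?thesis
  proof (intro iffI ballI)
    fix x assume x: "x \<in> carrier G"
      and fixed: "\<forall>x\<in>carrier G. \<forall>y\<in>carrier G. f (gcomm G x y) = gcomm G x y"
    show "inv x \<otimes> f x \<in> center G"
    proof (rule centerI)
      fix g assume g: "g \<in> carrier G"
      show "inv x \<otimes> f x \<otimes> g = g \<otimes> (inv x \<otimes> f x)"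
        using key[OF x g] bspec[OF bspec[OF fixed g] x] by (simp only: refl simp_thms)
    qed (use x f in simp)
  next
    fix g x assume x: "x \<in> carrier G" and g: "g \<in> carrier G"
      and central: "\<forall>x\<in>carrier G. inv x \<otimes> f x \<in> center G"
    show "f (gcomm G g x) = gcomm G g x"
      using key[OF x g] centerD(2)[OF bspec[OF central x] g] by (simp only: refl simp_thms)
  qed
qed

lemma kills_gcomm_iff:
  assumes "normal_endo G f"
  shows "(\<forall>x\<in>carrier G. \<forall>y\<in>carrier G. f (gcomm G x y) = \<one>) \<longleftrightarrow>
    (\<forall>x\<in>carrier G. f x \<in> center G)"
proof -
  have f: "\<And>x. x \<in> carrier G \<Longrightarrow> f x \<in> carrier G" using assms by (auto simp: normal_endo_def hom_def)
  show ?thesis using f normal_endo_gcomm[OF assms] by (auto simp: center_gcomm)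
qed

lemma normal_endo_hom: "normal_endo G f \<Longrightarrow> f \<in> hom G G"
  by (simp add: normal_endo_def)

lemma normal_endo_conj:
  "normal_endo G f \<Longrightarrow> g \<in> carrier G \<Longrightarrow> x \<in> carrier G \<Longrightarrow>
    f (g \<otimes> x \<otimes> inv g) = g \<otimes> f x \<otimes> inv g"
  unfolding normal_endo_def by blast

lemma normal_endo_comp:
  assumes "normal_endo G f" "normal_endo G h"
  shows "normal_endo G (f \<circ> h)"
  unfolding normal_endo_def
proof (intro conjI ballI)
  show "f \<circ> h \<in> hom G G" using normal_endo_hom[OF assms(1)] normal_endo_hom[OF assms(2)] by (simp add: hom_def Pi_iff)
  fix g x assume "g \<in> carrier G" "x \<in> carrier G"
  then show "(f \<circ> h) (g \<otimes> x \<otimes> inv g) = g \<otimes> (f \<circ> h) x \<otimes> inv g"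
    using hom_in_carrier[OF normal_endo_hom[OF assms(2)]]
    by (simp add: normal_endo_conj[OF assms(1)] normal_endo_conj[OF assms(2)])
qed

lemma normal_endo_funpow:
  assumes "normal_endo G f"
  shows "normal_endo G (f ^^ k)"
proof (induction k)
  case 0
  then show ?case by (auto simp: normal_endo_def hom_def)
next
  case (Suc k)
  then show ?case using normal_endo_comp[OF assms Suc] by (simp only: funpow.simps)
qed

end

text \<open>On a finite set two powers of \<open>f\<close> agree, so the powers are eventually periodic.  A positive
  multiple of the period that lies beyond the preperiod is the exponent of an idempotent.\<close>

lemma idempotent_power:
  assumes "finite A" "\<And>x. x \<in> A \<Longrightarrow> f x \<in> A"
  obtains m where "m > 0" "\<And>x. x \<in> A \<Longrightarrow> (f ^^ m) ((f ^^ m) x) = (f ^^ m) x"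
proof -
  have cl: "(f ^^ k) x \<in> A" if "x \<in> A" for k x using that assms(2) by (induction k) auto
  have "finite (A \<rightarrow>\<^sub>E A)" using assms(1) by (rule finite_PiE) (use assms(1) in auto)
  moreover have "range (\<lambda>k. restrict (f ^^ k) A) \<subseteq> A \<rightarrow>\<^sub>E A" using cl by (auto simp: extensional_def)
  ultimately have "finite (range (\<lambda>k. restrict (f ^^ k) A))" using finite_subset by blast
  then have "\<not> inj (\<lambda>k. restrict (f ^^ k) A)" using finite_imageD infinite_UNIV_nat by blast
  then obtain i j where ij: "i < j" "restrict (f ^^ i) A = restrict (f ^^ j) A"
    unfolding inj_on_def by (metis linorder_neqE_nat)
  define p where "p = j - i"
  have p: "p > 0" "j = p + i" using ij by (auto simp: p_def)
  have step: "(f ^^ (p + k)) x = (f ^^ k) x" if k: "k \<ge> i" and x: "x \<in> A" for k x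
  proof -
    obtain d where d: "k = d + i" using k by (metis le_add_diff_inverse2)
    have eq: "(f ^^ j) x = (f ^^ i) x" using ij(2) x by (metis restrict_apply')
    have "p + k = d + j" using d p(2) by simp
    then have "(f ^^ (p + k)) x = (f ^^ d) ((f ^^ j) x)" by (simp only: funpow_add comp_apply)
    then show ?thesis unfolding eq d by (simp add: funpow_add)
  qed
  have step': "(f ^^ (q * p + k)) x = (f ^^ k) x" if "k \<ge> i" "x \<in> A" for k x q
    using that step by (induction q) (auto simp: add.assoc)
  have "(f ^^ (Suc i * p)) ((f ^^ (Suc i * p)) x) = (f ^^ (Suc i * p)) x" if "x \<in> A" for x
  proof -
    have "i \<le> Suc i * p" using p(1) by (cases p) auto
    then have "(f ^^ (Suc i * p + Suc i * p)) x = (f ^^ (Suc i * p)) x" using step' that by blast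
    then show ?thesis by (simp add: funpow_add)
  qed
  then show ?thesis using that[of "Suc i * p"] p(1) by auto
qed

context group
begin

text \<open>An idempotent normal endomorphism \<open>e\<close> splits \<open>G\<close> as the product of its kernel and its
  image; normality makes the two factors commute elementwise.\<close>

lemma indecomposable_idempotent:
  assumes ind: "indecomposable G" and e: "normal_endo G e"
    and idem: "\<And>x. x \<in> carrier G \<Longrightarrow> e (e x) = e x"
  shows "(\<forall>x\<in>carrier G. e x = \<one>) \<or> (\<forall>x\<in>carrier G. e x = \<one> \<longrightarrow> x = \<one>)"
proof -
  have ehom: "e \<in> hom G G" using e by (simp add: normal_endo_def)
  interpret h: group_hom G G e using ehom is_group by (simp add: group_hom_def group_hom_axioms_def)
  define N where "N = kernel G G e"
  define M where "M = e ` carrier G"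
  define A :: "'a monoid" where "A = \<lparr>carrier = N, mult = (\<otimes>), one = \<one>\<rparr>"
  define B :: "'a monoid" where "B = \<lparr>carrier = M, mult = (\<otimes>), one = \<one>\<rparr>"
  have commute: "x \<otimes> e t = e t \<otimes> x" if "x \<in> N" "t \<in> carrier G" for x t
  proof -
    have x: "x \<in> carrier G" "e x = \<one>" using that by (auto simp: N_def kernel_def)
    have "x \<otimes> e t \<otimes> inv x = e (x \<otimes> t \<otimes> inv x)" using normal_endo_conj[OF e x(1) that(2)] by simp
    also have "\<dots> = e t" using x that by simp
    finally show ?thesis using x that by (metis h.hom_closed inv_solve_right m_closed)
  qed
  have gA: "group A"
  proof (rule groupI)
    fix x assume "x \<in> carrier A"
    then have "inv x \<in> carrier A \<and> inv x \<otimes>\<^bsub>A\<^esub> x = \<one>\<^bsub>A\<^esub>" by (auto simp: A_def N_def kernel_def)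
    then show "\<exists>y\<in>carrier A. y \<otimes>\<^bsub>A\<^esub> x = \<one>\<^bsub>A\<^esub>" by blast
  qed (auto simp: A_def N_def kernel_def m_assoc)
  have gB: "group B"
  proof (rule groupI)
    fix x assume "x \<in> carrier B"
    then obtain t where "t \<in> carrier G" "x = e t" by (auto simp: B_def M_def)
    then have "inv x \<in> carrier B \<and> inv x \<otimes>\<^bsub>B\<^esub> x = \<one>\<^bsub>B\<^esub>"
      by (auto simp: B_def M_def intro!: image_eqI[of _ _ "inv t"])
    then show "\<exists>y\<in>carrier B. y \<otimes>\<^bsub>B\<^esub> x = \<one>\<^bsub>B\<^esub>" by blast
  next
    show "\<one>\<^bsub>B\<^esub> \<in> carrier B" by (auto simp: B_def M_def intro!: image_eqI[of _ _ "\<one>"])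
  next
    fix x y assume "x \<in> carrier B" "y \<in> carrier B"
    then show "x \<otimes>\<^bsub>B\<^esub> y \<in> carrier B"
      by (auto simp: B_def M_def) (metis h.hom_mult imageI m_closed)
  qed (auto simp: B_def M_def m_assoc)
  define F where "F x = (x \<otimes> inv (e x), e x)" for x
  have ker: "x \<otimes> inv (e x) \<in> N" if "x \<in> carrier G" for x
    using that by (auto simp: N_def kernel_def idem)
  have "F \<in> iso G (A \<times>\<times> B)"
  proof (rule isoI)
    show "F \<in> hom G (A \<times>\<times> B)"
    proof (rule homI)
      fix x assume "x \<in> carrier G"
      then show "F x \<in> carrier (A \<times>\<times> B)" using ker by (auto simp: F_def DirProd_def A_def B_def M_def)
    next
      fix x y assume xy: "x \<in> carrier G" "y \<in> carrier G"
      have "x \<otimes> y \<otimes> inv (e (x \<otimes> y)) = x \<otimes> ((y \<otimes> inv (e y)) \<otimes> e (inv x))"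
        using xy by (simp add: group_word)
      also have "\<dots> = x \<otimes> (e (inv x) \<otimes> (y \<otimes> inv (e y)))" using commute[OF ker[OF xy(2)], of "inv x"] xy by (simp only: inv_closed)
      finally show "F (x \<otimes> y) = F x \<otimes>\<^bsub>A \<times>\<times> B\<^esub> F y"
        using xy by (simp add: F_def A_def B_def group_word)
    qed
    show "bij_betw F (carrier G) (carrier (A \<times>\<times> B))"
      unfolding bij_betw_def
    proof
      show "inj_on F (carrier G)" by (rule inj_onI) (auto simp: F_def)
      have "(x, e t) \<in> F ` carrier G" if "x \<in> N" "t \<in> carrier G" for x t
      proof -
        have x: "x \<in> carrier G" "e x = \<one>" using that by (auto simp: N_def kernel_def)
        have "F (x \<otimes> e t) = (x, e t)" using x that by (simp add: F_def idem m_assoc)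
        then show ?thesis using x that by (metis h.hom_closed imageI m_closed)
      qed
      then show "F ` carrier G = carrier (A \<times>\<times> B)"
        using ker by (auto simp: A_def B_def M_def F_def DirProd_def)
    qed
  qed
  then have "G \<cong> A \<times>\<times> B" by (auto simp: is_iso_def)
  then have "trivial_group A \<or> trivial_group B" using ind gA gB unfolding indecomposable_def by blast
  then show ?thesis
  proof
    assume "trivial_group A"
    then have "N = {\<one>}" by (simp add: trivial_group_def A_def)
    then show ?thesis by (auto simp: N_def kernel_def)
  next
    assume "trivial_group B"
    then have "M = {\<one>}" by (simp add: trivial_group_def B_def)
    then show ?thesis by (auto simp: M_def)
  qed
qed

text \<open>Fitting's lemma: an idempotent power of \<open>f\<close> splits \<open>G\<close>, so indecomposability makes its image or
  its kernel trivial.\<close>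

lemma fitting_normal_endo:
  assumes "finite (carrier G)" "indecomposable G" "normal_endo G f"
  shows "f \<in> iso G G \<or> (\<exists>m. \<forall>x\<in>carrier G. (f ^^ m) x = \<one>)"
proof -
  have fhom: "f \<in> hom G G" using assms(3) by (simp add: normal_endo_def)
  interpret h: group_hom G G f using fhom is_group by (simp add: group_hom_def group_hom_axioms_def)
  obtain m where m: "m > 0" "\<And>x. x \<in> carrier G \<Longrightarrow> (f ^^ m) ((f ^^ m) x) = (f ^^ m) x"
    using idempotent_power[OF assms(1)] h.hom_closed by metis
  consider "\<forall>x\<in>carrier G. (f ^^ m) x = \<one>" | "\<forall>x\<in>carrier G. (f ^^ m) x = \<one> \<longrightarrow> x = \<one>"
    using indecomposable_idempotent[OF assms(2) normal_endo_funpow[OF assms(3)]] m(2) by blast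
  then show ?thesis
  proof cases
    case 2
    have one: "(f ^^ k) \<one> = \<one>" for k by (induction k) auto
    have "x = \<one>" if "x \<in> carrier G" "f x = \<one>" for x
      using 2 that m(1) one by (metis Suc_pred' comp_apply funpow_Suc_right)
    then have "inj_on f (carrier G)" using h.inj_on_one_iff by blast
    then have "bij_betw f (carrier G) (carrier G)"
      using assms(1) h.hom_closed by (metis bij_betw_def endo_inj_surj image_subsetI)
    then show ?thesis using fhom by (simp add: iso_def)
  qed blast
qed

text \<open>If \<open>f\<close> is onto, everything commutes with the image of \<open>w\<close>.  Then \<open>w\<close> kills all commutators,
  so \<open>f\<close> fixes them.\<close>

lemma central_aut_if_iso:
  assumes w: "normal_endo G w" and f: "normal_endo G f" and iso: "f \<in> iso G G"
    and commute: "\<And>x y. x \<in> carrier G \<Longrightarrow> y \<in> carrier G \<Longrightarrow> w x \<otimes> f y = f y \<otimes> w x"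
    and id: "\<And>x y. x \<in> carrier G \<Longrightarrow> y \<in> carrier G \<Longrightarrow> w (gcomm G x y) \<otimes> f (gcomm G x y) = gcomm G x y"
  shows "w \<in> homs_to_center G \<and> f \<in> central_auts G"
proof -
  have hom: "w \<in> hom G G" "f \<in> hom G G" using w f by (auto simp: normal_endo_def)
  have cl: "\<And>x. x \<in> carrier G \<Longrightarrow> w x \<in> carrier G" "\<And>x. x \<in> carrier G \<Longrightarrow> f x \<in> carrier G"
    using hom by (auto simp: hom_def)
  have surj: "f ` carrier G = carrier G" using iso by (auto simp: iso_def bij_betw_def)
  have wc: "w x \<in> center G" if "x \<in> carrier G" for x
  proof (rule centerI)
    fix y assume "y \<in> carrier G"
    then obtain t where "t \<in> carrier G" "y = f t" using surj by blast
    then show "w x \<otimes> y = y \<otimes> w x" using commute[OF that] by blast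
  qed (use cl that in blast)
  then have "w (gcomm G x y) = \<one>" if "x \<in> carrier G" "y \<in> carrier G" for x y
    using kills_gcomm_iff[OF w] that by blast
  then have "f (gcomm G x y) = gcomm G x y" if "x \<in> carrier G" "y \<in> carrier G" for x y
    using id[OF that] that cl by simp
  then have "\<forall>x\<in>carrier G. inv x \<otimes> f x \<in> center G" using fixes_gcomm_iff[OF f] by blast
  then show ?thesis using wc iso hom by (auto simp: central_auts_def homs_to_center_iff)
qed

text \<open>On commutators \<open>w \<circ> f\<close> is trivial, so \<open>w\<close> is idempotent there.  If \<open>w\<close> is nilpotent, it thus
  kills all commutators and \<open>f\<close> fixes them; as \<open>G\<close> is not abelian, \<open>f\<close> is not nilpotent.\<close>

lemma central_aut_dichotomy:
  assumes fin: "finite (carrier G)" and ind: "indecomposable G" and nonab: "\<not> comm_group G"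
    and w: "normal_endo G w" and f: "normal_endo G f"
    and commute: "\<And>x y. x \<in> carrier G \<Longrightarrow> y \<in> carrier G \<Longrightarrow> w x \<otimes> f y = f y \<otimes> w x"
    and id: "\<And>x y. x \<in> carrier G \<Longrightarrow> y \<in> carrier G \<Longrightarrow> w (gcomm G x y) \<otimes> f (gcomm G x y) = gcomm G x y"
  shows "w \<in> homs_to_center G \<and> f \<in> central_auts G \<or> w \<in> central_auts G \<and> f \<in> homs_to_center G"
proof -
  have hom: "w \<in> hom G G" "f \<in> hom G G" using w f by (auto simp: normal_endo_def)
  interpret w: group_hom G G w using hom is_group by (simp add: group_hom_def group_hom_axioms_def)
  interpret f: group_hom G G f using hom is_group by (simp add: group_hom_def group_hom_axioms_def)
  consider "w \<in> iso G G" | m where "\<forall>x\<in>carrier G. (w ^^ m) x = \<one>"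
    using fitting_normal_endo[OF fin ind w] by blast
  then show ?thesis
  proof cases
    case 1
    have "f \<in> homs_to_center G \<and> w \<in> central_auts G"
      using central_aut_if_iso[OF f w 1] commute id by (metis w.hom_closed f.hom_closed gcomm_closed)
    then show ?thesis by blast
  next
    case 2
    have wc: "w (gcomm G x y) = \<one>" if xy: "x \<in> carrier G" "y \<in> carrier G" for x y
    proof -
      let ?c = "gcomm G x y"
      have "w (f ?c) = gcomm G (w (f x)) (f y)"
        using xy hom_gcomm[OF is_group hom(2)] normal_endo_gcomm(2)[OF w] by simp
      also have "\<dots> = \<one>" using commute[of "f x" y] xy by (simp add: gcomm_eq_one_iff)
      finally have "w (w ?c) = w ?c"
        using xy arg_cong[OF id[OF xy], of w] by simp
      then have "(w ^^ Suc k) ?c = w ?c" for k by (induction k) auto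
      moreover have "(w ^^ Suc m) ?c = \<one>" using 2 xy by simp
      ultimately show ?thesis by metis
    qed
    then have fc: "f (gcomm G x y) = gcomm G x y" if "x \<in> carrier G" "y \<in> carrier G" for x y
      using id[OF that] that by simp
    have "\<not> (\<exists>m. \<forall>x\<in>carrier G. (f ^^ m) x = \<one>)"
    proof
      assume "\<exists>m. \<forall>x\<in>carrier G. (f ^^ m) x = \<one>"
      then obtain m where m: "\<forall>x\<in>carrier G. (f ^^ m) x = \<one>" ..
      have "(f ^^ m) (gcomm G x y) = gcomm G x y" if "x \<in> carrier G" "y \<in> carrier G" for x y
        using fc[OF that] by (induction m) auto
      then have "gcomm G x y = \<one>" if "x \<in> carrier G" "y \<in> carrier G" for x y
        using that m by (metis gcomm_closed)
      then have "comm_group G" by (intro group_comm_groupI) (simp add: gcomm_eq_one_iff)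
      then show False using nonab by simp
    qed
    then have "f \<in> iso G G" using fitting_normal_endo[OF fin ind f] by blast
    then show ?thesis using central_aut_if_iso[OF w f _ commute id] by blast
  qed
qed

end

section \<open>Normal endomorphisms of a direct product\<close>

locale factored_group = group G for G :: "('g, 'm) monoid_scheme" (structure) +
  fixes K :: "nat \<Rightarrow> ('a, 'l) monoid_scheme" and n :: nat and \<theta> :: "(nat \<Rightarrow> 'a) \<Rightarrow> 'g"
  assumes finite_carrier: "finite (carrier G)"
    and abelian_factor: "comm_group (K 0)"
    and nonabelian_factor: "\<And>i. i \<in> {1..n} \<Longrightarrow> group (K i) \<and> \<not> comm_group (K i) \<and> indecomposable (K i)"
    and iso: "\<theta> \<in> iso (product_group {..n} K) G"
begin

abbreviation "incl \<equiv> comp_inj K n \<theta>"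
abbreviation "proj \<equiv> comp_proj K n \<theta>"
abbreviation "diag f i \<equiv> diag_comp K n \<theta> i f"

lemma group_factor: "i \<le> n \<Longrightarrow> group (K i)"
  using abelian_factor nonabelian_factor[of i] by (cases "i = 0") (auto simp: comm_group_def)

lemma group_product: "group (product_group {..n} K)"
  by (rule product_group) (simp add: group_factor)

abbreviation "\<theta>inv \<equiv> inv_into (carrier (product_group {..n} K)) \<theta>"

lemma iso_inv: "\<theta>inv \<in> iso G (product_group {..n} K)"
  using group.iso_set_sym[OF group_product iso] .

lemma \<theta>inv_\<theta>: "f \<in> carrier (product_group {..n} K) \<Longrightarrow> \<theta>inv (\<theta> f) = f"
  using iso by (intro inv_into_f_f) (auto simp: iso_def bij_betw_def)

lemma \<theta>_\<theta>inv: "x \<in> carrier G \<Longrightarrow> \<theta> (\<theta>inv x) = x"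
  using iso f_inv_into_f[of x \<theta> "carrier (product_group {..n} K)"] by (auto simp: iso_def bij_betw_def)

lemma \<theta>_hom: "\<theta> \<in> hom (product_group {..n} K) G"
  using iso by (simp add: iso_def)

lemma \<theta>inv_hom: "\<theta>inv \<in> hom G (product_group {..n} K)"
  using iso_inv by (simp add: iso_def)

lemma \<theta>inv_closed: "x \<in> carrier G \<Longrightarrow> \<theta>inv x \<in> (\<Pi>\<^sub>E i\<in>{..n}. carrier (K i))"
  using hom_in_carrier[OF \<theta>inv_hom] by simp

lemma proj_closed: "i \<le> n \<Longrightarrow> x \<in> carrier G \<Longrightarrow> proj i x \<in> carrier (K i)"
  using \<theta>inv_closed by (auto simp: comp_proj_def)

lemma proj_hom: "i \<le> n \<Longrightarrow> proj i \<in> hom G (K i)"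
proof (rule homI)
  fix x y assume "i \<le> n" "x \<in> carrier G" "y \<in> carrier G"
  then show "proj i (x \<otimes> y) = proj i x \<otimes>\<^bsub>K i\<^esub> proj i y"
    using hom_mult[OF \<theta>inv_hom, of x y] by (simp add: comp_proj_def)
qed (rule proj_closed)

lemma proj_eqI:
  assumes "x \<in> carrier G" "y \<in> carrier G" "\<And>i. i \<le> n \<Longrightarrow> proj i x = proj i y"
  shows "x = y"
proof -
  have "\<theta>inv x = \<theta>inv y"
    using \<theta>inv_closed[OF assms(1)] \<theta>inv_closed[OF assms(2)]
    by (rule PiE_ext) (use assms(3) in \<open>auto simp: comp_proj_def\<close>)
  then show ?thesis using \<theta>_\<theta>inv assms(1,2) by metis
qed

lemma one_closed_factor: "i \<le> n \<Longrightarrow> \<one>\<^bsub>K i\<^esub> \<in> carrier (K i)"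
  using group_factor group.is_monoid monoid.one_closed by blast

lemma incl_closed: "i \<le> n \<Longrightarrow> x \<in> carrier (K i) \<Longrightarrow> incl i x \<in> carrier G"
  unfolding comp_inj_def by (rule hom_in_carrier[OF \<theta>_hom]) (auto simp: one_closed_factor)

lemma proj_incl:
  assumes "i \<le> n" "j \<le> n" "x \<in> carrier (K i)"
  shows "proj j (incl i x) = (if j = i then x else \<one>\<^bsub>K j\<^esub>)"
  using assms unfolding comp_proj_def comp_inj_def
  by (subst \<theta>inv_\<theta>) (auto simp: one_closed_factor)

lemma incl_hom:
  assumes "i \<le> n"
  shows "incl i \<in> hom (K i) G"
proof (rule homI)
  interpret k: group "K i" using group_factor assms .
  fix x y assume xy: "x \<in> carrier (K i)" "y \<in> carrier (K i)"
  show "incl i (x \<otimes>\<^bsub>K i\<^esub> y) = incl i x \<otimes> incl i y"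
  proof (rule proj_eqI)
    fix j assume j: "j \<le> n"
    interpret kj: group "K j" using group_factor j .
    show "proj j (incl i (x \<otimes>\<^bsub>K i\<^esub> y)) = proj j (incl i x \<otimes> incl i y)"
      using assms j xy hom_mult[OF proj_hom[OF j]] by (simp add: proj_incl incl_closed)
  qed (use assms xy incl_closed in auto)
qed (use assms incl_closed in auto)

definition proj_on :: "nat set \<Rightarrow> 'g \<Rightarrow> 'g" where
  "proj_on I x = \<theta> (\<lambda>j\<in>{..n}. if j \<in> I then proj j x else \<one>\<^bsub>K j\<^esub>)"

lemma proj_on_closed [simp]: "x \<in> carrier G \<Longrightarrow> proj_on I x \<in> carrier G"
  unfolding proj_on_def
  by (rule hom_in_carrier[OF \<theta>_hom]) (auto simp: one_closed_factor proj_closed)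

lemma proj_proj_on:
  assumes "x \<in> carrier G" "j \<le> n"
  shows "proj j (proj_on I x) = (if j \<in> I then proj j x else \<one>\<^bsub>K j\<^esub>)"
proof -
  have "(\<lambda>j\<in>{..n}. if j \<in> I then proj j x else \<one>\<^bsub>K j\<^esub>) \<in> carrier (product_group {..n} K)"
    using assms by (auto simp: one_closed_factor proj_closed)
  from \<theta>inv_\<theta>[OF this] show ?thesis
    using assms by (simp add: proj_on_def comp_proj_def[of K n \<theta> j "\<theta> _"])
qed

lemma proj_on_hom: "proj_on I \<in> hom G G"
proof (rule homI)
  fix x y assume xy: "x \<in> carrier G" "y \<in> carrier G"
  show "proj_on I (x \<otimes> y) = proj_on I x \<otimes> proj_on I y"
  proof (rule proj_eqI)
    fix j assume j: "j \<le> n"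
    interpret kj: group "K j" using group_factor j .
    show "proj j (proj_on I (x \<otimes> y)) = proj j (proj_on I x \<otimes> proj_on I y)"
      using xy j hom_mult[OF proj_hom[OF j]] by (simp add: proj_proj_on)
  qed (use xy in auto)
qed simp

lemma proj_inv: "i \<le> n \<Longrightarrow> x \<in> carrier G \<Longrightarrow> proj i (inv x) = inv\<^bsub>K i\<^esub> proj i x"
  using group_hom.hom_inv[of G "K i" "proj i" x] group_factor[of i] proj_hom[of i] is_group
  by (simp add: group_hom_def group_hom_axioms_def)

lemma incl_inv: "i \<le> n \<Longrightarrow> x \<in> carrier (K i) \<Longrightarrow> incl i (inv\<^bsub>K i\<^esub> x) = inv (incl i x)"
  using group_hom.hom_inv[of "K i" G "incl i" x] group_factor[of i] incl_hom[of i] is_group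
  by (simp add: group_hom_def group_hom_axioms_def)

lemma proj_gcomm:
  "i \<le> n \<Longrightarrow> x \<in> carrier G \<Longrightarrow> y \<in> carrier G \<Longrightarrow>
    proj i (gcomm G x y) = gcomm (K i) (proj i x) (proj i y)"
  using hom_gcomm group_factor proj_hom by blast

lemma incl_gcomm:
  "i \<le> n \<Longrightarrow> x \<in> carrier (K i) \<Longrightarrow> y \<in> carrier (K i) \<Longrightarrow>
    incl i (gcomm (K i) x y) = gcomm G (incl i x) (incl i y)"
  using group.hom_gcomm[OF group_factor is_group incl_hom] by blast

lemma proj_on_normal: "normal_endo G (proj_on I)"
  unfolding normal_endo_def
proof (intro conjI ballI proj_on_hom)
  fix g x assume gx: "g \<in> carrier G" "x \<in> carrier G"
  show "proj_on I (g \<otimes> x \<otimes> inv g) = g \<otimes> proj_on I x \<otimes> inv g"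
  proof (rule proj_eqI)
    fix j assume j: "j \<le> n"
    interpret kj: group "K j" using group_factor j .
    show "proj j (proj_on I (g \<otimes> x \<otimes> inv g)) = proj j (g \<otimes> proj_on I x \<otimes> inv g)"
      using gx j by (simp add: proj_proj_on hom_mult[OF proj_hom[OF j]] proj_inv proj_closed)
  qed (use gx in auto)
qed

lemma proj_on_commute:
  assumes "I \<inter> J = {}" "x \<in> carrier G" "y \<in> carrier G"
  shows "proj_on I x \<otimes> proj_on J y = proj_on J y \<otimes> proj_on I x"
proof (rule proj_eqI)
  fix j assume j: "j \<le> n"
  interpret kj: group "K j" using group_factor j .
  show "proj j (proj_on I x \<otimes> proj_on J y) = proj j (proj_on J y \<otimes> proj_on I x)"
    using assms j by (auto simp: proj_proj_on hom_mult[OF proj_hom[OF j]] proj_closed)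
qed (use assms in auto)

lemma gcomm_factor_0: "x \<in> carrier (K 0) \<Longrightarrow> y \<in> carrier (K 0) \<Longrightarrow> gcomm (K 0) x y = \<one>\<^bsub>K 0\<^esub>"
  using group.gcomm_eq_one_iff[OF group_factor[of 0]] comm_groupE(4)[OF abelian_factor] by simp

lemma gcomm_eq_proj_on:
  assumes "I \<subseteq> {1..n}" "x \<in> carrier G" "y \<in> carrier G"
  shows "proj_on ({1..n} - I) (gcomm G x y) \<otimes> proj_on I (gcomm G x y) = gcomm G x y"
proof (rule proj_eqI)
  fix j assume j: "j \<le> n"
  interpret kj: group "K j" using group_factor j .
  let ?d = "gcomm (K j) (proj j x) (proj j y)"
  have d: "?d \<in> carrier (K j)" using assms j by (simp add: proj_closed)
  consider "?d = \<one>\<^bsub>K j\<^esub>" | "j \<in> I" | "j \<in> {1..n} - I"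
    using gcomm_factor_0 proj_closed assms j by (cases "j = 0") auto
  then have "(if j \<in> {1..n} - I then ?d else \<one>\<^bsub>K j\<^esub>) \<otimes>\<^bsub>K j\<^esub> (if j \<in> I then ?d else \<one>\<^bsub>K j\<^esub>) = ?d"
    using d by cases auto
  then show "proj j (proj_on ({1..n} - I) (gcomm G x y) \<otimes> proj_on I (gcomm G x y)) = proj j (gcomm G x y)"
    using assms(2,3) j
    by (simp only: proj_proj_on hom_mult[OF proj_hom[OF j]] proj_gcomm gcomm_closed proj_on_closed)
qed (use assms in auto)

lemma proj_center:
  assumes "z \<in> center G" "i \<le> n"
  shows "proj i z \<in> center (K i)"
proof (rule group.centerI[OF group_factor[OF assms(2)]])
  have z: "z \<in> carrier G" using assms(1) by (rule centerD)
  then show "proj i z \<in> carrier (K i)" using assms(2) by (simp add: proj_closed)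
  fix x assume x: "x \<in> carrier (K i)"
  have "proj i (z \<otimes> incl i x) = proj i (incl i x \<otimes> z)"
    using centerD(2)[OF assms(1) incl_closed[OF assms(2) x]] by simp
  then show "proj i z \<otimes>\<^bsub>K i\<^esub> x = x \<otimes>\<^bsub>K i\<^esub> proj i z"
    using assms(2) x z by (simp add: hom_mult[OF proj_hom[OF assms(2)]] incl_closed proj_incl)
qed

lemma diag_apply: "diag f i x = proj i (f (incl i x))"
  by (simp add: diag_comp_def)

lemma diag_hom:
  assumes "f \<in> hom G G" "i \<le> n"
  shows "diag f i \<in> hom (K i) (K i)"
  using hom_in_carrier[OF assms(1)] assms(2)
  by (intro homI) (simp_all add: diag_apply hom_mult[OF assms(1)] hom_mult[OF incl_hom]
      hom_mult[OF proj_hom] incl_closed proj_closed)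

lemma diag_normal:
  assumes "normal_endo G f" "i \<le> n"
  shows "normal_endo (K i) (diag f i)"
  unfolding normal_endo_def
proof (intro conjI ballI diag_hom normal_endo_hom[OF assms(1)] assms(2))
  interpret k: group "K i" using group_factor assms(2) .
  have f: "f x \<in> carrier G" if "x \<in> carrier G" for x
    using hom_in_carrier[OF normal_endo_hom[OF assms(1)] that] .
  fix g x assume gx: "g \<in> carrier (K i)" "x \<in> carrier (K i)"
  have "diag f i (g \<otimes>\<^bsub>K i\<^esub> x \<otimes>\<^bsub>K i\<^esub> inv\<^bsub>K i\<^esub> g) = proj i (f (incl i g \<otimes> incl i x \<otimes> inv incl i g))"
    using gx assms(2) by (simp add: diag_apply hom_mult[OF incl_hom] incl_inv)
  also have "\<dots> = proj i (incl i g \<otimes> f (incl i x) \<otimes> inv incl i g)"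
    using normal_endo_conj[OF assms(1)] gx assms(2) by (simp add: incl_closed)
  finally show "diag f i (g \<otimes>\<^bsub>K i\<^esub> x \<otimes>\<^bsub>K i\<^esub> inv\<^bsub>K i\<^esub> g) = g \<otimes>\<^bsub>K i\<^esub> diag f i x \<otimes>\<^bsub>K i\<^esub> inv\<^bsub>K i\<^esub> g"
    using gx assms(2) f by (simp add: diag_apply hom_mult[OF proj_hom] incl_closed proj_inv proj_incl)
qed

text \<open>On commutators a normal endomorphism is determined by its diagonal components: the others
  take central values and so kill commutators.\<close>

lemma proj_normal_endo_gcomm:
  assumes f: "normal_endo G f" and j: "j \<le> n" and xy: "x \<in> carrier G" "y \<in> carrier G"
  shows "proj j (f (gcomm G x y)) = diag f j (gcomm (K j) (proj j x) (proj j y))"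
proof -
  have fc: "f x \<in> carrier G" if "x \<in> carrier G" for x
    using hom_in_carrier[OF normal_endo_hom[OF f] that] .
  let ?x = "incl j (proj j x)" and ?y = "incl j (proj j y)"
  have c: "?x \<in> carrier G" "?y \<in> carrier G" using xy j by (auto simp: incl_closed proj_closed)
  have p: "proj j ?x = proj j x" "proj j ?y = proj j y" using xy j by (auto simp: proj_incl proj_closed)
  have "proj j (f (gcomm G x y)) = gcomm (K j) (proj j ?x) (proj j (f y))"
    using normal_endo_gcomm(1)[OF f xy] xy j fc p by (simp add: proj_gcomm)
  also have "\<dots> = proj j (f (gcomm G ?x y))"
    using normal_endo_gcomm(1)[OF f c(1) xy(2)] proj_gcomm[OF j c(1) fc[OF xy(2)]] by simp
  also have "\<dots> = gcomm (K j) (proj j (f ?x)) (proj j ?y)"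
    using normal_endo_gcomm(2)[OF f c(1) xy(2)] proj_gcomm[OF j fc[OF c(1)] xy(2)] p by simp
  also have "\<dots> = proj j (f (gcomm G ?x ?y))"
    using normal_endo_gcomm(2)[OF f c] proj_gcomm[OF j fc[OF c(1)] c(2)] by simp
  also have "gcomm G ?x ?y = incl j (gcomm (K j) (proj j x) (proj j y))"
    using incl_gcomm[OF j] xy j by (simp add: proj_closed)
  finally show ?thesis by (simp add: diag_apply)
qed

lemma finite_factor:
  assumes "i \<le> n"
  shows "finite (carrier (K i))"
proof (rule finite_imageD)
  show "finite (incl i ` carrier (K i))"
    by (rule finite_subset[OF _ finite_carrier]) (use assms incl_closed in auto)
  show "inj_on (incl i) (carrier (K i))"
    by (rule inj_on_inverseI[of _ "proj i"]) (use assms in \<open>simp add: proj_incl\<close>)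
qed

lemma central_auts_normal_fixes:
  assumes "i \<le> n" "normal_endo (K i) f" "f \<in> central_auts (K i)" "x \<in> carrier (K i)" "y \<in> carrier (K i)"
  shows "f (gcomm (K i) x y) = gcomm (K i) x y"
  using group.fixes_gcomm_iff[OF group_factor[OF assms(1)] assms(2)] assms(3-5)
  by (simp add: central_auts_def)

lemma homs_to_center_kills:
  assumes "i \<le> n" "normal_endo (K i) f" "f \<in> homs_to_center (K i)" "x \<in> carrier (K i)" "y \<in> carrier (K i)"
  shows "f (gcomm (K i) x y) = \<one>\<^bsub>K i\<^esub>"
  using group.kills_gcomm_iff[OF group_factor[OF assms(1)] assms(2)] assms(3-5)
  by (simp add: group.homs_to_center_iff[OF group_factor[OF assms(1)]])

lemma nontrivial_gcomm:
  assumes "i \<in> {1..n}"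
  obtains x y where "x \<in> carrier (K i)" "y \<in> carrier (K i)" "gcomm (K i) x y \<noteq> \<one>\<^bsub>K i\<^esub>"
proof -
  interpret k: group "K i" using group_factor assms by simp
  show ?thesis
    using nonabelian_factor[OF assms] k.group_comm_groupI k.gcomm_eq_one_iff that by metis
qed

lemma not_central_aut_and_hom:
  assumes "i \<in> {1..n}" "normal_endo (K i) f" "f \<in> central_auts (K i)" "f \<in> homs_to_center (K i)"
  shows False
proof -
  have i: "i \<le> n" using assms(1) by simp
  obtain x y where "x \<in> carrier (K i)" "y \<in> carrier (K i)" "gcomm (K i) x y \<noteq> \<one>\<^bsub>K i\<^esub>"
    using nontrivial_gcomm[OF assms(1)] .
  then show False
    using central_auts_normal_fixes[OF i assms(2,3)] homs_to_center_kills[OF i assms(2,4)] by metis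
qed

text \<open>Both sides can be tested on one factor at a time, because on commutators \<open>w\<close> and \<open>f\<close> act through
  their diagonal components; the abelian factor contributes nothing.  On an indecomposable factor
  the dichotomy for commuting normal endomorphisms applies.\<close>

theorem gcomm_identity_iff:
  assumes w: "normal_endo G w" and f: "normal_endo G f"
    and commute: "\<And>x y. x \<in> carrier G \<Longrightarrow> y \<in> carrier G \<Longrightarrow> w x \<otimes> f y = f y \<otimes> w x"
  shows "(\<forall>x\<in>carrier G. \<forall>y\<in>carrier G. w (gcomm G x y) \<otimes> f (gcomm G x y) = gcomm G x y) \<longleftrightarrow>
    (\<forall>i\<in>{1..n}. diag w i \<in> homs_to_center (K i) \<and> diag f i \<in> central_auts (K i) \<or>
       diag w i \<in> central_auts (K i) \<and> diag f i \<in> homs_to_center (K i))"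
    (is "?L \<longleftrightarrow> ?R")
proof
  have wc: "w x \<in> carrier G" and fc: "f x \<in> carrier G" if "x \<in> carrier G" for x
    using hom_in_carrier[OF normal_endo_hom[OF w] that] hom_in_carrier[OF normal_endo_hom[OF f] that] .
  assume L: ?L
  show ?R
  proof
    fix i assume i: "i \<in> {1..n}"
    then have i': "i \<le> n" by simp
    interpret k: group "K i" using group_factor i' .
    show "diag w i \<in> homs_to_center (K i) \<and> diag f i \<in> central_auts (K i) \<or>
       diag w i \<in> central_auts (K i) \<and> diag f i \<in> homs_to_center (K i)"
    proof (rule k.central_aut_dichotomy)
      fix x y assume xy: "x \<in> carrier (K i)" "y \<in> carrier (K i)"
      then have c: "incl i x \<in> carrier G" "incl i y \<in> carrier G" using i' by (auto simp: incl_closed)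
      have "proj i (w (incl i x) \<otimes> f (incl i y)) = proj i (f (incl i y) \<otimes> w (incl i x))"
        using commute[OF c] by simp
      then show "diag w i x \<otimes>\<^bsub>K i\<^esub> diag f i y = diag f i y \<otimes>\<^bsub>K i\<^esub> diag w i x"
        using c wc fc by (simp add: diag_apply hom_mult[OF proj_hom[OF i']])
      let ?c = "gcomm (K i) x y"
      have "proj i (w (incl i ?c) \<otimes> f (incl i ?c)) = proj i (incl i ?c)"
        using L c xy i' by (simp add: incl_gcomm)
      then show "diag w i ?c \<otimes>\<^bsub>K i\<^esub> diag f i ?c = ?c"
        using xy i' wc fc by (simp add: diag_apply hom_mult[OF proj_hom[OF i']] incl_closed proj_incl)
    qed (use i' nonabelian_factor[OF i] finite_factor diag_normal w f in auto)
  qed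
next
  have wc: "w x \<in> carrier G" and fc: "f x \<in> carrier G" if "x \<in> carrier G" for x
    using hom_in_carrier[OF normal_endo_hom[OF w] that] hom_in_carrier[OF normal_endo_hom[OF f] that] .
  assume R: ?R
  show ?L
  proof (intro ballI)
    fix x y assume xy: "x \<in> carrier G" "y \<in> carrier G"
    let ?c = "gcomm G x y"
    show "w ?c \<otimes> f ?c = ?c"
    proof (rule proj_eqI)
      fix i assume i: "i \<le> n"
      interpret k: group "K i" using group_factor i .
      let ?d = "gcomm (K i) (proj i x) (proj i y)"
      have dw: "normal_endo (K i) (diag w i)" and df: "normal_endo (K i) (diag f i)"
        using diag_normal w f i by auto
      have "proj i (w ?c \<otimes> f ?c) = diag w i ?d \<otimes>\<^bsub>K i\<^esub> diag f i ?d"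
        using xy wc fc i proj_normal_endo_gcomm[OF w i xy] proj_normal_endo_gcomm[OF f i xy]
        by (simp add: hom_mult[OF proj_hom[OF i]])
      also have "\<dots> = ?d"
      proof (cases "i = 0")
        case True
        have "diag w 0 \<one>\<^bsub>K 0\<^esub> = \<one>\<^bsub>K 0\<^esub>" "diag f 0 \<one>\<^bsub>K 0\<^esub> = \<one>\<^bsub>K 0\<^esub>"
          using hom_one[OF k.normal_endo_hom[OF dw]] hom_one[OF k.normal_endo_hom[OF df]] True k.is_group
          by auto
        moreover have "?d = \<one>\<^bsub>K i\<^esub>" using gcomm_factor_0 xy i True by (simp add: proj_closed)
        ultimately show ?thesis using True k.r_one[OF k.one_closed] by simp
      next
        case False
        then have "i \<in> {1..n}" using i by simp
        with R consider "diag w i \<in> homs_to_center (K i)" "diag f i \<in> central_auts (K i)"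
          | "diag w i \<in> central_auts (K i)" "diag f i \<in> homs_to_center (K i)" by blast
        then show ?thesis
          using homs_to_center_kills[OF i dw] central_auts_normal_fixes[OF i df]
            homs_to_center_kills[OF i df] central_auts_normal_fixes[OF i dw] xy i
          by cases (simp_all add: proj_closed)
      qed
      finally show "proj i (w ?c \<otimes> f ?c) = proj i ?c" using xy i by (simp add: proj_gcomm)
    qed (use xy wc fc in auto)
  qed
qed

text \<open>In each factor \<open>f\<close> fixes or kills the commutators, just as the projection does.  Hence
  \<open>[g, f x] = [g, proj_on I x]\<close> for all \<open>g\<close>, which puts the quotient of \<open>f x\<close> by the projection of \<open>x\<close>
  into the center.\<close>

lemma inv_proj_on_central:
  assumes f: "normal_endo G f" and I: "I \<subseteq> {1..n}"
    and fI: "\<And>i. i \<in> I \<Longrightarrow> diag f i \<in> central_auts (K i)"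
    and fJ: "\<And>i. i \<in> {1..n} - I \<Longrightarrow> diag f i \<in> homs_to_center (K i)"
    and x: "x \<in> carrier G"
  shows "inv (proj_on I x) \<otimes> f x \<in> center G"
proof (rule centerI)
  have fc: "f x \<in> carrier G" if "x \<in> carrier G" for x
    using hom_in_carrier[OF normal_endo_hom[OF f] that] .
  then show "inv (proj_on I x) \<otimes> f x \<in> carrier G" using x by simp
  fix g assume g: "g \<in> carrier G"
  have "gcomm G g (proj_on I x) = gcomm G g (f x)"
  proof (rule proj_eqI)
    fix j assume j: "j \<le> n"
    interpret k: group "K j" using group_factor j .
    let ?d = "gcomm (K j) (proj j g) (proj j x)"
    have df: "normal_endo (K j) (diag f j)" using diag_normal f j by auto
    have "proj j (gcomm G g (f x)) = diag f j ?d"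
      using proj_normal_endo_gcomm[OF f j g x] normal_endo_gcomm(1)[OF f g x] by simp
    also have "\<dots> = (if j \<in> I then ?d else \<one>\<^bsub>K j\<^esub>)"
    proof -
      consider "j = 0" "j \<notin> I" | "j \<in> I" | "j \<in> {1..n} - I" using I j by fastforce
      then show ?thesis
      proof cases
        case 1
        have "?d = \<one>\<^bsub>K j\<^esub>" using gcomm_factor_0 g x j 1 by (simp add: proj_closed)
        moreover have "diag f j \<one>\<^bsub>K j\<^esub> = \<one>\<^bsub>K j\<^esub>"
          using hom_one[OF k.normal_endo_hom[OF df]] k.is_group by auto
        ultimately show ?thesis using 1 by simp
      qed (use fI fJ central_auts_normal_fixes[OF j df] homs_to_center_kills[OF j df] g x j
          in \<open>simp_all add: proj_closed\<close>)
    qed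
    also have "\<dots> = proj j (gcomm G g (proj_on I x))"
      using g x j by (simp add: proj_gcomm proj_proj_on proj_closed)
    finally show "proj j (gcomm G g (proj_on I x)) = proj j (gcomm G g (f x))" by simp
  qed (use g x fc in auto)
  then show "inv (proj_on I x) \<otimes> f x \<otimes> g = g \<otimes> (inv (proj_on I x) \<otimes> f x)"
    using gcomm_inverse_conj[OF g, of "proj_on I x" "f x"] x fc by simp
qed

text \<open>On a factor in \<open>I\<close> but not in \<open>I'\<close> the equation would write every element as a quotient of
  central ones.\<close>

lemma proj_on_central_twist_subset:
  assumes f: "\<And>x. x \<in> carrier G \<Longrightarrow> f x \<in> center G" and f': "\<And>x. x \<in> carrier G \<Longrightarrow> f' x \<in> center G"
    and eq: "\<And>x. x \<in> carrier G \<Longrightarrow> f x \<otimes> proj_on I x = f' x \<otimes> proj_on I' x"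
    and I: "I \<subseteq> {1..n}"
  shows "I \<subseteq> I'"
proof (rule ccontr)
  assume "\<not> I \<subseteq> I'"
  then obtain i where i: "i \<in> I" "i \<notin> I'" by blast
  then have i1: "i \<in> {1..n}" and i': "i \<le> n" using I by auto
  interpret k: group "K i" using group_factor i' .
  have "x \<in> center (K i)" if x: "x \<in> carrier (K i)" for x
  proof -
    have c: "incl i x \<in> carrier G" using x i' by (simp add: incl_closed)
    have fc: "f (incl i x) \<in> center G" "f' (incl i x) \<in> center G" using f f' c by auto
    have p: "proj i (f (incl i x)) \<in> center (K i)" "proj i (f' (incl i x)) \<in> center (K i)"
      using proj_center fc i' by auto
    have "proj i (f (incl i x) \<otimes> proj_on I (incl i x)) = proj i (f' (incl i x) \<otimes> proj_on I' (incl i x))"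
      using eq[OF c] by simp
    then have "proj i (f (incl i x)) \<otimes>\<^bsub>K i\<^esub> x = proj i (f' (incl i x))"
      using centerD(1)[OF fc(1)] centerD(1)[OF fc(2)] c i i' x
      by (simp add: hom_mult[OF proj_hom[OF i']] proj_proj_on proj_incl proj_closed)
    then have "x = inv\<^bsub>K i\<^esub> (proj i (f (incl i x))) \<otimes>\<^bsub>K i\<^esub> proj i (f' (incl i x))"
      using k.mult_eq_iff_left k.centerD(1)[OF p(1)] k.centerD(1)[OF p(2)] x by blast
    then show ?thesis using k.center_mult[OF k.center_inv[OF p(1)] p(2)] by simp
  qed
  then have "comm_group (K i)" by (intro k.group_comm_groupI) (blast dest: k.centerD)
  then show False using nonabelian_factor[OF i1] by simp
qed

end

section \<open>Coefficients of weak $R$-matrices of the double\<close>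

text \<open>Finite dimension and the two unit laws, in terms of structure constants; \<open>c\<close> is unrestricted
  because elements are functions on the whole type.\<close>

definition unital_basis :: "('b, 'k::field) bialg \<Rightarrow> bool" where
  "unital_basis H \<longleftrightarrow> finite (bbasis H) \<and> (\<forall>a\<in>bbasis H. \<forall>c.
     (\<Sum>b\<in>bbasis H. bunit H b * bmul H a b c) = delta a c \<and>
     (\<Sum>b\<in>bbasis H. bunit H b * bmul H b a c) = delta a c)"

lemma sum_perm4:
  fixes F :: "_ \<Rightarrow> _ \<Rightarrow> _ \<Rightarrow> _ \<Rightarrow> 'k::comm_monoid_add"
  shows "(\<Sum>a\<in>A. \<Sum>b\<in>B. \<Sum>c\<in>C. \<Sum>d\<in>D. F a b c d) = (\<Sum>b\<in>B. \<Sum>d\<in>D. \<Sum>a\<in>A. \<Sum>c\<in>C. F a b c d)"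
proof -
  have inner: "(\<Sum>a\<in>A. \<Sum>c\<in>C. \<Sum>d\<in>D. F a b c d) = (\<Sum>d\<in>D. \<Sum>a\<in>A. \<Sum>c\<in>C. F a b c d)" for b
  proof -
    have "(\<Sum>a\<in>A. \<Sum>c\<in>C. \<Sum>d\<in>D. F a b c d) = (\<Sum>a\<in>A. \<Sum>d\<in>D. \<Sum>c\<in>C. F a b c d)"
      by (rule sum.cong[OF refl]) (rule sum.swap)
    also have "\<dots> = (\<Sum>d\<in>D. \<Sum>a\<in>A. \<Sum>c\<in>C. F a b c d)" by (rule sum.swap)
    finally show ?thesis .
  qed
  have "(\<Sum>a\<in>A. \<Sum>b\<in>B. \<Sum>c\<in>C. \<Sum>d\<in>D. F a b c d) = (\<Sum>b\<in>B. \<Sum>a\<in>A. \<Sum>c\<in>C. \<Sum>d\<in>D. F a b c d)"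
    by (rule sum.swap)
  also have "\<dots> = (\<Sum>b\<in>B. \<Sum>d\<in>D. \<Sum>a\<in>A. \<Sum>c\<in>C. F a b c d)"
    by (rule sum.cong[OF refl]) (rule inner)
  finally show ?thesis .
qed

lemma sum_mult_delta:
  assumes "finite B" "c \<notin> B \<Longrightarrow> f c = (0::'k::field)"
  shows "(\<Sum>a\<in>B. f a * delta a c) = f c" "(\<Sum>a\<in>B. delta a c * f a) = f c"
proof -
  have "(\<Sum>a\<in>B. f a * delta a c) = (\<Sum>a\<in>B. if a = c then f a else 0)"
    by (rule sum.cong) (auto simp: delta_def)
  also have "\<dots> = f c" using assms by (simp add: sum.delta)
  finally show "(\<Sum>a\<in>B. f a * delta a c) = f c" .
  then show "(\<Sum>a\<in>B. delta a c * f a) = f c" by (simp add: mult.commute)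
qed

lemma hmult_unit:
  assumes "unital_basis H" "c \<notin> bbasis H \<Longrightarrow> y c = 0"
  shows "(\<Sum>a\<in>bbasis H. \<Sum>b\<in>bbasis H. bunit H a * y b * bmul H a b c) = y c"
    and "(\<Sum>a\<in>bbasis H. \<Sum>b\<in>bbasis H. y a * bunit H b * bmul H a b c) = y c"
proof -
  let ?B = "bbasis H"
  have fin: "finite ?B" and unit: "\<And>a. a \<in> ?B \<Longrightarrow> (\<Sum>b\<in>?B. bunit H b * bmul H a b c) = delta a c"
      "\<And>a. a \<in> ?B \<Longrightarrow> (\<Sum>b\<in>?B. bunit H b * bmul H b a c) = delta a c"
    using assms(1) by (auto simp: unital_basis_def)
  have "(\<Sum>a\<in>?B. \<Sum>b\<in>?B. bunit H a * y b * bmul H a b c) = (\<Sum>b\<in>?B. \<Sum>a\<in>?B. bunit H a * y b * bmul H a b c)"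
    by (rule sum.swap)
  also have "\<dots> = (\<Sum>b\<in>?B. y b * (\<Sum>a\<in>?B. bunit H a * bmul H a b c))"
    by (simp add: sum_distrib_left mult_ac)
  also have "\<dots> = (\<Sum>b\<in>?B. y b * delta b c)" by (rule sum.cong) (simp_all add: unit)
  also have "\<dots> = y c" by (rule sum_mult_delta(1)[where f = y, OF fin assms(2)])
  finally show "(\<Sum>a\<in>?B. \<Sum>b\<in>?B. bunit H a * y b * bmul H a b c) = y c" .
  have "(\<Sum>a\<in>?B. \<Sum>b\<in>?B. y a * bunit H b * bmul H a b c) = (\<Sum>a\<in>?B. y a * (\<Sum>b\<in>?B. bunit H b * bmul H a b c))"
    by (simp add: sum_distrib_left mult_ac)
  also have "\<dots> = (\<Sum>b\<in>?B. y b * delta b c)" by (rule sum.cong) (simp_all add: unit)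
  also have "\<dots> = y c" by (rule sum_mult_delta(1)[where f = y, OF fin assms(2)])
  finally show "(\<Sum>a\<in>?B. \<Sum>b\<in>?B. y a * bunit H b * bmul H a b c) = y c" .
qed

lemma tensor_simps:
  "bbasis (tensor H L) = bbasis H \<times> bbasis L"
  "bmul (tensor H L) (a, b) (c, d) (e, f) = bmul H a c e * bmul L b d f"
  "bunit (tensor H L) (a, b) = bunit H a * bunit L b"
  by (simp_all add: tensor_def pure_tensor_def)

text \<open>In the equations for a weak $R$-matrix each side has a tensor leg on which one of the two
  factors is the unit; there the product is no sum at all.\<close>

lemma hmult_R13_R23:
  assumes H: "unital_basis H" and R: "R \<in> bspace (tensor H H)"
  shows "hmult (tensor H (tensor H H)) (\<lambda>(a, b, c). R (a, c) * bunit H b) (\<lambda>(a, b, c). bunit H a * R (b, c)) (x, y, z)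
    = hmult H (\<lambda>b. R (x, b)) (\<lambda>b. R (y, b)) z"
proof -
  let ?B = "bbasis H" and ?m = "bmul H" and ?u = "bunit H"
  have R0: "R (a, b) = 0" if "a \<notin> ?B \<or> b \<notin> ?B" for a b
    using R that by (auto simp: bspace_def tensor_simps)
  have "hmult (tensor H (tensor H H)) (\<lambda>(a, b, c). R (a, c) * bunit H b) (\<lambda>(a, b, c). bunit H a * R (b, c)) (x, y, z)
    = (\<Sum>a\<in>?B. \<Sum>b\<in>?B. \<Sum>c\<in>?B. \<Sum>a'\<in>?B. \<Sum>b'\<in>?B. \<Sum>c'\<in>?B.
        R (a, c) * ?u b * (?u a' * R (b', c')) * (?m a a' x * (?m b b' y * ?m c c' z)))"
    by (simp add: hmult_def tensor_simps sum.cartesian_product')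
  also have "\<dots> = (\<Sum>a\<in>?B. \<Sum>a'\<in>?B. \<Sum>b\<in>?B. \<Sum>c\<in>?B. \<Sum>b'\<in>?B. \<Sum>c'\<in>?B.
        R (a, c) * ?u b * (?u a' * R (b', c')) * (?m a a' x * (?m b b' y * ?m c c' z)))"
  proof (rule sum.cong[OF refl])
    fix a
    let ?f = "\<lambda>a' b c. \<Sum>b'\<in>?B. \<Sum>c'\<in>?B.
        R (a, c) * ?u b * (?u a' * R (b', c')) * (?m a a' x * (?m b b' y * ?m c c' z))"
    have "(\<Sum>b\<in>?B. \<Sum>c\<in>?B. \<Sum>a'\<in>?B. ?f a' b c) = (\<Sum>b\<in>?B. \<Sum>a'\<in>?B. \<Sum>c\<in>?B. ?f a' b c)"
      by (rule sum.cong[OF refl]) (rule sum.swap)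
    also have "\<dots> = (\<Sum>a'\<in>?B. \<Sum>b\<in>?B. \<Sum>c\<in>?B. ?f a' b c)" by (rule sum.swap)
    finally show "(\<Sum>b\<in>?B. \<Sum>c\<in>?B. \<Sum>a'\<in>?B. ?f a' b c) = (\<Sum>a'\<in>?B. \<Sum>b\<in>?B. \<Sum>c\<in>?B. ?f a' b c)" .
  qed
  also have "\<dots> = (\<Sum>a\<in>?B. \<Sum>a'\<in>?B. (\<Sum>b\<in>?B. \<Sum>c\<in>?B. \<Sum>b'\<in>?B. \<Sum>c'\<in>?B.
        ?u b * R (b', c') * ?m b b' y * (R (a, c) * ?m c c' z)) * ?u a' * ?m a a' x)"
    by (simp add: sum_distrib_left mult_ac)
  also have "\<dots> = (\<Sum>b\<in>?B. \<Sum>c\<in>?B. \<Sum>b'\<in>?B. \<Sum>c'\<in>?B.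
        ?u b * R (b', c') * ?m b b' y * (R (x, c) * ?m c c' z))"
    by (rule hmult_unit(2)[OF H]) (simp add: R0)
  also have "\<dots> = (\<Sum>c\<in>?B. \<Sum>c'\<in>?B. \<Sum>b\<in>?B. \<Sum>b'\<in>?B.
        ?u b * R (b', c') * ?m b b' y * (R (x, c) * ?m c c' z))"
    by (rule sum_perm4)
  also have "\<dots> = (\<Sum>c\<in>?B. \<Sum>c'\<in>?B. (\<Sum>b\<in>?B. \<Sum>b'\<in>?B. ?u b * R (b', c') * ?m b b' y) * (R (x, c) * ?m c c' z))"
    by (simp only: sum_distrib_right)
  also have "\<dots> = (\<Sum>c\<in>?B. \<Sum>c'\<in>?B. R (y, c') * (R (x, c) * ?m c c' z))"
    by (simp add: hmult_unit(1)[OF H, where y = "\<lambda>b'. R (b', _)"] R0)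
  finally show ?thesis by (simp add: hmult_def mult_ac)
qed

lemma hmult_R13_R12:
  assumes H: "unital_basis H" and R: "R \<in> bspace (tensor H H)"
  shows "hmult (tensor H (tensor H H)) (\<lambda>(a, b, c). R (a, c) * bunit H b) (\<lambda>(a, b, c). R (a, b) * bunit H c) (x, y, z)
    = hmult H (\<lambda>a. R (a, z)) (\<lambda>a. R (a, y)) x"
proof -
  let ?B = "bbasis H" and ?m = "bmul H" and ?u = "bunit H"
  have R0: "R (a, b) = 0" if "a \<notin> ?B \<or> b \<notin> ?B" for a b
    using R that by (auto simp: bspace_def tensor_simps)
  have "hmult (tensor H (tensor H H)) (\<lambda>(a, b, c). R (a, c) * bunit H b) (\<lambda>(a, b, c). R (a, b) * bunit H c) (x, y, z)
    = (\<Sum>a\<in>?B. \<Sum>b\<in>?B. \<Sum>c\<in>?B. \<Sum>a'\<in>?B. \<Sum>b'\<in>?B. \<Sum>c'\<in>?B.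
        R (a, c) * ?u b * (R (a', b') * ?u c') * (?m a a' x * (?m b b' y * ?m c c' z)))"
    by (simp add: hmult_def tensor_simps sum.cartesian_product')
  also have "\<dots> = (\<Sum>a\<in>?B. \<Sum>a'\<in>?B. \<Sum>b\<in>?B. \<Sum>b'\<in>?B. \<Sum>c\<in>?B. \<Sum>c'\<in>?B.
        R (a, c) * ?u b * (R (a', b') * ?u c') * (?m a a' x * (?m b b' y * ?m c c' z)))"
  proof (rule sum.cong[OF refl])
    fix a
    let ?f = "\<lambda>b c a' b'. \<Sum>c'\<in>?B.
        R (a, c) * ?u b * (R (a', b') * ?u c') * (?m a a' x * (?m b b' y * ?m c c' z))"
    have "(\<Sum>b\<in>?B. \<Sum>c\<in>?B. \<Sum>a'\<in>?B. \<Sum>b'\<in>?B. ?f b c a' b') = (\<Sum>b\<in>?B. \<Sum>a'\<in>?B. \<Sum>c\<in>?B. \<Sum>b'\<in>?B. ?f b c a' b')"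
      by (rule sum.cong[OF refl]) (rule sum.swap)
    also have "\<dots> = (\<Sum>b\<in>?B. \<Sum>a'\<in>?B. \<Sum>b'\<in>?B. \<Sum>c\<in>?B. ?f b c a' b')"
      by (rule sum.cong[OF refl], rule sum.cong[OF refl]) (rule sum.swap)
    also have "\<dots> = (\<Sum>a'\<in>?B. \<Sum>b\<in>?B. \<Sum>b'\<in>?B. \<Sum>c\<in>?B. ?f b c a' b')" by (rule sum.swap)
    finally show "(\<Sum>b\<in>?B. \<Sum>c\<in>?B. \<Sum>a'\<in>?B. \<Sum>b'\<in>?B. ?f b c a' b') = (\<Sum>a'\<in>?B. \<Sum>b\<in>?B. \<Sum>b'\<in>?B. \<Sum>c\<in>?B. ?f b c a' b')" .
  qed
  also have "\<dots> = (\<Sum>a\<in>?B. \<Sum>a'\<in>?B. \<Sum>b\<in>?B. \<Sum>b'\<in>?B.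
        (\<Sum>c\<in>?B. \<Sum>c'\<in>?B. R (a, c) * ?u c' * ?m c c' z) * (?u b * R (a', b') * ?m b b' y * ?m a a' x))"
    by (simp add: sum_distrib_left sum_distrib_right mult_ac)
  also have "\<dots> = (\<Sum>a\<in>?B. \<Sum>a'\<in>?B. \<Sum>b\<in>?B. \<Sum>b'\<in>?B.
        R (a, z) * (?u b * R (a', b') * ?m b b' y * ?m a a' x))"
    by (simp add: hmult_unit(2)[OF H, where y = "\<lambda>c. R (_, c)"] R0)
  also have "\<dots> = (\<Sum>a\<in>?B. \<Sum>a'\<in>?B. R (a, z) * (\<Sum>b\<in>?B. \<Sum>b'\<in>?B. ?u b * R (a', b') * ?m b b' y) * ?m a a' x)"
    by (simp add: sum_distrib_left sum_distrib_right mult_ac)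
  also have "\<dots> = (\<Sum>a\<in>?B. \<Sum>a'\<in>?B. R (a, z) * R (a', y) * ?m a a' x)"
    by (simp add: hmult_unit(1)[OF H, where y = "\<lambda>c. R (_, c)"] R0)
  finally show ?thesis by (simp add: hmult_def)
qed

lemma weak_R_matrices_iff:
  assumes H: "unital_basis H"
  shows "R \<in> weak_R_matrices H \<longleftrightarrow> R \<in> bspace (tensor H H) \<and>
    (\<forall>a b c. comult H (\<lambda>d. R (d, c)) (a, b) = hmult H (\<lambda>d. R (a, d)) (\<lambda>d. R (b, d)) c) \<and>
    (\<forall>a b c. comult H (\<lambda>d. R (a, d)) (b, c) = hmult H (\<lambda>d. R (d, c)) (\<lambda>d. R (d, b)) a) \<and>
    (\<lambda>b. counit H (\<lambda>a. R (a, b))) = bunit H \<and>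
    (\<lambda>a. counit H (\<lambda>b. R (a, b))) = bunit H"
proof (cases "R \<in> bspace (tensor H H)")
  case True
  show ?thesis
    unfolding weak_R_matrices_def Let_def mem_Collect_eq fun_eq_iff split_paired_All prod.case
      hmult_R13_R23[OF H True] hmult_R13_R12[OF H True]
    using True by blast
qed (simp add: weak_R_matrices_def)

locale finite_group = group G for G :: "('g, 'm) monoid_scheme" (structure) +
  assumes finite_carrier [simp]: "finite (carrier G)"
begin

lemma sum_mult_left: "a \<in> carrier G \<Longrightarrow> (\<Sum>g\<in>carrier G. f (a \<otimes> g)) = (\<Sum>g\<in>carrier G. f g)"
  by (rule sum.reindex_bij_witness[of _ "\<lambda>g. inv a \<otimes> g" "\<lambda>g. a \<otimes> g"]) auto

lemma sum_mult_right: "a \<in> carrier G \<Longrightarrow> (\<Sum>g\<in>carrier G. f (g \<otimes> a)) = (\<Sum>g\<in>carrier G. f g)"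
  by (rule sum.reindex_bij_witness[of _ "\<lambda>g. g \<otimes> inv a" "\<lambda>g. g \<otimes> a"]) (auto simp: m_assoc)

lemma sum_inv_mult: "a \<in> carrier G \<Longrightarrow> (\<Sum>g\<in>carrier G. f (inv g \<otimes> a)) = (\<Sum>g\<in>carrier G. f g)"
  by (rule sum.reindex_bij_witness[of _ "\<lambda>g. a \<otimes> inv g" "\<lambda>g. inv g \<otimes> a"]) (auto simp: group_word)

lemma sum_conj: "a \<in> carrier G \<Longrightarrow> (\<Sum>g\<in>carrier G. f (a \<otimes> g \<otimes> inv a)) = (\<Sum>g\<in>carrier G. f g)"
  by (rule sum.reindex_bij_witness[of _ "\<lambda>g. inv a \<otimes> g \<otimes> a" "\<lambda>g. a \<otimes> g \<otimes> inv a"]) (auto simp: m_assoc)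

abbreviation D :: "('g \<times> 'g, 'k::field) bialg" where "D \<equiv> double G"

lemma hmult_fun_alg:
  "hmult (fun_alg G) f f' z = (if z \<in> carrier G then f z * f' z else 0)"
proof -
  have "hmult (fun_alg G) f f' z = (\<Sum>a\<in>carrier G. (\<Sum>b\<in>carrier G. f' b * delta b z) * f a * delta a z)"
    by (simp add: hmult_def fun_alg_def sum_distrib_left sum_distrib_right mult_ac)
  also have "\<dots> = (if z \<in> carrier G then f z * f' z else 0)"
    by (auto simp: delta_def if_distrib[of "(*) _"] if_distrib[of "\<lambda>x. x * _"] cong: if_cong)
  finally show ?thesis .
qed

lemma conj_act_delta:
  "y \<in> carrier G \<Longrightarrow> conj_act G g (delta y) = delta (g \<otimes> y \<otimes> inv g)"
proof
  fix s assume "y \<in> carrier G"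
  then show "conj_act G g (delta y) s = (delta (g \<otimes> y \<otimes> inv g) s :: 'k::field)"
    unfolding conj_act_def
    by (subst (2) delta_def) (simp add: delta_def if_distrib[of "\<lambda>x. x * _"] cong: if_cong)
qed

lemma double_simps [simp]:
  "bbasis D = carrier G \<times> carrier G"
  "bunit D (x, g) = (if x \<in> carrier G \<and> g = \<one> then 1 else 0)"
  by (simp_all add: double_def tensor_def cop_def fun_alg_def group_alg_def pure_tensor_def delta_def)

lemma bmul_double:
  assumes "x \<in> carrier G" "g \<in> carrier G" "y \<in> carrier G" "h \<in> carrier G"
  shows "bmul D (x, g) (y, h) (s, a) =
    (if x = s \<and> s = g \<otimes> y \<otimes> inv g \<and> a = g \<otimes> h then 1 else 0)"
  using assms by (simp add: double_def pure_tensor_def conj_act_delta hmult_fun_alg) (auto simp: delta_def)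

lemma bmul_double_outside:
  assumes "p \<in> carrier G \<times> carrier G" "q \<in> carrier G \<times> carrier G" "s \<notin> carrier G \<or> a \<notin> carrier G"
  shows "bmul D p q (s, a) = 0"
proof -
  obtain x g y h where pq: "p = (x, g)" "q = (y, h)" "x \<in> carrier G" "g \<in> carrier G" "y \<in> carrier G" "h \<in> carrier G"
    using assms(1,2) by auto
  have "\<not> (x = s \<and> a = g \<otimes> h)" using assms(3) pq by auto
  then show ?thesis using pq by (auto simp: bmul_double)
qed

lemma bmul_double_in:
  assumes "x \<in> carrier G" "g \<in> carrier G" "y \<in> carrier G" "h \<in> carrier G" "s \<in> carrier G" "a \<in> carrier G"
  shows "bmul D (x, g) (y, h) (s, a) =
    (if x = s then if (y, h) = (inv g \<otimes> s \<otimes> g, inv g \<otimes> a) then 1 else 0 else 0)"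
proof -
  have "s = g \<otimes> y \<otimes> inv g \<longleftrightarrow> y = inv g \<otimes> s \<otimes> g"
    using assms by (auto simp: m_assoc)
  moreover have "a = g \<otimes> h \<longleftrightarrow> h = inv g \<otimes> a" using assms by auto
  ultimately show ?thesis using assms by (simp add: bmul_double)
qed

lemma sum_bmul_double:
  assumes "s \<in> carrier G" "a \<in> carrier G"
  shows "(\<Sum>p\<in>carrier G \<times> carrier G. \<Sum>q\<in>carrier G \<times> carrier G. f p q * bmul D p q (s, a)) =
    (\<Sum>g\<in>carrier G. f (s, g) (inv g \<otimes> s \<otimes> g, inv g \<otimes> a))"
proof -
  have inner: "(\<Sum>q\<in>carrier G \<times> carrier G. f (x, g) q * bmul D (x, g) q (s, a)) =
      (if x = s then f (s, g) (inv g \<otimes> s \<otimes> g, inv g \<otimes> a) else 0)"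
    if xg: "x \<in> carrier G" "g \<in> carrier G" for x g
  proof -
    let ?t = "(inv g \<otimes> s \<otimes> g, inv g \<otimes> a)"
    have "(\<Sum>q\<in>carrier G \<times> carrier G. f (x, g) q * bmul D (x, g) q (s, a)) =
      (\<Sum>q\<in>carrier G \<times> carrier G. if q = ?t then (if x = s then f (s, g) ?t else 0) else 0)"
    proof (rule sum.cong[OF refl])
      fix q assume "q \<in> carrier G \<times> carrier G"
      then show "f (x, g) q * bmul D (x, g) q (s, a) = (if q = ?t then (if x = s then f (s, g) ?t else 0) else 0)"
        using xg assms by (cases q) (auto simp: bmul_double_in)
    qed
    also have "\<dots> = (if x = s then f (s, g) ?t else 0)" using xg assms by (simp add: sum.delta)
    finally show ?thesis .
  qed
  have "(\<Sum>p\<in>carrier G \<times> carrier G. \<Sum>q\<in>carrier G \<times> carrier G. f p q * bmul D p q (s, a)) =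
    (\<Sum>x\<in>carrier G. \<Sum>g\<in>carrier G. if x = s then f (s, g) (inv g \<otimes> s \<otimes> g, inv g \<otimes> a) else 0)"
    by (rule trans[OF sum.cartesian_product']) (intro sum.cong refl inner)
  also have "\<dots> = (\<Sum>g\<in>carrier G. \<Sum>x\<in>carrier G. if x = s then f (s, g) (inv g \<otimes> s \<otimes> g, inv g \<otimes> a) else 0)"
    by (rule sum.swap)
  finally show ?thesis using assms by (simp add: sum.delta)
qed

lemma hmult_double:
  assumes "s \<in> carrier G" "a \<in> carrier G"
  shows "hmult D X Y (s, a) = (\<Sum>g\<in>carrier G. X (s, g) * Y (inv g \<otimes> s \<otimes> g, inv g \<otimes> a))"
  unfolding hmult_def double_simps by (rule sum_bmul_double[OF assms])

lemma hmult_double_outside: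
  assumes "s \<notin> carrier G \<or> a \<notin> carrier G"
  shows "hmult D X Y (s, a) = 0"
  unfolding hmult_def double_simps by (intro sum.neutral ballI) (simp add: bmul_double_outside[OF _ _ assms])

lemma hmult_double_double:
  assumes "s \<in> carrier G" "a \<in> carrier G" "y \<in> carrier G" "h \<in> carrier G"
  shows "hmult (tensor D D) X Y ((s, a), (y, h)) = (\<Sum>\<alpha>\<in>carrier G. \<Sum>\<beta>\<in>carrier G. X ((s, \<alpha>), (y, \<beta>)) *
    Y ((inv \<alpha> \<otimes> s \<otimes> \<alpha>, inv \<alpha> \<otimes> a), (inv \<beta> \<otimes> y \<otimes> \<beta>, inv \<beta> \<otimes> h)))"
proof -
  let ?C = "carrier G \<times> carrier G"
  have "hmult (tensor D D) X Y ((s, a), (y, h)) =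
    (\<Sum>p\<in>?C. \<Sum>p'\<in>?C. \<Sum>q\<in>?C. \<Sum>q'\<in>?C. X (p, p') * Y (q, q') * (bmul D p q (s, a) * bmul D p' q' (y, h)))"
    by (simp add: hmult_def tensor_simps sum.cartesian_product'[of _ "?C" "?C"])
  also have "\<dots> = (\<Sum>p\<in>?C. \<Sum>q\<in>?C. (\<Sum>p'\<in>?C. \<Sum>q'\<in>?C. X (p, p') * Y (q, q') * bmul D p' q' (y, h)) * bmul D p q (s, a))"
  proof (rule sum.cong[OF refl])
    fix p
    have "(\<Sum>p'\<in>?C. \<Sum>q\<in>?C. \<Sum>q'\<in>?C. X (p, p') * Y (q, q') * (bmul D p q (s, a) * bmul D p' q' (y, h))) =
      (\<Sum>q\<in>?C. \<Sum>p'\<in>?C. \<Sum>q'\<in>?C. X (p, p') * Y (q, q') * (bmul D p q (s, a) * bmul D p' q' (y, h)))"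
      by (rule sum.swap)
    then show "(\<Sum>p'\<in>?C. \<Sum>q\<in>?C. \<Sum>q'\<in>?C. X (p, p') * Y (q, q') * (bmul D p q (s, a) * bmul D p' q' (y, h))) =
      (\<Sum>q\<in>?C. (\<Sum>p'\<in>?C. \<Sum>q'\<in>?C. X (p, p') * Y (q, q') * bmul D p' q' (y, h)) * bmul D p q (s, a))"
      by (simp add: sum_distrib_left sum_distrib_right mult_ac)
  qed
  also have "\<dots> = (\<Sum>\<alpha>\<in>carrier G. \<Sum>p'\<in>?C. \<Sum>q'\<in>?C.
      X ((s, \<alpha>), p') * Y ((inv \<alpha> \<otimes> s \<otimes> \<alpha>, inv \<alpha> \<otimes> a), q') * bmul D p' q' (y, h))"
    by (rule sum_bmul_double[OF assms(1,2)])
  also have "\<dots> = (\<Sum>\<alpha>\<in>carrier G. \<Sum>\<beta>\<in>carrier G. X ((s, \<alpha>), (y, \<beta>)) *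
    Y ((inv \<alpha> \<otimes> s \<otimes> \<alpha>, inv \<alpha> \<otimes> a), (inv \<beta> \<otimes> y \<otimes> \<beta>, inv \<beta> \<otimes> h)))"
    by (intro sum.cong refl) (rule sum_bmul_double[OF assms(3,4)])
  finally show ?thesis .
qed

lemma hmult_double_double_outside:
  fixes X Y :: "('g \<times> 'g) \<times> ('g \<times> 'g) \<Rightarrow> 'k::field"
  assumes "\<not> (s \<in> carrier G \<and> a \<in> carrier G \<and> y \<in> carrier G \<and> h \<in> carrier G)"
  shows "hmult (tensor D D) X Y ((s, a), (y, h)) = 0"
proof -
  have "bmul (tensor D D) p q ((s, a), (y, h)) = (0 :: 'k)"
    if "p \<in> bbasis (tensor D D :: (_, 'k) bialg)" "q \<in> bbasis (tensor D D :: (_, 'k) bialg)" for p q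
  proof -
    obtain p1 p2 q1 q2 where pq: "p = (p1, p2)" "q = (q1, q2)" by (metis surj_pair)
    then have "bmul D p1 q1 (s, a) = (0 :: 'k) \<or> bmul D p2 q2 (y, h) = (0 :: 'k)"
      using that assms bmul_double_outside by (metis double_simps(1) mem_Sigma_iff tensor_simps(1))
    then show ?thesis unfolding pq tensor_simps by simp
  qed
  then show ?thesis unfolding hmult_def by (intro sum.neutral ballI) simp
qed

lemma comult_double:
  assumes "b \<in> carrier G" "g \<in> carrier G" "c \<in> carrier G"
  shows "comult D X ((b, g), (c, h)) = (if g = h then X (c \<otimes> b, g) else 0)"
proof -
  have "comult D X ((b, g), (c, h)) = (\<Sum>p\<in>carrier G \<times> carrier G.
      if p = (c \<otimes> b, g) then (if g = h then X (c \<otimes> b, g) else 0) else 0)"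
    unfolding comult_def double_simps
    by (intro sum.cong refl)
      (use assms in \<open>auto simp: double_def tensor_def cop_def fun_alg_def group_alg_def delta_def split: if_splits\<close>)
  then show ?thesis using assms by (simp add: sum.delta)
qed

lemma comult_double_outside:
  assumes "\<not> (b \<in> carrier G \<and> g \<in> carrier G \<and> c \<in> carrier G \<and> h \<in> carrier G)"
  shows "comult D X ((b, g), (c, h)) = 0"
  unfolding comult_def double_simps
  by (intro sum.neutral ballI)
    (use assms in \<open>auto simp: double_def tensor_def cop_def fun_alg_def group_alg_def delta_def split: if_splits\<close>)

lemma counit_double: "counit D X = (\<Sum>g\<in>carrier G. X (\<one>, g))"
proof -
  have "counit D X = (\<Sum>x\<in>carrier G. \<Sum>g\<in>carrier G. if x = \<one> then X (\<one>, g) else 0)"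
    unfolding counit_def double_simps sum.cartesian_product'
    by (intro sum.cong refl)
      (auto simp: double_def tensor_def cop_def fun_alg_def group_alg_def delta_def)
  also have "\<dots> = (\<Sum>g\<in>carrier G. \<Sum>x\<in>carrier G. if x = \<one> then X (\<one>, g) else 0)"
    by (rule sum.swap)
  finally show ?thesis by (simp add: sum.delta)
qed

lemma unital_basis_double: "unital_basis (D :: ('g \<times> 'g, 'k::field) bialg)"
  unfolding unital_basis_def
proof (intro conjI ballI allI)
  let ?D = "D :: ('g \<times> 'g, 'k) bialg"
  fix a c :: "'g \<times> 'g" assume a: "a \<in> bbasis ?D"
  then obtain x g where xg: "a = (x, g)" "x \<in> carrier G" "g \<in> carrier G" by auto
  obtain s t where c: "c = (s, t)" by (cases c)
  let ?C = "carrier G \<times> carrier G"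
  have "(\<Sum>b\<in>?C. bunit ?D b * bmul ?D a b c) = (\<Sum>b\<in>?C. if b = (inv g \<otimes> x \<otimes> g, \<one>) then delta a c else 0)"
  proof (rule sum.cong[OF refl])
    fix b assume "b \<in> ?C"
    then obtain y h where b: "b = (y, h)" "y \<in> carrier G" "h \<in> carrier G" by auto
    have "x = g \<otimes> y \<otimes> inv g \<longleftrightarrow> y = inv g \<otimes> x \<otimes> g" using xg b by (auto simp: m_assoc)
    then have "x = s \<and> s = g \<otimes> y \<otimes> inv g \<and> t = g \<otimes> h \<longleftrightarrow> x = s \<and> y = inv g \<otimes> x \<otimes> g \<and> t = g \<otimes> h"
      by blast
    then have "bmul ?D a b c = (if x = s \<and> y = inv g \<otimes> x \<otimes> g \<and> t = g \<otimes> h then 1 else 0)"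
      unfolding xg(1) b(1) c bmul_double[OF xg(2,3) b(2,3)] by (simp only:)
    then show "bunit ?D b * bmul ?D a b c = (if b = (inv g \<otimes> x \<otimes> g, \<one>) then delta a c else 0)"
      using xg b c by (auto simp: delta_def)
  qed
  then show "(\<Sum>b\<in>bbasis ?D. bunit ?D b * bmul ?D a b c) = delta a c" using xg by (simp add: sum.delta)
  have "(\<Sum>b\<in>?C. bunit ?D b * bmul ?D b a c) = (\<Sum>b\<in>?C. if b = (x, \<one>) then delta a c else 0)"
  proof (rule sum.cong[OF refl])
    fix b assume "b \<in> ?C"
    then obtain y h where b: "b = (y, h)" "y \<in> carrier G" "h \<in> carrier G" by auto
    show "bunit ?D b * bmul ?D b a c = (if b = (x, \<one>) then delta a c else 0)"
    proof (cases "h = \<one>")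
      case True
      have e: "bmul ?D (y, \<one>) (x, g) (s, t) = (if y = s \<and> s = x \<and> t = g then 1 else 0)"
        unfolding bmul_double[OF b(2) one_closed xg(2,3)] using xg(2,3) by simp
      have "(if y \<in> carrier G \<and> \<one> = \<one> then 1 else 0) * (if y = s \<and> s = x \<and> t = g then 1 else 0) =
          (if (y, \<one>) = (x, \<one>) then if (s, t) = (x, g) then 1 else 0 else (0 :: 'k))"
        using b(2) by (cases "s = x") auto
      then show ?thesis
        unfolding b(1) xg(1) c True double_simps delta_def e .
    next
      case False
      then show ?thesis unfolding b(1) by simp
    qed
  qed
  then show "(\<Sum>b\<in>bbasis ?D. bunit ?D b * bmul ?D b a c) = delta a c" using xg by (simp add: sum.delta)
qed simp

text \<open>Here \<open>R ((s, a), (y, h))\<close> is the coefficient of $e_s \bowtie a \otimes e_y \bowtie h$.  After the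
  vanishing condition, the clauses are the coefficient forms of
  $(\Delta \otimes \mathrm{id})(R) = R^{13} R^{23}$, of $(\mathrm{id} \otimes \Delta)(R) = R^{13} R^{12}$ and
  of the two counit conditions.\<close>

definition weak_coeffs :: "(('g \<times> 'g) \<times> ('g \<times> 'g) \<Rightarrow> 'k::field) \<Rightarrow> bool" where
  "weak_coeffs R \<longleftrightarrow>
    (\<forall>s a y h. \<not> (s \<in> carrier G \<and> a \<in> carrier G \<and> y \<in> carrier G \<and> h \<in> carrier G) \<longrightarrow> R ((s, a), (y, h)) = 0) \<and>
    (\<forall>s\<in>carrier G. \<forall>a\<in>carrier G. \<forall>s'\<in>carrier G. \<forall>a'\<in>carrier G. \<forall>x\<in>carrier G. \<forall>k\<in>carrier G.
      (\<Sum>g\<in>carrier G. R ((s, a), (x, g)) * R ((s', a'), (inv g \<otimes> x \<otimes> g, inv g \<otimes> k))) =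
      (if a = a' then R ((s' \<otimes> s, a), (x, k)) else 0)) \<and>
    (\<forall>s\<in>carrier G. \<forall>c\<in>carrier G. \<forall>b\<in>carrier G. \<forall>g\<in>carrier G. \<forall>y\<in>carrier G. \<forall>h\<in>carrier G.
      (\<Sum>a\<in>carrier G. R ((s, a), (y, h)) * R ((inv a \<otimes> s \<otimes> a, inv a \<otimes> c), (b, g))) =
      (if g = h then R ((s, c), (y \<otimes> b, g)) else 0)) \<and>
    (\<forall>x\<in>carrier G. \<forall>h\<in>carrier G. (\<Sum>a\<in>carrier G. R ((\<one>, a), (x, h))) = (if h = \<one> then 1 else 0)) \<and>
    (\<forall>s\<in>carrier G. \<forall>a\<in>carrier G. (\<Sum>h\<in>carrier G. R ((s, a), (\<one>, h))) = (if a = \<one> then 1 else 0))"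

lemma weak_R_matrices_double_iff:
  fixes R :: "('g \<times> 'g) \<times> ('g \<times> 'g) \<Rightarrow> 'k::field"
  shows "R \<in> weak_R_matrices D \<longleftrightarrow> weak_coeffs R"
proof -
  let ?V = "\<forall>s a y h. \<not> (s \<in> carrier G \<and> a \<in> carrier G \<and> y \<in> carrier G \<and> h \<in> carrier G) \<longrightarrow> R ((s, a), (y, h)) = 0"
  have V: "R \<in> bspace (tensor D D) \<longleftrightarrow> ?V" by (auto simp: bspace_def tensor_simps)
  have 1: "(\<forall>a b c. comult D (\<lambda>d. R (d, c)) (a, b) = hmult D (\<lambda>d. R (a, d)) (\<lambda>d. R (b, d)) c) \<longleftrightarrow>
    (\<forall>s\<in>carrier G. \<forall>a\<in>carrier G. \<forall>s'\<in>carrier G. \<forall>a'\<in>carrier G. \<forall>x\<in>carrier G. \<forall>k\<in>carrier G.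
      (\<Sum>g\<in>carrier G. R ((s, a), (x, g)) * R ((s', a'), (inv g \<otimes> x \<otimes> g, inv g \<otimes> k))) =
      (if a = a' then R ((s' \<otimes> s, a), (x, k)) else 0))" (is "?L \<longleftrightarrow> ?M") if v: ?V
  proof
    assume L: ?L
    show ?M
    proof (intro ballI)
      fix s a s' a' x k assume c: "s \<in> carrier G" "a \<in> carrier G" "s' \<in> carrier G" "a' \<in> carrier G" "x \<in> carrier G" "k \<in> carrier G"
      from L have "comult D (\<lambda>d. R (d, (x, k))) ((s, a), (s', a')) = hmult D (\<lambda>d. R ((s, a), d)) (\<lambda>d. R ((s', a'), d)) (x, k)"
        by blast
      then show "(\<Sum>g\<in>carrier G. R ((s, a), (x, g)) * R ((s', a'), (inv g \<otimes> x \<otimes> g, inv g \<otimes> k))) =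
        (if a = a' then R ((s' \<otimes> s, a), (x, k)) else 0)"
        using c by (simp add: comult_double hmult_double)
    qed
  next
    assume M: ?M
    have "comult D (\<lambda>d. R (d, (x, k))) ((s, a), (s', a')) = hmult D (\<lambda>d. R ((s, a), d)) (\<lambda>d. R ((s', a'), d)) (x, k)"
      for s a s' a' x k
    proof (cases "s \<in> carrier G \<and> a \<in> carrier G \<and> s' \<in> carrier G \<and> a' \<in> carrier G")
      case True
      show ?thesis
      proof (cases "x \<in> carrier G \<and> k \<in> carrier G")
        case xk: True
        then show ?thesis using True M by (simp add: comult_double hmult_double)
      next
        case False
        then show ?thesis using True v by (auto simp: comult_double hmult_double_outside)
      qed
    next
      case False
      then have "R ((s, a), p) = 0 \<or> R ((s', a'), q) = 0" for p q using v by (cases p; cases q) auto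
      then have "hmult D (\<lambda>d. R ((s, a), d)) (\<lambda>d. R ((s', a'), d)) (x, k) = 0"
        unfolding hmult_def by (intro sum.neutral ballI) simp
      then show ?thesis using False by (simp add: comult_double_outside)
    qed
    then show ?L by (simp only: split_paired_All) blast
  qed
  have 2: "(\<forall>a b c. comult D (\<lambda>d. R (a, d)) (b, c) = hmult D (\<lambda>d. R (d, c)) (\<lambda>d. R (d, b)) a) \<longleftrightarrow>
    (\<forall>s\<in>carrier G. \<forall>c\<in>carrier G. \<forall>b\<in>carrier G. \<forall>g\<in>carrier G. \<forall>y\<in>carrier G. \<forall>h\<in>carrier G.
      (\<Sum>a\<in>carrier G. R ((s, a), (y, h)) * R ((inv a \<otimes> s \<otimes> a, inv a \<otimes> c), (b, g))) =
      (if g = h then R ((s, c), (y \<otimes> b, g)) else 0))" (is "?L \<longleftrightarrow> ?M") if v: ?V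
  proof
    assume L: ?L
    show ?M
    proof (intro ballI)
      fix s c b g y h assume c: "s \<in> carrier G" "c \<in> carrier G" "b \<in> carrier G" "g \<in> carrier G" "y \<in> carrier G" "h \<in> carrier G"
      from L have "comult D (\<lambda>d. R ((s, c), d)) ((b, g), (y, h)) = hmult D (\<lambda>d. R (d, (y, h))) (\<lambda>d. R (d, (b, g))) (s, c)"
        by blast
      then show "(\<Sum>a\<in>carrier G. R ((s, a), (y, h)) * R ((inv a \<otimes> s \<otimes> a, inv a \<otimes> c), (b, g))) =
        (if g = h then R ((s, c), (y \<otimes> b, g)) else 0)"
        using c by (simp add: comult_double hmult_double)
    qed
  next
    assume M: ?M
    have "comult D (\<lambda>d. R ((s, c), d)) ((b, g), (y, h)) = hmult D (\<lambda>d. R (d, (y, h))) (\<lambda>d. R (d, (b, g))) (s, c)"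
      for s c b g y h
    proof (cases "b \<in> carrier G \<and> g \<in> carrier G \<and> y \<in> carrier G \<and> h \<in> carrier G")
      case True
      show ?thesis
      proof (cases "s \<in> carrier G \<and> c \<in> carrier G")
        case sc: True
        then show ?thesis using True M by (simp add: comult_double hmult_double)
      next
        case False
        then show ?thesis using True v by (auto simp: comult_double hmult_double_outside)
      qed
    next
      case False
      then have "R (p, (y, h)) = 0 \<or> R (q, (b, g)) = 0" for p q using v by (cases p; cases q) auto
      then have "hmult D (\<lambda>d. R (d, (y, h))) (\<lambda>d. R (d, (b, g))) (s, c) = 0"
        unfolding hmult_def by (intro sum.neutral ballI) simp
      then show ?thesis using False by (simp add: comult_double_outside)
    qed
    then show ?L by (simp only: split_paired_All) blast
  qed
  have 3: "(\<lambda>b. counit D (\<lambda>a. R (a, b))) = bunit D \<longleftrightarrow>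
     (\<forall>x\<in>carrier G. \<forall>h\<in>carrier G. (\<Sum>a\<in>carrier G. R ((\<one>, a), (x, h))) = (if h = \<one> then 1 else 0))" if v: ?V
  proof -
    have "(\<Sum>a\<in>carrier G. R ((\<one>, a), (x, h))) = bunit D (x, h)" if "\<not> (x \<in> carrier G \<and> h \<in> carrier G)" for x h
      using that v by (auto intro!: sum.neutral)
    then have "(\<forall>x h. (\<Sum>a\<in>carrier G. R ((\<one>, a), (x, h))) = bunit D (x, h)) \<longleftrightarrow>
      (\<forall>x\<in>carrier G. \<forall>h\<in>carrier G. (\<Sum>a\<in>carrier G. R ((\<one>, a), (x, h))) = bunit D (x, h))" by blast
    then show ?thesis unfolding fun_eq_iff split_paired_All counit_double by simp
  qed
  have 4: "(\<lambda>a. counit D (\<lambda>b. R (a, b))) = bunit D \<longleftrightarrow>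
     (\<forall>s\<in>carrier G. \<forall>a\<in>carrier G. (\<Sum>h\<in>carrier G. R ((s, a), (\<one>, h))) = (if a = \<one> then 1 else 0))" if v: ?V
  proof -
    have "(\<Sum>h\<in>carrier G. R ((s, a), (\<one>, h))) = bunit D (s, a)" if "\<not> (s \<in> carrier G \<and> a \<in> carrier G)" for s a
      using that v by (auto intro!: sum.neutral)
    then have "(\<forall>s a. (\<Sum>h\<in>carrier G. R ((s, a), (\<one>, h))) = bunit D (s, a)) \<longleftrightarrow>
      (\<forall>s\<in>carrier G. \<forall>a\<in>carrier G. (\<Sum>h\<in>carrier G. R ((s, a), (\<one>, h))) = bunit D (s, a))" by blast
    then show ?thesis unfolding fun_eq_iff split_paired_All counit_double by simp
  qed
  show ?thesis
  proof (cases ?V)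
    case True
    show ?thesis
      unfolding weak_R_matrices_iff[OF unital_basis_double] weak_coeffs_def V
        1[OF True] 2[OF True] 3[OF True] 4[OF True] ..
  next
    case False
    then show ?thesis
      unfolding weak_R_matrices_iff[OF unital_basis_double] weak_coeffs_def V by (simp only: False simp_thms)
  qed
qed

text \<open>The coefficient form of the commutation of \<open>R\<close> with coproducts.  The map \<open>m\<close> is the order in
  which the two function legs are multiplied: \<open>s \<otimes> y\<close> for the flipped coproduct and \<open>y \<otimes> s\<close> for the
  coproduct itself.\<close>

definition support_law :: "('g \<Rightarrow> 'g \<Rightarrow> 'g) \<Rightarrow> (('g \<times> 'g) \<times> ('g \<times> 'g) \<Rightarrow> 'k::field) \<Rightarrow> bool" where
  "support_law m R \<longleftrightarrow> (\<forall>s\<in>carrier G. \<forall>a\<in>carrier G. \<forall>y\<in>carrier G. \<forall>h\<in>carrier G.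
    (R ((s, a), (y, h)) \<noteq> 0 \<longrightarrow> m s y = (inv h \<otimes> y \<otimes> h) \<otimes> (inv a \<otimes> s \<otimes> a)) \<and>
    (\<forall>g\<in>carrier G. R ((inv g \<otimes> s \<otimes> g, inv g \<otimes> a \<otimes> g), (inv g \<otimes> y \<otimes> g, inv g \<otimes> h \<otimes> g)) = R ((s, a), (y, h))))"

text \<open>Multiplication by the coproduct of $e_x \bowtie g$ translates the group elements of \<open>R\<close> by \<open>g\<close>
  from one side and selects the coefficients with a given product of function legs; comparing both
  sides for all \<open>x\<close> and \<open>g\<close> gives the law.\<close>

lemma commutation_iff_support_law:
  fixes R :: "('g \<times> 'g) \<times> ('g \<times> 'g) \<Rightarrow> 'k::field"
  assumes m: "\<And>s y. s \<in> carrier G \<Longrightarrow> y \<in> carrier G \<Longrightarrow> m s y \<in> carrier G"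
    and E: "\<And>X s a y h. s \<in> carrier G \<Longrightarrow> a \<in> carrier G \<Longrightarrow> y \<in> carrier G \<Longrightarrow> h \<in> carrier G \<Longrightarrow>
      E X ((s, a), (y, h)) = (if a = h then X (m s y, a) else 0)"
  shows "(\<forall>X\<in>bspace D. hmult (tensor D D) R (comult D X) = hmult (tensor D D) (E X) R) \<longleftrightarrow> support_law m R"
    (is "?L \<longleftrightarrow> _")
proof -
  have lhs: "hmult (tensor D D) R (comult D X) ((s, a), (y, h)) =
      (\<Sum>g\<in>carrier G. R ((s, a \<otimes> inv g), (y, h \<otimes> inv g)) *
        X ((inv (h \<otimes> inv g) \<otimes> y \<otimes> (h \<otimes> inv g)) \<otimes> (inv (a \<otimes> inv g) \<otimes> s \<otimes> (a \<otimes> inv g)), g))"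
    if c: "s \<in> carrier G" "a \<in> carrier G" "y \<in> carrier G" "h \<in> carrier G" for X s a y h
  proof -
    have "hmult (tensor D D) R (comult D X) ((s, a), (y, h)) = (\<Sum>\<alpha>\<in>carrier G. \<Sum>\<beta>\<in>carrier G.
        if \<beta> = h \<otimes> inv a \<otimes> \<alpha> then R ((s, \<alpha>), (y, \<beta>)) * X ((inv \<beta> \<otimes> y \<otimes> \<beta>) \<otimes> (inv \<alpha> \<otimes> s \<otimes> \<alpha>), inv \<alpha> \<otimes> a) else 0)"
      unfolding hmult_double_double[OF c]
    proof (intro sum.cong refl)
      fix \<alpha> \<beta> assume ab: "\<alpha> \<in> carrier G" "\<beta> \<in> carrier G"
      have "inv \<alpha> \<otimes> a = inv \<beta> \<otimes> h \<longleftrightarrow> \<beta> \<otimes> (inv \<alpha> \<otimes> a) = h"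
        using ab c by (subst mult_eq_iff_left) auto
      also have "\<dots> \<longleftrightarrow> \<beta> = h \<otimes> inv (inv \<alpha> \<otimes> a)"
        using ab c by (subst mult_eq_iff_right) auto
      also have "h \<otimes> inv (inv \<alpha> \<otimes> a) = h \<otimes> inv a \<otimes> \<alpha>" using ab c by (simp add: group_word)
      finally show "R ((s, \<alpha>), (y, \<beta>)) * comult D X ((inv \<alpha> \<otimes> s \<otimes> \<alpha>, inv \<alpha> \<otimes> a), (inv \<beta> \<otimes> y \<otimes> \<beta>, inv \<beta> \<otimes> h)) =
        (if \<beta> = h \<otimes> inv a \<otimes> \<alpha> then R ((s, \<alpha>), (y, \<beta>)) * X ((inv \<beta> \<otimes> y \<otimes> \<beta>) \<otimes> (inv \<alpha> \<otimes> s \<otimes> \<alpha>), inv \<alpha> \<otimes> a) else 0)"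
        using ab c by (simp add: comult_double)
    qed
    also have "\<dots> = (\<Sum>\<alpha>\<in>carrier G. R ((s, \<alpha>), (y, h \<otimes> inv a \<otimes> \<alpha>)) *
        X ((inv (h \<otimes> inv a \<otimes> \<alpha>) \<otimes> y \<otimes> (h \<otimes> inv a \<otimes> \<alpha>)) \<otimes> (inv \<alpha> \<otimes> s \<otimes> \<alpha>), inv \<alpha> \<otimes> a))"
      using c by (simp add: sum.delta)
    also have "\<dots> = (\<Sum>g\<in>carrier G. R ((s, a \<otimes> inv g), (y, h \<otimes> inv g)) *
        X ((inv (h \<otimes> inv g) \<otimes> y \<otimes> (h \<otimes> inv g)) \<otimes> (inv (a \<otimes> inv g) \<otimes> s \<otimes> (a \<otimes> inv g)), g))"
      by (rule sum.reindex_bij_witness[of _ "\<lambda>g. a \<otimes> inv g" "\<lambda>\<alpha>. inv \<alpha> \<otimes> a"])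
        (use c in \<open>auto simp: group_word\<close>)
    finally show ?thesis .
  qed
  have rhs: "hmult (tensor D D) (E X) R ((s, a), (y, h)) =
      (\<Sum>g\<in>carrier G. X (m s y, g) * R ((inv g \<otimes> s \<otimes> g, inv g \<otimes> a), (inv g \<otimes> y \<otimes> g, inv g \<otimes> h)))"
    if c: "s \<in> carrier G" "a \<in> carrier G" "y \<in> carrier G" "h \<in> carrier G" for X s a y h
    unfolding hmult_double_double[OF c]
  proof (intro sum.cong refl)
    fix \<alpha> assume \<alpha>: "\<alpha> \<in> carrier G"
    have "(\<Sum>\<beta>\<in>carrier G. E X ((s, \<alpha>), (y, \<beta>)) * R ((inv \<alpha> \<otimes> s \<otimes> \<alpha>, inv \<alpha> \<otimes> a), (inv \<beta> \<otimes> y \<otimes> \<beta>, inv \<beta> \<otimes> h))) =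
      (\<Sum>\<beta>\<in>carrier G. if \<beta> = \<alpha> then X (m s y, \<alpha>) * R ((inv \<alpha> \<otimes> s \<otimes> \<alpha>, inv \<alpha> \<otimes> a), (inv \<alpha> \<otimes> y \<otimes> \<alpha>, inv \<alpha> \<otimes> h)) else 0)"
      by (intro sum.cong refl) (use \<alpha> c in \<open>auto simp: E\<close>)
    then show "(\<Sum>\<beta>\<in>carrier G. E X ((s, \<alpha>), (y, \<beta>)) * R ((inv \<alpha> \<otimes> s \<otimes> \<alpha>, inv \<alpha> \<otimes> a), (inv \<beta> \<otimes> y \<otimes> \<beta>, inv \<beta> \<otimes> h))) =
      X (m s y, \<alpha>) * R ((inv \<alpha> \<otimes> s \<otimes> \<alpha>, inv \<alpha> \<otimes> a), (inv \<alpha> \<otimes> y \<otimes> \<alpha>, inv \<alpha> \<otimes> h))"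
      using \<alpha> by (simp add: sum.delta)
  qed
  show ?thesis
  proof
    assume L: ?L
    have eq: "R ((s, a), (y, h)) * delta x ((inv h \<otimes> y \<otimes> h) \<otimes> (inv a \<otimes> s \<otimes> a)) =
       delta x (m s y) * R ((inv g \<otimes> s \<otimes> g, inv g \<otimes> a \<otimes> g), (inv g \<otimes> y \<otimes> g, inv g \<otimes> h \<otimes> g))"
      if c: "s \<in> carrier G" "a \<in> carrier G" "y \<in> carrier G" "h \<in> carrier G" "x \<in> carrier G" "g \<in> carrier G"
      for s a y h x g
    proof -
      let ?X = "delta (x, g) :: 'g \<times> 'g \<Rightarrow> 'k"
      have d: "?X (z, g') = (if g' = g then delta x z else 0)" for z g' by (simp add: delta_def)
      have "?X \<in> bspace D" using c by (auto simp: bspace_def delta_def)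
      with L have "hmult (tensor D D) R (comult D ?X) ((s, a \<otimes> g), (y, h \<otimes> g)) =
        hmult (tensor D D) (E ?X) R ((s, a \<otimes> g), (y, h \<otimes> g))" by simp
      then show ?thesis using c
        by (simp add: lhs rhs d if_distrib[of "(*) _"] if_distrib[of "\<lambda>x. x * _"] m_assoc cong: if_cong)
    qed
    show "support_law m R"
      unfolding support_law_def
    proof (intro ballI conjI impI)
      fix s a y h g assume c: "s \<in> carrier G" "a \<in> carrier G" "y \<in> carrier G" "h \<in> carrier G"
      note e = eq[OF c m[OF c(1,3)], unfolded delta_def[of "m s y"]]
      show "m s y = (inv h \<otimes> y \<otimes> h) \<otimes> (inv a \<otimes> s \<otimes> a)" if "R ((s, a), (y, h)) \<noteq> 0"
        using e[of \<one>] c that by (auto split: if_splits)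
      then show "R ((inv g \<otimes> s \<otimes> g, inv g \<otimes> a \<otimes> g), (inv g \<otimes> y \<otimes> g, inv g \<otimes> h \<otimes> g)) = R ((s, a), (y, h))"
        if "g \<in> carrier G"
        using e[OF that] by (auto split: if_splits)
    qed
  next
    assume law: "support_law m R"
    show ?L
    proof (intro ballI ext)
      fix X :: "'g \<times> 'g \<Rightarrow> 'k" and z :: "('g \<times> 'g) \<times> ('g \<times> 'g)"
      obtain s a y h where z: "z = ((s, a), (y, h))" by (metis prod.exhaust)
      show "hmult (tensor D D) R (comult D X) z = hmult (tensor D D) (E X) R z"
      proof (cases "s \<in> carrier G \<and> a \<in> carrier G \<and> y \<in> carrier G \<and> h \<in> carrier G")
        case True
        then have c: "s \<in> carrier G" "a \<in> carrier G" "y \<in> carrier G" "h \<in> carrier G" by auto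
        show ?thesis
          unfolding z lhs[OF c] rhs[OF c]
        proof (intro sum.cong refl)
          fix g assume g: "g \<in> carrier G"
          let ?a = "a \<otimes> inv g" and ?h = "h \<otimes> inv g"
          have "R ((inv g \<otimes> s \<otimes> g, inv g \<otimes> ?a \<otimes> g), (inv g \<otimes> y \<otimes> g, inv g \<otimes> ?h \<otimes> g)) = R ((s, ?a), (y, ?h))"
            using law c g unfolding support_law_def by simp
          then have inv: "R ((inv g \<otimes> s \<otimes> g, inv g \<otimes> a), (inv g \<otimes> y \<otimes> g, inv g \<otimes> h)) = R ((s, ?a), (y, ?h))"
            using c g by (simp add: m_assoc)
          have "R ((s, ?a), (y, ?h)) \<noteq> 0 \<Longrightarrow> m s y = (inv ?h \<otimes> y \<otimes> ?h) \<otimes> (inv ?a \<otimes> s \<otimes> ?a)"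
            using law c g unfolding support_law_def by (metis inv_closed m_closed)
          then show "R ((s, ?a), (y, ?h)) * X ((inv ?h \<otimes> y \<otimes> ?h) \<otimes> (inv ?a \<otimes> s \<otimes> ?a), g) =
              X (m s y, g) * R ((inv g \<otimes> s \<otimes> g, inv g \<otimes> a), (inv g \<otimes> y \<otimes> g, inv g \<otimes> h))"
            unfolding inv by (cases "R ((s, ?a), (y, ?h)) = 0") (simp_all add: mult.commute)
        qed
      qed (simp add: z hmult_double_double_outside)
    qed
  qed
qed

lemma quasitriangular_iff:
  "R \<in> quasitriangular_structures D \<longleftrightarrow> weak_coeffs R \<and> support_law (\<lambda>s y. s \<otimes> y) R"
proof -
  have "(\<forall>X\<in>bspace D. hmult (tensor D D) R (comult D X) = hmult (tensor D D) (flip (comult D X)) R)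
      \<longleftrightarrow> support_law (\<lambda>s y. s \<otimes> y) R"
    by (rule commutation_iff_support_law) (auto simp: flip_def comult_double)
  then show ?thesis
    unfolding quasitriangular_structures_def mem_Collect_eq weak_R_matrices_double_iff by blast
qed

lemma central_weak_iff:
  "R \<in> central_weak_R_matrices D \<longleftrightarrow> weak_coeffs R \<and> support_law (\<lambda>s y. y \<otimes> s) R"
proof -
  have "(\<forall>X\<in>bspace D. hmult (tensor D D) R (comult D X) = hmult (tensor D D) (comult D X) R)
      \<longleftrightarrow> support_law (\<lambda>s y. y \<otimes> s) R"
    by (rule commutation_iff_support_law) (auto simp: comult_double)
  then show ?thesis
    unfolding central_weak_R_matrices_def mem_Collect_eq weak_R_matrices_double_iff by blast
qed

end

section \<open>Hopf pairings and the subgroups $A$ and $B$\<close>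

context finite_group
begin

text \<open>The matrix of a Hopf algebra map $e_a \mapsto \sum_h P(a,h)\, h$ from functions on \<open>G\<close> to
  the group algebra.  Exchanging the arguments exchanges multiplicativity and
  comultiplicativity, so the transposed matrix is again of this kind.\<close>

definition pairing :: "('g \<Rightarrow> 'g \<Rightarrow> 'k::field) \<Rightarrow> bool" where
  "pairing P \<longleftrightarrow>
    (\<forall>a h. \<not> (a \<in> carrier G \<and> h \<in> carrier G) \<longrightarrow> P a h = 0) \<and>
    (\<forall>a\<in>carrier G. \<forall>a'\<in>carrier G. \<forall>k\<in>carrier G.
      (\<Sum>g\<in>carrier G. P a g * P a' (inv g \<otimes> k)) = (if a = a' then P a k else 0)) \<and>
    (\<forall>c\<in>carrier G. \<forall>g\<in>carrier G. \<forall>g'\<in>carrier G.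
      (\<Sum>a\<in>carrier G. P a g * P (inv a \<otimes> c) g') = (if g = g' then P c g else 0)) \<and>
    (\<forall>h\<in>carrier G. (\<Sum>a\<in>carrier G. P a h) = (if h = \<one> then 1 else 0)) \<and>
    (\<forall>a\<in>carrier G. (\<Sum>h\<in>carrier G. P a h) = (if a = \<one> then 1 else 0))"

lemma pairing_dual: "pairing P \<Longrightarrow> pairing (\<lambda>a h. P h a)"
  unfolding pairing_def by auto

lemma pairingD:
  assumes "pairing P"
  shows "\<not> (a \<in> carrier G \<and> h \<in> carrier G) \<Longrightarrow> P a h = 0"
    and "a \<in> carrier G \<Longrightarrow> a' \<in> carrier G \<Longrightarrow> k \<in> carrier G \<Longrightarrow>
      (\<Sum>g\<in>carrier G. P a g * P a' (inv g \<otimes> k)) = (if a = a' then P a k else 0)"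
    and "c \<in> carrier G \<Longrightarrow> g \<in> carrier G \<Longrightarrow> g' \<in> carrier G \<Longrightarrow>
      (\<Sum>a\<in>carrier G. P a g * P (inv a \<otimes> c) g') = (if g = g' then P c g else 0)"
    and "h \<in> carrier G \<Longrightarrow> (\<Sum>a\<in>carrier G. P a h) = (if h = \<one> then 1 else 0)"
    and "a \<in> carrier G \<Longrightarrow> (\<Sum>h\<in>carrier G. P a h) = (if a = \<one> then 1 else 0)"
  using assms unfolding pairing_def by blast+

definition supp :: "('g \<Rightarrow> 'g \<Rightarrow> 'k::field) \<Rightarrow> 'g set" where
  "supp P = {a. \<exists>h. P a h \<noteq> 0}"

lemma supp_carrier: "pairing P \<Longrightarrow> supp P \<subseteq> carrier G"
  using pairingD(1)[of P] by (auto simp: supp_def)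

text \<open>Convolving the row of \<open>a \<in> supp P\<close> with the columns shows that the coordinate vector of \<open>a\<close>
  is a combination of columns of \<open>P\<close>.\<close>

lemma unit_vector_from_columns:
  assumes P: "pairing P" and a: "a \<in> supp P"
  obtains c where "\<And>x. x \<in> carrier G \<Longrightarrow> (\<Sum>t\<in>carrier G. c t * P x t) = (if x = a then 1 else 0)"
proof -
  from a obtain g where g: "P a g \<noteq> 0" by (auto simp: supp_def)
  then have car: "a \<in> carrier G" "g \<in> carrier G" using pairingD(1)[OF P] by auto
  \<comment> \<open>These coefficients turn the sum into the product of the rows \<open>a\<close> and \<open>x\<close>, taken at \<open>g\<close>.\<close>
  have "(\<Sum>t\<in>carrier G. P a (g \<otimes> inv t) / P a g * P x t) = (if x = a then 1 else 0)" if x: "x \<in> carrier G" for x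
  proof -
    have "(\<Sum>t\<in>carrier G. P a (g \<otimes> inv t) / P a g * P x t) = (\<Sum>t\<in>carrier G. P a (g \<otimes> inv (inv t \<otimes> g)) / P a g * P x (inv t \<otimes> g))"
      by (rule sum_inv_mult[OF car(2), symmetric])
    also have "\<dots> = (\<Sum>t\<in>carrier G. P a t * P x (inv t \<otimes> g)) / P a g"
      unfolding sum_divide_distrib by (rule sum.cong) (use car in \<open>simp_all add: group_word\<close>)
    also have "\<dots> = (if x = a then 1 else 0)"
      using pairingD(2)[OF P car(1) x car(2)] g by auto
    finally show ?thesis .
  qed
  then show ?thesis by (rule that)
qed

text \<open>The columns are orthogonal idempotents of the group algebra, so combinations of columns multiply
  coefficient by coefficient; in particular they commute.\<close>

lemma supp_unit_vector_mult:
  assumes P: "pairing P" and a: "a \<in> carrier G" and b: "b \<in> carrier G" and x: "x \<in> carrier G"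
    and c: "\<And>x. x \<in> carrier G \<Longrightarrow> (\<Sum>t\<in>carrier G. c t * P x t) = (if x = a then 1 else 0)"
    and d: "\<And>x. x \<in> carrier G \<Longrightarrow> (\<Sum>t\<in>carrier G. d t * P x t) = (if x = b then 1 else 0)"
  shows "(\<Sum>t\<in>carrier G. c t * d t * P x t) = (if x = a \<otimes> b then 1 else 0)"
proof -
  have "(\<Sum>t\<in>carrier G. c t * d t * P x t) = (\<Sum>t\<in>carrier G. \<Sum>t'\<in>carrier G. if t' = t then c t * d t * P x t else 0)"
    by (simp add: sum.delta)
  also have "\<dots> = (\<Sum>t\<in>carrier G. \<Sum>t'\<in>carrier G. \<Sum>y\<in>carrier G. c t * d t' * (P y t * P (inv y \<otimes> x) t'))"
    by (intro sum.cong refl) (auto simp: pairingD(3)[OF P x] simp flip: sum_distrib_left)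
  also have "\<dots> = (\<Sum>t\<in>carrier G. \<Sum>y\<in>carrier G. \<Sum>t'\<in>carrier G. c t * d t' * (P y t * P (inv y \<otimes> x) t'))"
    by (rule sum.cong[OF refl]) (rule sum.swap)
  also have "\<dots> = (\<Sum>y\<in>carrier G. \<Sum>t\<in>carrier G. \<Sum>t'\<in>carrier G. c t * d t' * (P y t * P (inv y \<otimes> x) t'))"
    by (rule sum.swap)
  also have "\<dots> = (\<Sum>y\<in>carrier G. (\<Sum>t\<in>carrier G. c t * P y t) * (\<Sum>t'\<in>carrier G. d t' * P (inv y \<otimes> x) t'))"
    by (simp add: sum_product mult_ac)
  also have "\<dots> = (\<Sum>y\<in>carrier G. if y = a then (if inv y \<otimes> x = b then 1 else 0) else 0)"
    by (rule sum.cong) (use c d x in auto)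
  also have "\<dots> = (if inv a \<otimes> x = b then 1 else 0)" using a by (simp add: sum.delta)
  also have "inv a \<otimes> x = b \<longleftrightarrow> x = a \<otimes> b" using a b x by auto
  finally show ?thesis .
qed

lemma supp_mult:
  assumes P: "pairing P" and a: "a \<in> supp P" and b: "b \<in> supp P"
  shows "a \<otimes> b \<in> supp P" and "a \<otimes> b = b \<otimes> a"
proof -
  have car: "a \<in> carrier G" "b \<in> carrier G" using supp_carrier[OF P] a b by auto
  obtain c d where c: "\<And>x. x \<in> carrier G \<Longrightarrow> (\<Sum>t\<in>carrier G. c t * P x t) = (if x = a then 1 else 0)"
    and d: "\<And>x. x \<in> carrier G \<Longrightarrow> (\<Sum>t\<in>carrier G. d t * P x t) = (if x = b then 1 else 0)"
    using unit_vector_from_columns[OF P a] unit_vector_from_columns[OF P b] by metis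
  note cd = supp_unit_vector_mult[OF P car(1,2) _ c d]
  note dc = supp_unit_vector_mult[OF P car(2,1) _ d c]
  have 1: "(\<Sum>t\<in>carrier G. c t * d t * P (a \<otimes> b) t) = 1" using cd[of "a \<otimes> b"] car by simp
  then have "(\<Sum>t\<in>carrier G. c t * d t * P (a \<otimes> b) t) \<noteq> 0" by simp
  then obtain t where "c t * d t * P (a \<otimes> b) t \<noteq> 0"
    by (rule sum.not_neutral_contains_not_neutral)
  then have "\<exists>t. P (a \<otimes> b) t \<noteq> 0" by auto
  then show "a \<otimes> b \<in> supp P" by (simp add: supp_def)
  have "(\<Sum>t\<in>carrier G. d t * c t * P (a \<otimes> b) t) = 1" using 1 by (simp add: mult.commute)
  then show "a \<otimes> b = b \<otimes> a" using dc[of "a \<otimes> b"] car by (auto split: if_splits)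
qed

lemma one_in_supp:
  assumes P: "pairing P"
  shows "\<one> \<in> supp P"
proof -
  have "(\<Sum>h\<in>carrier G. P \<one> h) \<noteq> 0" using pairingD(5)[OF P one_closed] by simp
  then obtain h where "P \<one> h \<noteq> 0" by (rule sum.not_neutral_contains_not_neutral)
  then show ?thesis by (auto simp: supp_def)
qed

lemma supp_subgroup:
  assumes P: "pairing P"
  shows "subgroup (supp P) G"
proof (rule subgroupI)
  show sub: "supp P \<subseteq> carrier G" using supp_carrier[OF P] .
  show "supp P \<noteq> {}" using one_in_supp[OF P] by blast
  fix a assume a: "a \<in> supp P"
  have ac: "a \<in> carrier G" using sub a by blast
  have "inj_on (\<lambda>x. a \<otimes> x) (supp P)" by (rule inj_onI) (use sub ac in \<open>auto simp: subset_iff\<close>)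
  moreover have "(\<lambda>x. a \<otimes> x) ` supp P \<subseteq> supp P" using supp_mult(1)[OF P a] by blast
  moreover have "finite (supp P)" using sub finite_carrier finite_subset by blast
  ultimately have "(\<lambda>x. a \<otimes> x) ` supp P = supp P" by (simp add: endo_inj_surj)
  then obtain x where "x \<in> supp P" "a \<otimes> x = \<one>" using one_in_supp[OF P] by (metis imageE)
  then show "inv a \<in> supp P" using sub ac by (metis inv_equality inv_inv r_inv subsetD inv_comm)
next
  show "\<And>a b. a \<in> supp P \<Longrightarrow> b \<in> supp P \<Longrightarrow> a \<otimes> b \<in> supp P" using supp_mult(1)[OF P] .
qed

lemma comm_group_supp:
  assumes P: "pairing P"
  shows "comm_group (G\<lparr>carrier := supp P\<rparr>)"
proof -
  interpret A: group "G\<lparr>carrier := supp P\<rparr>"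
    using subgroup.subgroup_is_group[OF supp_subgroup[OF P] is_group] .
  show ?thesis by (rule A.group_comm_groupI) (simp add: supp_mult(2)[OF P])
qed

lemma hmult_group_alg_subgroup:
  assumes H: "subgroup H G" and X: "\<And>g. g \<notin> H \<Longrightarrow> X g = 0" and Y: "\<And>g. g \<notin> H \<Longrightarrow> Y g = 0"
  shows "hmult (group_alg (G\<lparr>carrier := H\<rparr>)) X Y k =
    (if k \<in> carrier G then \<Sum>g\<in>carrier G. X g * Y (inv g \<otimes> k) else 0)"
proof -
  have sub: "H \<subseteq> carrier G" using subgroup.subset[OF H] .
  have fin: "finite H" using sub finite_subset finite_carrier by blast
  have inner: "(\<Sum>h\<in>H. X g * Y h * delta (g \<otimes> h) k) = (if k \<in> carrier G then X g * Y (inv g \<otimes> k) else 0)"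
    if g: "g \<in> H" for g
  proof -
    have gc: "g \<in> carrier G" using g sub by blast
    have "(\<Sum>h\<in>H. X g * Y h * delta (g \<otimes> h) k) = (\<Sum>h\<in>H. if h = inv g \<otimes> k then (if k \<in> carrier G then X g * Y (inv g \<otimes> k) else 0) else 0)"
    proof (rule sum.cong[OF refl])
      fix h assume h: "h \<in> H"
      then have hc: "h \<in> carrier G" using sub by blast
      show "X g * Y h * delta (g \<otimes> h) k = (if h = inv g \<otimes> k then (if k \<in> carrier G then X g * Y (inv g \<otimes> k) else 0) else 0)"
      proof (cases "k \<in> carrier G")
        case True
        then have "k = g \<otimes> h \<longleftrightarrow> h = inv g \<otimes> k" using gc hc by auto
        then show ?thesis using True by (simp add: delta_def)
      next
        case False
        then have "k \<noteq> g \<otimes> h" using gc hc by auto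
        then show ?thesis using False by (simp add: delta_def)
      qed
    qed
    also have "\<dots> = (if k \<in> carrier G then X g * Y (inv g \<otimes> k) else 0)"
      using fin Y[of "inv g \<otimes> k"] by (simp add: sum.delta)
    finally show ?thesis .
  qed
  have "hmult (group_alg (G\<lparr>carrier := H\<rparr>)) X Y k = (\<Sum>g\<in>H. \<Sum>h\<in>H. X g * Y h * delta (g \<otimes> h) k)"
    by (simp add: hmult_def group_alg_def)
  also have "\<dots> = (\<Sum>g\<in>H. if k \<in> carrier G then X g * Y (inv g \<otimes> k) else 0)"
    by (intro sum.cong refl) (simp add: inner)
  also have "\<dots> = (\<Sum>g\<in>carrier G. if k \<in> carrier G then X g * Y (inv g \<otimes> k) else 0)"
    by (rule sum.mono_neutral_left[OF finite_carrier sub]) (simp add: X)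
  finally show ?thesis by simp
qed

definition pairing_map :: "('g \<Rightarrow> 'g \<Rightarrow> 'k::field) \<Rightarrow> ('g \<Rightarrow> 'k) \<Rightarrow> 'g \<Rightarrow> 'k" where
  "pairing_map P f = (\<lambda>h. \<Sum>a\<in>carrier G. f a * P a h)"

lemma pairing_map_cong:
  "pairing P \<Longrightarrow> (\<And>a. a \<in> supp P \<Longrightarrow> f a = f' a) \<Longrightarrow> pairing_map P f = pairing_map P f'"
  unfolding pairing_map_def by (intro ext sum.cong refl) (auto simp: supp_def)

lemma pairing_map_delta: "a \<in> carrier G \<Longrightarrow> pairing_map P (delta a) = P a"
  by (rule ext) (simp add: pairing_map_def delta_def if_distrib[of "\<lambda>x. x * _"] cong: if_cong)

lemma pairing_map_mult:
  assumes P: "pairing P" and k: "k \<in> carrier G"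
  shows "(\<Sum>g\<in>carrier G. pairing_map P f g * pairing_map P f' (inv g \<otimes> k)) = pairing_map P (\<lambda>a. f a * f' a) k"
proof -
  have "(\<Sum>g\<in>carrier G. pairing_map P f g * pairing_map P f' (inv g \<otimes> k)) =
      (\<Sum>g\<in>carrier G. \<Sum>a\<in>carrier G. \<Sum>a'\<in>carrier G. f a * f' a' * (P a g * P a' (inv g \<otimes> k)))"
    by (simp add: pairing_map_def sum_product mult_ac)
  also have "\<dots> = (\<Sum>a\<in>carrier G. \<Sum>g\<in>carrier G. \<Sum>a'\<in>carrier G. f a * f' a' * (P a g * P a' (inv g \<otimes> k)))"
    by (rule sum.swap)
  also have "\<dots> = (\<Sum>a\<in>carrier G. \<Sum>a'\<in>carrier G. \<Sum>g\<in>carrier G. f a * f' a' * (P a g * P a' (inv g \<otimes> k)))"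
    by (rule sum.cong[OF refl]) (rule sum.swap)
  also have "\<dots> = (\<Sum>a\<in>carrier G. \<Sum>a'\<in>carrier G. if a' = a then f a * f' a * P a k else 0)"
    by (intro sum.cong refl) (auto simp: pairingD(2)[OF P _ _ k] simp flip: sum_distrib_left)
  finally show ?thesis by (simp add: pairing_map_def sum.delta)
qed

lemma pairing_map_comult:
  assumes P: "pairing P" and g: "g \<in> carrier G" "g' \<in> carrier G"
  shows "(\<Sum>a\<in>carrier G. \<Sum>b\<in>carrier G. x (a \<otimes> b) * (P a g * P b g')) = (if g = g' then pairing_map P x g else 0)"
proof -
  have "(\<Sum>a\<in>carrier G. \<Sum>b\<in>carrier G. x (a \<otimes> b) * (P a g * P b g')) =
    (\<Sum>a\<in>carrier G. \<Sum>c\<in>carrier G. x c * (P a g * P (inv a \<otimes> c) g'))"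
  proof (rule sum.cong[OF refl])
    fix a assume a: "a \<in> carrier G"
    have "(\<Sum>b\<in>carrier G. x (a \<otimes> b) * (P a g * P b g')) =
      (\<Sum>b\<in>carrier G. x (a \<otimes> b) * (P a g * P (inv a \<otimes> (a \<otimes> b)) g'))"
      by (rule sum.cong) (use a in auto)
    also have "\<dots> = (\<Sum>c\<in>carrier G. x c * (P a g * P (inv a \<otimes> c) g'))"
      by (rule sum_mult_left[OF a, where f = "\<lambda>c. x c * (P a g * P (inv a \<otimes> c) g')"])
    finally show "(\<Sum>b\<in>carrier G. x (a \<otimes> b) * (P a g * P b g')) = (\<Sum>c\<in>carrier G. x c * (P a g * P (inv a \<otimes> c) g'))" .
  qed
  also have "\<dots> = (\<Sum>c\<in>carrier G. \<Sum>a\<in>carrier G. x c * (P a g * P (inv a \<otimes> c) g'))"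
    by (rule sum.swap)
  also have "\<dots> = (\<Sum>c\<in>carrier G. x c * (if g = g' then P c g else 0))"
    by (rule sum.cong) (auto simp: pairingD(3)[OF P _ g] simp flip: sum_distrib_left)
  finally show ?thesis by (simp add: pairing_map_def)
qed

text \<open>Orthogonality of the rows recovers \<open>f\<close> from its image.  The coordinate vectors of the
  elements of \<open>B\<close> are combinations of rows, which gives surjectivity.\<close>

lemma pairing_map_bij:
  fixes P :: "'g \<Rightarrow> 'g \<Rightarrow> 'k::field"
  assumes P: "pairing P"
  shows "bij_betw (pairing_map P) (bspace (fun_alg (G\<lparr>carrier := supp P\<rparr>)))
    (bspace (group_alg (G\<lparr>carrier := supp (\<lambda>a h. P h a)\<rparr>)))"
    (is "bij_betw ?\<psi> ?X ?Y")
  unfolding bij_betw_def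
proof
  have X: "f \<in> ?X \<longleftrightarrow> (\<forall>a. a \<notin> supp P \<longrightarrow> f a = 0)" for f :: "'g \<Rightarrow> 'k"
    by (simp add: bspace_def fun_alg_def)
  have Y: "y \<in> ?Y \<longleftrightarrow> (\<forall>h. h \<notin> supp (\<lambda>a h. P h a) \<longrightarrow> y h = 0)" for y :: "'g \<Rightarrow> 'k"
    by (simp add: bspace_def group_alg_def)
  show "inj_on ?\<psi> ?X"
  proof (rule inj_onI, rule ext)
    fix f f' a assume f: "f \<in> ?X" "f' \<in> ?X" and eq: "?\<psi> f = ?\<psi> f'"
    show "f a = f' a"
    proof (cases "a \<in> supp P")
      case True
      then obtain c where c: "\<And>x. x \<in> carrier G \<Longrightarrow> (\<Sum>t\<in>carrier G. c t * P x t) = (if x = a then 1 else 0)"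
        using unit_vector_from_columns[OF P] by metis
      have rec: "(\<Sum>t\<in>carrier G. c t * ?\<psi> f t) = f a" for f
      proof -
        have "(\<Sum>t\<in>carrier G. c t * ?\<psi> f t) = (\<Sum>t\<in>carrier G. \<Sum>x\<in>carrier G. f x * (c t * P x t))"
          by (simp add: pairing_map_def sum_distrib_left mult_ac)
        also have "\<dots> = (\<Sum>x\<in>carrier G. f x * (\<Sum>t\<in>carrier G. c t * P x t))"
          by (subst sum.swap) (simp add: sum_distrib_left)
        also have "\<dots> = (\<Sum>x\<in>carrier G. if x = a then f x else 0)" by (rule sum.cong) (simp_all add: c)
        also have "\<dots> = f a" using True supp_carrier[OF P] by (auto simp: sum.delta)
        finally show ?thesis .
      qed
      show ?thesis using rec[of f] rec[of f'] eq by simp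
    qed (use f X in auto)
  qed
  show "?\<psi> ` ?X = ?Y"
  proof
    show "?\<psi> ` ?X \<subseteq> ?Y"
      unfolding image_subset_iff Y by (auto simp: pairing_map_def supp_def intro!: sum.neutral)
    show "?Y \<subseteq> ?\<psi> ` ?X"
    proof
      fix y assume y: "y \<in> ?Y"
      let ?B = "supp (\<lambda>a h. P h a)"
      have Bsub: "?B \<subseteq> carrier G" using supp_carrier[OF pairing_dual[OF P]] .
      have "\<exists>c. \<forall>h\<in>carrier G. (\<Sum>t\<in>carrier G. c t * P t h) = (if h = b then 1 else 0)" if "b \<in> ?B" for b
        using unit_vector_from_columns[OF pairing_dual[OF P] that] by metis
      then obtain c where c: "\<And>b h. b \<in> ?B \<Longrightarrow> h \<in> carrier G \<Longrightarrow> (\<Sum>t\<in>carrier G. c b t * P t h) = (if h = b then 1 else 0)"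
        by metis
      define f where "f t = (if t \<in> supp P then \<Sum>b\<in>?B. y b * c b t else 0)" for t
      have "?\<psi> f h = y h" for h
      proof (cases "h \<in> carrier G")
        case True
        have "?\<psi> f h = pairing_map P (\<lambda>t. \<Sum>b\<in>?B. y b * c b t) h"
          using pairing_map_cong[OF P, of f "\<lambda>t. \<Sum>b\<in>?B. y b * c b t"] by (simp add: f_def)
        also have "\<dots> = (\<Sum>t\<in>carrier G. \<Sum>b\<in>?B. y b * (c b t * P t h))"
          by (simp add: pairing_map_def sum_distrib_left sum_distrib_right mult_ac)
        also have "\<dots> = (\<Sum>b\<in>?B. y b * (\<Sum>t\<in>carrier G. c b t * P t h))"
          by (subst sum.swap) (simp add: sum_distrib_left)
        also have "\<dots> = (\<Sum>b\<in>?B. if b = h then y b else 0)"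
          by (rule sum.cong) (use True in \<open>auto simp: c\<close>)
        also have "\<dots> = y h" using y finite_subset[OF Bsub finite_carrier] unfolding Y by (auto simp: sum.delta)
        finally show ?thesis .
      next
        case False
        then have "h \<notin> ?B" using Bsub by blast
        then have "y h = 0" "P t h = 0" for t using y unfolding Y by (auto simp: supp_def)
        then show ?thesis by (simp add: pairing_map_def)
      qed
      then have "?\<psi> f = y" by (rule ext)
      moreover have "f \<in> ?X" unfolding X by (simp add: f_def)
      ultimately show "y \<in> ?\<psi> ` ?X" by blast
    qed
  qed
qed

lemma comult_group_alg:
  assumes "finite (carrier H)"
  shows "comult (group_alg H) x (g, g') = (if g = g' \<and> g \<in> carrier H then x g else 0)"
proof -
  have "comult (group_alg H) x (g, g') = (\<Sum>h\<in>carrier H. if h = g then (if g = g' then x g else 0) else 0)"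
    unfolding comult_def by (intro sum.cong) (auto simp: group_alg_def delta_def)
  then show ?thesis using assms by (simp add: sum.delta)
qed

lemma comult_fun_alg:
  assumes "finite (carrier H)" "\<And>x y. x \<in> carrier H \<Longrightarrow> y \<in> carrier H \<Longrightarrow> x \<otimes>\<^bsub>H\<^esub> y \<in> carrier H"
  shows "comult (fun_alg H) x (a, b) = (if a \<in> carrier H \<and> b \<in> carrier H then x (a \<otimes>\<^bsub>H\<^esub> b) else 0)"
proof -
  have "comult (fun_alg H) x (a, b) = (\<Sum>c\<in>carrier H. if c = a \<otimes>\<^bsub>H\<^esub> b then (if a \<in> carrier H \<and> b \<in> carrier H then x (a \<otimes>\<^bsub>H\<^esub> b) else 0) else 0)"
    unfolding comult_def by (intro sum.cong) (auto simp: fun_alg_def)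
  then show ?thesis using assms by (auto simp: sum.delta)
qed

lemma pairing_map_hopf_iso:
  fixes P :: "'g \<Rightarrow> 'g \<Rightarrow> 'k::field"
  assumes P: "pairing P"
  shows "hopf_iso (fun_alg (G\<lparr>carrier := supp P\<rparr>)) (group_alg (G\<lparr>carrier := supp (\<lambda>a h. P h a)\<rparr>)) (pairing_map P)"
proof -
  let ?A = "supp P" and ?B = "supp (\<lambda>a h. P h a)"
  let ?X = "fun_alg (G\<lparr>carrier := ?A\<rparr>) :: ('g, 'k) bialg" and ?Y = "group_alg (G\<lparr>carrier := ?B\<rparr>) :: ('g, 'k) bialg"
  have A: "subgroup ?A G" and B: "subgroup ?B G" using supp_subgroup[OF P] supp_subgroup[OF pairing_dual[OF P]] .
  have sub: "?A \<subseteq> carrier G" "?B \<subseteq> carrier G" using subgroup.subset A B by auto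
  have fin: "finite ?A" "finite ?B" using sub finite_subset finite_carrier by blast+
  have X: "f \<in> bspace ?X \<longleftrightarrow> (\<forall>a. a \<notin> ?A \<longrightarrow> f a = 0)" for f
    by (simp add: bspace_def fun_alg_def)
  have P0: "P a h = 0" if "h \<notin> ?B" for a h using that by (auto simp: supp_def)
  have PA: "P a h = 0" if "a \<notin> ?A" for a h using that by (auto simp: supp_def)
  have out: "pairing_map P f h = 0" if "h \<notin> ?B" for f h using P0[OF that] by (simp add: pairing_map_def)
  have sumA: "(\<Sum>a\<in>?A. F a * P a h) = (\<Sum>a\<in>carrier G. F a * P a h)" for F h
    by (rule sum.mono_neutral_left[OF finite_carrier sub(1)]) (simp add: PA)
  have multX: "hmult ?X f f' = (\<lambda>a. if a \<in> ?A then f a * f' a else 0)" for f f' :: "'g \<Rightarrow> 'k"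
  proof
    fix z
    have "hmult ?X f f' z = (\<Sum>a\<in>?A. (\<Sum>b\<in>?A. f' b * delta b z) * f a * delta a z)"
      by (simp add: hmult_def fun_alg_def sum_distrib_left sum_distrib_right mult_ac)
    also have "\<dots> = (if z \<in> ?A then f z * f' z else 0)"
      using fin by (auto simp: delta_def if_distrib[of "(*) _"] if_distrib[of "\<lambda>x. x * _"] cong: if_cong)
    finally show "hmult ?X f f' z = (if z \<in> ?A then f z * f' z else 0)" .
  qed
  show ?thesis
    unfolding hopf_iso_def
  proof (intro conjI ballI allI)
    show "bij_betw (pairing_map P) (bspace ?X) (bspace ?Y)" by (rule pairing_map_bij[OF P])
  next
    fix x y assume "x \<in> bspace ?X" "y \<in> bspace ?X"
    show "pairing_map P (\<lambda>b. x b + y b) = (\<lambda>c. pairing_map P x c + pairing_map P y c)"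
      by (simp add: pairing_map_def distrib_right sum.distrib)
    show "pairing_map P (hmult ?X x y) = hmult ?Y (pairing_map P x) (pairing_map P y)"
    proof
      fix k
      have "pairing_map P (hmult ?X x y) = pairing_map P (\<lambda>a. x a * y a)"
        by (rule pairing_map_cong[OF P]) (simp add: multX)
      then show "pairing_map P (hmult ?X x y) k = hmult ?Y (pairing_map P x) (pairing_map P y) k"
        using out sub(2) by (auto simp: hmult_group_alg_subgroup[OF B out out] pairing_map_mult[OF P])
    qed
  next
    fix t x assume "x \<in> bspace ?X"
    show "pairing_map P (\<lambda>b. t * x b) = (\<lambda>c. t * pairing_map P x c)"
      by (simp add: pairing_map_def sum_distrib_left mult_ac)
  next
    have "pairing_map P (bunit ?X) = pairing_map P (\<lambda>a. 1)"
      by (rule pairing_map_cong[OF P]) (simp add: fun_alg_def)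
    also have "\<dots> = delta \<one>"
    proof
      fix h
      show "pairing_map P (\<lambda>a. 1) h = delta \<one> h"
        using pairingD(4)[OF P] pairingD(1)[OF P]
        by (cases "h \<in> carrier G") (auto simp: pairing_map_def delta_def intro: sum.neutral)
    qed
    finally show "pairing_map P (bunit ?X) = bunit ?Y" by (simp add: group_alg_def)
  next
    fix x assume x: "x \<in> bspace ?X"
    show "comult ?Y (pairing_map P x) = (\<lambda>cd. \<Sum>(a, b)\<in>bbasis ?X \<times> bbasis ?X.
      comult ?X x (a, b) * pure_tensor (pairing_map P (delta a)) (pairing_map P (delta b)) cd)"
    proof
      fix cd :: "'g \<times> 'g"
      obtain g g' where cd: "cd = (g, g')" by (cases cd)
      have cl: "a \<otimes> b \<in> ?A" if "a \<in> ?A" "b \<in> ?A" for a b using subgroup.m_closed[OF A that] .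
      have bas: "bbasis ?X = ?A" by (simp add: fun_alg_def)
      have com: "comult ?X x (a, b) = x (a \<otimes> b)" if "a \<in> ?A" "b \<in> ?A" for a b
        using comult_fun_alg[of "G\<lparr>carrier := ?A\<rparr>" x a b] cl fin that by simp
      have "(\<Sum>(a, b)\<in>bbasis ?X \<times> bbasis ?X. comult ?X x (a, b) * pure_tensor (pairing_map P (delta a)) (pairing_map P (delta b)) cd)
        = (\<Sum>a\<in>?A. \<Sum>b\<in>?A. x (a \<otimes> b) * (P a g * P b g'))"
        unfolding bas sum.cartesian_product[symmetric]
        by (intro sum.cong refl)
          (use sub in \<open>simp add: com cd pure_tensor_def pairing_map_delta subset_iff\<close>)
      also have "\<dots> = (\<Sum>a\<in>?A. \<Sum>b\<in>carrier G. x (a \<otimes> b) * (P a g * P b g'))"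
        by (intro sum.cong refl sum.mono_neutral_left finite_carrier sub) (simp add: PA)
      also have "\<dots> = (\<Sum>a\<in>carrier G. \<Sum>b\<in>carrier G. x (a \<otimes> b) * (P a g * P b g'))"
        by (intro sum.mono_neutral_left finite_carrier sub) (simp add: PA)
      also have "\<dots> = comult ?Y (pairing_map P x) cd"
      proof (cases "g \<in> ?B \<and> g' \<in> ?B")
        case True
        then show ?thesis
          using sub(2) fin by (simp add: cd comult_group_alg pairing_map_comult[OF P] subset_iff)
      next
        case False
        then have z: "P a g * P b g' = 0" for a b using P0 by auto
        have "(\<Sum>a\<in>carrier G. \<Sum>b\<in>carrier G. x (a \<otimes> b) * (P a g * P b g')) = 0"
          by (simp only: z mult_zero_right sum.neutral_const)
        moreover have "comult ?Y (pairing_map P x) cd = 0"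
          using False fin by (auto simp: cd comult_group_alg)
        ultimately show ?thesis by simp
      qed
      finally show "comult ?Y (pairing_map P x) cd = (\<Sum>(a, b)\<in>bbasis ?X \<times> bbasis ?X.
        comult ?X x (a, b) * pure_tensor (pairing_map P (delta a)) (pairing_map P (delta b)) cd)" by simp
    qed
    have "counit ?Y (pairing_map P x) = (\<Sum>h\<in>?B. pairing_map P x h)"
      by (simp add: counit_def group_alg_def)
    also have "\<dots> = (\<Sum>h\<in>carrier G. pairing_map P x h)"
      by (rule sum.mono_neutral_left[OF finite_carrier sub(2)]) (simp add: out)
    also have "\<dots> = (\<Sum>a\<in>carrier G. x a * (\<Sum>h\<in>carrier G. P a h))"
      unfolding pairing_map_def by (subst sum.swap) (simp add: sum_distrib_left)
    also have "\<dots> = (\<Sum>a\<in>carrier G. if a = \<one> then x a else 0)"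
      by (rule sum.cong) (simp_all add: pairingD(5)[OF P])
    also have "\<dots> = x \<one>" by (simp add: sum.delta)
    also have "\<dots> = (\<Sum>a\<in>?A. if a = \<one> then x a else 0)"
      using one_in_supp[OF P] fin by (simp add: sum.delta)
    also have "\<dots> = counit ?X x"
      unfolding counit_def by (intro sum.cong) (auto simp: fun_alg_def delta_def)
    finally show "counit ?Y (pairing_map P x) = counit ?X x" .
  qed
qed

text \<open>Both subgroups can be read off from any factorization: as the isomorphism in the middle is
  injective, \<open>A\<close> consists of the \<open>a\<close> with $p(e_a) \neq 0$, and as it is onto, \<open>B\<close> consists of the group
  elements that occur in the image of \<open>p\<close>.\<close>

lemma p_factors_through_iff:
  fixes P :: "'g \<Rightarrow> 'g \<Rightarrow> 'k::field"
  assumes P: "pairing P" and p: "\<And>f. f \<in> bspace (fun_alg G) \<Longrightarrow> p f = pairing_map P f"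
  shows "p_factors_through G p A B \<longleftrightarrow> A = supp P \<and> B = supp (\<lambda>a h. P h a)"
proof
  assume "A = supp P \<and> B = supp (\<lambda>a h. P h a)"
  moreover have "p f = pairing_map P (\<lambda>x. if x \<in> supp P then f x else 0)" if "f \<in> bspace (fun_alg G)" for f
    unfolding p[OF that] by (rule pairing_map_cong[OF P]) simp
  ultimately show "p_factors_through G p A B"
    unfolding p_factors_through_def
    using supp_subgroup[OF P] supp_subgroup[OF pairing_dual[OF P]] comm_group_supp[OF P]
      comm_group_supp[OF pairing_dual[OF P]] pairing_map_hopf_iso[OF P] by blast
next
  assume "p_factors_through G p A B"
  then obtain \<psi> where A: "subgroup A G" and B: "subgroup B G"
    and \<psi>: "hopf_iso (fun_alg (G\<lparr>carrier := A\<rparr>)) (group_alg (G\<lparr>carrier := B\<rparr>)) \<psi>"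
    and fac: "\<And>f. f \<in> bspace (fun_alg G) \<Longrightarrow> p f = \<psi> (\<lambda>x. if x \<in> A then f x else 0)"
    unfolding p_factors_through_def by blast
  have sub: "A \<subseteq> carrier G" "B \<subseteq> carrier G" using subgroup.subset A B by auto
  let ?X = "bspace (fun_alg (G\<lparr>carrier := A\<rparr>)) :: ('g \<Rightarrow> 'k) set"
  let ?Y = "bspace (group_alg (G\<lparr>carrier := B\<rparr>)) :: ('g \<Rightarrow> 'k) set"
  have X: "f \<in> ?X \<longleftrightarrow> (\<forall>a. a \<notin> A \<longrightarrow> f a = 0)" for f by (simp add: bspace_def fun_alg_def)
  have Y: "f \<in> ?Y \<longleftrightarrow> (\<forall>a. a \<notin> B \<longrightarrow> f a = 0)" for f by (simp add: bspace_def group_alg_def)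
  have G: "f \<in> bspace (fun_alg G) \<longleftrightarrow> (\<forall>a. a \<notin> carrier G \<longrightarrow> f a = 0)" for f :: "'g \<Rightarrow> 'k"
    by (simp add: bspace_def fun_alg_def)
  have bij: "bij_betw \<psi> ?X ?Y" using \<psi> by (simp add: hopf_iso_def)
  have row: "P a = \<psi> (\<lambda>x. if x \<in> A then delta a x else 0)" if "a \<in> carrier G" for a
  proof -
    have "(delta a :: 'g \<Rightarrow> 'k) \<in> bspace (fun_alg G)" using that unfolding G by (auto simp: delta_def)
    then show ?thesis using fac p pairing_map_delta[OF that] by metis
  qed
  have zero: "\<psi> (\<lambda>x. 0) = (\<lambda>x. 0)"
  proof -
    have "\<psi> (\<lambda>x. if x \<in> A then 0 else 0) = pairing_map P (\<lambda>x. 0)"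
      using fac[of "\<lambda>x. 0"] p[of "\<lambda>x. 0"] by (simp add: G)
    then show ?thesis by (simp add: pairing_map_def)
  qed
  have "a \<in> A \<longleftrightarrow> a \<in> supp P" for a
  proof
    assume a: "a \<in> A"
    then have ac: "a \<in> carrier G" using sub by blast
    have "(\<lambda>x. if x \<in> A then delta a x else 0) \<in> ?X" "(\<lambda>x. 0) \<in> ?X" by (auto simp: X)
    moreover have "(\<lambda>x. if x \<in> A then delta a x else 0) \<noteq> (\<lambda>x. 0 :: 'k)"
      using a by (auto simp: fun_eq_iff delta_def intro!: exI[of _ a])
    ultimately have "\<psi> (\<lambda>x. if x \<in> A then delta a x else 0) \<noteq> \<psi> (\<lambda>x. 0)"
      using inj_on_eq_iff[OF bij_betw_imp_inj_on[OF bij]] by blast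
    then have "P a \<noteq> (\<lambda>x. 0)" by (simp only: row[OF ac] zero not_False_eq_True)
    then show "a \<in> supp P" by (auto simp: supp_def fun_eq_iff)
  next
    assume a: "a \<in> supp P"
    then have ac: "a \<in> carrier G" using supp_carrier[OF P] by blast
    show "a \<in> A"
    proof (rule ccontr)
      assume "a \<notin> A"
      then have "(\<lambda>x. if x \<in> A then delta a x else 0) = (\<lambda>x. 0 :: 'k)" by (auto simp: delta_def)
      then have "P a = (\<lambda>x. 0)" using row[OF ac] zero by simp
      then show False using a by (simp add: supp_def)
    qed
  qed
  moreover have "b \<in> B \<longleftrightarrow> b \<in> supp (\<lambda>a h. P h a)" for b
  proof
    assume b: "b \<in> B"
    then have "delta b \<in> ?Y" by (auto simp: Y delta_def)
    then have "delta b \<in> \<psi> ` ?X" using bij_betw_imp_surj_on[OF bij] by simp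
    then obtain f where f: "f \<in> ?X" "\<psi> f = delta b" by (metis imageE)
    then have fG: "f \<in> bspace (fun_alg G)" using sub by (auto simp: X G)
    have "(\<lambda>x. if x \<in> A then f x else 0) = f" using f(1) by (auto simp: X)
    then have "pairing_map P f = delta b" using fac[OF fG] p[OF fG] f(2) by simp
    then have "(\<Sum>a\<in>carrier G. f a * P a b) = 1" by (auto simp: pairing_map_def delta_def fun_eq_iff)
    then have "(\<Sum>a\<in>carrier G. f a * P a b) \<noteq> 0" by simp
    then obtain a where "f a * P a b \<noteq> 0" by (rule sum.not_neutral_contains_not_neutral)
    then have "\<exists>a. P a b \<noteq> 0" by auto
    then show "b \<in> supp (\<lambda>a h. P h a)" by (simp add: supp_def)
  next
    assume "b \<in> supp (\<lambda>a h. P h a)"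
    then obtain a where a: "P a b \<noteq> 0" by (auto simp: supp_def)
    then have ac: "a \<in> carrier G" using pairingD(1)[OF P] by blast
    have "(\<lambda>x. if x \<in> A then delta a x else 0) \<in> ?X" by (auto simp: X)
    then have "P a \<in> ?Y" unfolding row[OF ac] by (rule bij_betw_apply[OF bij])
    then show "b \<in> B" using a by (auto simp: Y)
  qed
  ultimately show "A = supp P \<and> B = supp (\<lambda>a h. P h a)" by blast
qed

end

section \<open>Weak $R$-matrices with central $A$ and $B$\<close>

lemma orthogonal_idempotents:
  fixes f :: "'a \<Rightarrow> 'k::field"
  assumes orth: "\<And>a b. a \<in> S \<Longrightarrow> b \<in> S \<Longrightarrow> f a * f b = (if a = b then f a else 0)" and sum: "(\<Sum>a\<in>S. f a) = 1"
  obtains t where "t \<in> S" "\<And>a. a \<in> S \<Longrightarrow> f a = (if a = t then 1 else 0)"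
proof -
  have "(\<Sum>a\<in>S. f a) \<noteq> 0" using sum by simp
  then obtain t where t: "t \<in> S" "f t \<noteq> 0" by (rule sum.not_neutral_contains_not_neutral)
  have "f a = (if a = t then 1 else 0)" if "a \<in> S" for a
    using orth[OF t(1) that] t(2) by (auto split: if_splits)
  with t(1) show ?thesis by (rule that)
qed

context finite_group
begin

abbreviation pairing_of :: "(('g \<times> 'g) \<times> ('g \<times> 'g) \<Rightarrow> 'k::field) \<Rightarrow> 'g \<Rightarrow> 'g \<Rightarrow> 'k" where
  "pairing_of R a h \<equiv> R ((\<one>, a), (\<one>, h))"

lemma weak_coeffsD:
  assumes "weak_coeffs R"
  shows "\<not> (s \<in> carrier G \<and> a \<in> carrier G \<and> y \<in> carrier G \<and> h \<in> carrier G) \<Longrightarrow> R ((s, a), (y, h)) = 0"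
    and "s \<in> carrier G \<Longrightarrow> a \<in> carrier G \<Longrightarrow> s' \<in> carrier G \<Longrightarrow> a' \<in> carrier G \<Longrightarrow> x \<in> carrier G \<Longrightarrow> k \<in> carrier G \<Longrightarrow>
      (\<Sum>g\<in>carrier G. R ((s, a), (x, g)) * R ((s', a'), (inv g \<otimes> x \<otimes> g, inv g \<otimes> k))) =
      (if a = a' then R ((s' \<otimes> s, a), (x, k)) else 0)"
    and "s \<in> carrier G \<Longrightarrow> c \<in> carrier G \<Longrightarrow> b \<in> carrier G \<Longrightarrow> g \<in> carrier G \<Longrightarrow> y \<in> carrier G \<Longrightarrow> h \<in> carrier G \<Longrightarrow>
      (\<Sum>a\<in>carrier G. R ((s, a), (y, h)) * R ((inv a \<otimes> s \<otimes> a, inv a \<otimes> c), (b, g))) =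
      (if g = h then R ((s, c), (y \<otimes> b, g)) else 0)"
    and "x \<in> carrier G \<Longrightarrow> h \<in> carrier G \<Longrightarrow> (\<Sum>a\<in>carrier G. R ((\<one>, a), (x, h))) = (if h = \<one> then 1 else 0)"
    and "s \<in> carrier G \<Longrightarrow> a \<in> carrier G \<Longrightarrow> (\<Sum>h\<in>carrier G. R ((s, a), (\<one>, h))) = (if a = \<one> then 1 else 0)"
  using assms unfolding weak_coeffs_def by blast+

lemma pairing_pairing_of:
  assumes R: "weak_coeffs R"
  shows "pairing (pairing_of R)"
  unfolding pairing_def
proof (intro conjI ballI allI impI)
  fix a h assume "\<not> (a \<in> carrier G \<and> h \<in> carrier G)"
  then show "pairing_of R a h = 0" using weak_coeffsD(1)[OF R] by blast
next
  fix a a' k assume c: "a \<in> carrier G" "a' \<in> carrier G" "k \<in> carrier G"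
  show "(\<Sum>g\<in>carrier G. pairing_of R a g * pairing_of R a' (inv g \<otimes> k)) = (if a = a' then pairing_of R a k else 0)"
    using weak_coeffsD(2)[OF R one_closed c(1) one_closed c(2) one_closed c(3)] by simp
next
  fix c g g' assume c: "c \<in> carrier G" "g \<in> carrier G" "g' \<in> carrier G"
  show "(\<Sum>a\<in>carrier G. pairing_of R a g * pairing_of R (inv a \<otimes> c) g') = (if g = g' then pairing_of R c g else 0)"
    using weak_coeffsD(3)[OF R one_closed c(1) one_closed c(3) one_closed c(2)] by auto
qed (use weak_coeffsD(4,5)[OF R] in auto)

lemma p_comp_eq: "p_comp G R f = pairing_map (pairing_of R) f"
proof
  fix h
  have "p_comp G R f h = (\<Sum>s\<in>carrier G. \<Sum>k\<in>carrier G. if s = \<one> then f k * R ((\<one>, k), (\<one>, h)) else 0)"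
    unfolding p_comp_def ev1_id_def F_map_def hash_def sum.cartesian_product[symmetric]
    by (intro sum.cong) (auto simp: delta_def)
  also have "\<dots> = (\<Sum>k\<in>carrier G. \<Sum>s\<in>carrier G. if s = \<one> then f k * R ((\<one>, k), (\<one>, h)) else 0)"
    by (rule sum.swap)
  finally show "p_comp G R f h = pairing_map (pairing_of R) f h"
    by (simp add: pairing_map_def sum.delta)
qed

lemma A_B_subgroup_eq:
  assumes R: "weak_coeffs R"
  shows "A_subgroup G R = supp (pairing_of R)" "B_subgroup G R = supp (\<lambda>a h. pairing_of R h a)"
proof -
  have "p_factors_through G (p_comp G R) A B \<longleftrightarrow> A = supp (pairing_of R) \<and> B = supp (\<lambda>a h. pairing_of R h a)" for A B
    by (rule p_factors_through_iff[OF pairing_pairing_of[OF R] p_comp_eq])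
  then have "(THE AB. p_factors_through G (p_comp G R) (fst AB) (snd AB)) =
      (supp (pairing_of R), supp (\<lambda>a h. pairing_of R h a))"
    by (intro the_equality) auto
  then show "A_subgroup G R = supp (pairing_of R)" "B_subgroup G R = supp (\<lambda>a h. pairing_of R h a)"
    by (simp_all add: A_subgroup_def B_subgroup_def)
qed

definition central_pairing :: "('g \<Rightarrow> 'g \<Rightarrow> 'k::field) \<Rightarrow> bool" where
  "central_pairing P \<longleftrightarrow> pairing P \<and> supp P \<subseteq> center G \<and> supp (\<lambda>a h. P h a) \<subseteq> center G"

lemma central_pairingD:
  assumes "central_pairing P"
  shows "pairing P" and "P a h \<noteq> 0 \<Longrightarrow> a \<in> center G" and "P a h \<noteq> 0 \<Longrightarrow> h \<in> center G"
  using assms by (auto simp: central_pairing_def supp_def)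

text \<open>For \<open>a \<in> A\<close> the element with coefficients \<open>R ((s, a), (\<one>, g))\<close> of the group algebra is
  non-zero because multiplying it by the one for \<open>s\<^sup>-\<^sup>1\<close> gives $p(e_a)$; the support law at a
  non-zero coefficient says that \<open>a\<close> commutes with \<open>s\<close>.  The argument for \<open>B\<close> is dual.\<close>

lemma support_law_central_pairing:
  assumes R: "weak_coeffs R" and law: "support_law m R"
    and m: "\<And>s. s \<in> carrier G \<Longrightarrow> m s \<one> = s" "\<And>y. y \<in> carrier G \<Longrightarrow> m \<one> y = y"
  shows "central_pairing (pairing_of R)"
  unfolding central_pairing_def
proof (intro conjI subsetI pairing_pairing_of[OF R])
  have lawD: "m s y = (inv h \<otimes> y \<otimes> h) \<otimes> (inv a \<otimes> s \<otimes> a)"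
    if "R ((s, a), (y, h)) \<noteq> 0" "s \<in> carrier G" "a \<in> carrier G" "y \<in> carrier G" "h \<in> carrier G" for s a y h
    using law that unfolding support_law_def by blast
  fix a assume "a \<in> supp (pairing_of R)"
  then obtain k where k: "R ((\<one>, a), (\<one>, k)) \<noteq> 0" by (auto simp: supp_def)
  then have car: "a \<in> carrier G" "k \<in> carrier G" using weak_coeffsD(1)[OF R] by blast+
  show "a \<in> center G"
  proof (rule centerI[OF car(1)])
    fix s assume s: "s \<in> carrier G"
    have "(\<Sum>g\<in>carrier G. R ((s, a), (\<one>, g)) * R ((inv s, a), (inv g \<otimes> \<one> \<otimes> g, inv g \<otimes> k))) \<noteq> 0"
      using weak_coeffsD(2)[OF R s car(1) inv_closed[OF s] car(1) one_closed car(2)] k s by simp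
    then obtain g where g: "g \<in> carrier G" "R ((s, a), (\<one>, g)) * R ((inv s, a), (inv g \<otimes> \<one> \<otimes> g, inv g \<otimes> k)) \<noteq> 0"
      by (rule sum.not_neutral_contains_not_neutral)
    then have "m s \<one> = (inv g \<otimes> \<one> \<otimes> g) \<otimes> (inv a \<otimes> s \<otimes> a)"
      by (intro lawD) (use s car in auto)
    then have "s = inv a \<otimes> (s \<otimes> a)" using m s car g by (simp add: m_assoc)
    then show "a \<otimes> s = s \<otimes> a" using s car by (metis inv_cancel_left(2) m_closed)
  qed
next
  have lawD: "m s y = (inv h \<otimes> y \<otimes> h) \<otimes> (inv a \<otimes> s \<otimes> a)"
    if "R ((s, a), (y, h)) \<noteq> 0" "s \<in> carrier G" "a \<in> carrier G" "y \<in> carrier G" "h \<in> carrier G" for s a y h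
    using law that unfolding support_law_def by blast
  fix h assume "h \<in> supp (\<lambda>a h. pairing_of R h a)"
  then obtain c where c: "R ((\<one>, c), (\<one>, h)) \<noteq> 0" by (auto simp: supp_def)
  then have car: "c \<in> carrier G" "h \<in> carrier G" using weak_coeffsD(1)[OF R] by blast+
  show "h \<in> center G"
  proof (rule centerI[OF car(2)])
    fix y assume y: "y \<in> carrier G"
    have "(\<Sum>a\<in>carrier G. R ((\<one>, a), (y, h)) * R ((inv a \<otimes> \<one> \<otimes> a, inv a \<otimes> c), (inv y, h))) \<noteq> 0"
      using weak_coeffsD(3)[OF R one_closed car(1) inv_closed[OF y] car(2) y car(2)] c y by simp
    then obtain a where a: "a \<in> carrier G" "R ((\<one>, a), (y, h)) * R ((inv a \<otimes> \<one> \<otimes> a, inv a \<otimes> c), (inv y, h)) \<noteq> 0"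
      by (rule sum.not_neutral_contains_not_neutral)
    then have "m \<one> y = (inv h \<otimes> y \<otimes> h) \<otimes> (inv a \<otimes> \<one> \<otimes> a)"
      by (intro lawD) (use y car in auto)
    then have "y = inv h \<otimes> (y \<otimes> h)" using m y car a by (simp add: m_assoc)
    then show "h \<otimes> y = y \<otimes> h" using y car by (metis inv_cancel_left(2) m_closed)
  qed
qed

lemma center_conj: "z \<in> center G \<Longrightarrow> x \<in> carrier G \<Longrightarrow> inv z \<otimes> x \<otimes> z = x"
  by (metis centerD inv_cancel_left(1) inv_closed m_assoc)

lemma center_conj': "z \<in> center G \<Longrightarrow> x \<in> carrier G \<Longrightarrow> inv x \<otimes> z \<otimes> x = z"
  using centerD(1)[of z] centerD(2)[of z x] by (simp add: m_assoc)

text \<open>The element with components \<open>u\<^sup>* = \<phi>\<close>, \<open>S v = w\<close>, \<open>r\<close> and \<open>p\<close> with matrix \<open>P\<close>.\<close>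

definition R_of :: "('g \<Rightarrow> 'g) \<Rightarrow> ('g \<Rightarrow> 'g) \<Rightarrow> ('g \<Rightarrow> 'g \<Rightarrow> 'k::field) \<Rightarrow> ('g \<Rightarrow> 'g \<Rightarrow> 'k) \<Rightarrow>
    ('g \<times> 'g) \<times> ('g \<times> 'g) \<Rightarrow> 'k" where
  "R_of \<phi> w r P = (\<lambda>((s, a), (y, h)).
     if s \<in> carrier G \<and> a \<in> carrier G \<and> y \<in> carrier G \<and> h \<in> carrier G
     then r s y * P (a \<otimes> inv (\<phi> y)) (h \<otimes> w s) else 0)"

text \<open>Compatibilities between the components that hold for every weak $R$-matrix with central
  \<open>A\<close> and \<open>B\<close>; in general \<open>r\<close> is only bimultiplicative up to a twist.\<close>

definition weak_data :: "('g \<Rightarrow> 'g) \<Rightarrow> ('g \<Rightarrow> 'g) \<Rightarrow> ('g \<Rightarrow> 'g \<Rightarrow> 'k::field) \<Rightarrow> ('g \<Rightarrow> 'g \<Rightarrow> 'k) \<Rightarrow> bool" where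
  "weak_data \<phi> w r P \<longleftrightarrow> \<phi> \<in> hom G G \<and> w \<in> hom G G \<and> central_pairing P \<and>
    (\<forall>s\<in>carrier G. r s \<one> = 1 \<and> r \<one> s = 1) \<and>
    (\<forall>s\<in>carrier G. \<forall>x\<in>carrier G. \<phi> (w s \<otimes> x \<otimes> inv (w s)) = \<phi> x \<and> w (inv (\<phi> x) \<otimes> s \<otimes> \<phi> x) = w s) \<and>
    (\<forall>s\<in>carrier G. \<forall>t\<in>carrier G. \<forall>x\<in>carrier G. r (t \<otimes> s) x = r s x * r t (w s \<otimes> x \<otimes> inv (w s))) \<and>
    (\<forall>s\<in>carrier G. \<forall>y\<in>carrier G. \<forall>b\<in>carrier G. r s (y \<otimes> b) = r s y * r (inv (\<phi> y) \<otimes> s \<otimes> \<phi> y) b)"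

end

locale centrally_supported = finite_group G for G :: "('g, 'm) monoid_scheme" (structure) +
  fixes R :: "('g \<times> 'g) \<times> ('g \<times> 'g) \<Rightarrow> 'k::field"
  assumes weak: "weak_coeffs R" and central: "central_pairing (pairing_of R)"
begin

text \<open>With the value of $F(R)(e_a \# s)$ as the element of the double in question, \<open>W\<close> and \<open>T\<close> are its
  image under the counit of the second leg and its sum over \<open>a\<close>; \<open>U\<close>, \<open>V\<close> and \<open>r\<close> are the coefficients
  of $u(e_a)$, of \<open>v(s)\<close> and of \<open>r(s)\<close>.\<close>

definition "U a y = (\<Sum>h\<in>carrier G. R ((\<one>, a), (y, h)))"
definition "V s h = (\<Sum>a\<in>carrier G. R ((s, a), (\<one>, h)))"
definition "W s a y = (\<Sum>h\<in>carrier G. R ((s, a), (y, h)))"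
definition "T s y h = (\<Sum>a\<in>carrier G. R ((s, a), (y, h)))"
definition "r s y = (\<Sum>a\<in>carrier G. W s a y)"

lemmas mult = weak_coeffsD(2)[OF weak]
lemmas comult = weak_coeffsD(3)[OF weak]

lemma r_sum_T: "r s y = (\<Sum>h\<in>carrier G. T s y h)"
  unfolding r_def W_def T_def by (rule sum.swap)

lemma central_coeff:
  assumes "R ((\<one>, a), (\<one>, h)) \<noteq> 0"
  shows "a \<in> center G" "h \<in> center G"
  using central_pairingD(2,3)[OF central assms] .

text \<open>The multiplication and comultiplication equations are used through their sums over one or
  more indices, which apply a counit or an evaluation to one tensor leg.\<close>

lemma sum_T_mult:
  assumes "s \<in> carrier G" "a \<in> carrier G" "t \<in> carrier G" "x \<in> carrier G" "k \<in> carrier G"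
  shows "(\<Sum>g\<in>carrier G. R ((s, a), (x, g)) * T t (inv g \<otimes> x \<otimes> g) (inv g \<otimes> k)) = R ((t \<otimes> s, a), (x, k))"
proof -
  have "(\<Sum>g\<in>carrier G. R ((s, a), (x, g)) * T t (inv g \<otimes> x \<otimes> g) (inv g \<otimes> k)) =
    (\<Sum>a'\<in>carrier G. \<Sum>g\<in>carrier G. R ((s, a), (x, g)) * R ((t, a'), (inv g \<otimes> x \<otimes> g, inv g \<otimes> k)))"
    unfolding T_def sum_distrib_left by (rule sum.swap)
  also have "\<dots> = (\<Sum>a'\<in>carrier G. if a' = a then R ((t \<otimes> s, a), (x, k)) else 0)"
    by (rule sum.cong) (use assms in \<open>auto simp: mult\<close>)
  finally show ?thesis using assms by (simp add: sum.delta)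
qed

lemma sum_W_mult:
  assumes "s \<in> carrier G" "a \<in> carrier G" "t \<in> carrier G" "a' \<in> carrier G" "x \<in> carrier G"
  shows "(\<Sum>g\<in>carrier G. R ((s, a), (x, g)) * W t a' (inv g \<otimes> x \<otimes> g)) = (if a = a' then W (t \<otimes> s) a x else 0)"
proof -
  have "(\<Sum>g\<in>carrier G. R ((s, a), (x, g)) * W t a' (inv g \<otimes> x \<otimes> g)) =
    (\<Sum>g\<in>carrier G. R ((s, a), (x, g)) * (\<Sum>k\<in>carrier G. R ((t, a'), (inv g \<otimes> x \<otimes> g, inv g \<otimes> k))))"
  proof (rule sum.cong[OF refl])
    fix g assume "g \<in> carrier G"
    then show "R ((s, a), (x, g)) * W t a' (inv g \<otimes> x \<otimes> g) =
        R ((s, a), (x, g)) * (\<Sum>k\<in>carrier G. R ((t, a'), (inv g \<otimes> x \<otimes> g, inv g \<otimes> k)))"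
      using sum_mult_left[of "inv g" "\<lambda>k. R ((t, a'), (inv g \<otimes> x \<otimes> g, k))"] by (simp only: W_def inv_closed)
  qed
  also have "\<dots> = (\<Sum>k\<in>carrier G. \<Sum>g\<in>carrier G. R ((s, a), (x, g)) * R ((t, a'), (inv g \<otimes> x \<otimes> g, inv g \<otimes> k)))"
    unfolding sum_distrib_left by (rule sum.swap)
  also have "\<dots> = (\<Sum>k\<in>carrier G. if a = a' then R ((t \<otimes> s, a), (x, k)) else 0)"
    by (rule sum.cong) (use assms in \<open>auto simp: mult\<close>)
  finally show ?thesis by (simp add: W_def)
qed

lemma sum_W_comult:
  assumes "s \<in> carrier G" "c \<in> carrier G" "b \<in> carrier G" "y \<in> carrier G" "h \<in> carrier G"
  shows "(\<Sum>a\<in>carrier G. R ((s, a), (y, h)) * W (inv a \<otimes> s \<otimes> a) (inv a \<otimes> c) b) = R ((s, c), (y \<otimes> b, h))"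
proof -
  have "(\<Sum>a\<in>carrier G. R ((s, a), (y, h)) * W (inv a \<otimes> s \<otimes> a) (inv a \<otimes> c) b) =
    (\<Sum>g\<in>carrier G. \<Sum>a\<in>carrier G. R ((s, a), (y, h)) * R ((inv a \<otimes> s \<otimes> a, inv a \<otimes> c), (b, g)))"
    unfolding W_def sum_distrib_left by (rule sum.swap)
  also have "\<dots> = (\<Sum>g\<in>carrier G. if g = h then R ((s, c), (y \<otimes> b, h)) else 0)"
    by (rule sum.cong) (use assms in \<open>auto simp: comult\<close>)
  finally show ?thesis using assms by (simp add: sum.delta)
qed

lemma sum_T_comult:
  assumes "s \<in> carrier G" "b \<in> carrier G" "g \<in> carrier G" "y \<in> carrier G" "h \<in> carrier G"
  shows "(\<Sum>a\<in>carrier G. R ((s, a), (y, h)) * T (inv a \<otimes> s \<otimes> a) b g) = (if g = h then T s (y \<otimes> b) g else 0)"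
proof -
  have "(\<Sum>a\<in>carrier G. R ((s, a), (y, h)) * T (inv a \<otimes> s \<otimes> a) b g) =
    (\<Sum>a\<in>carrier G. R ((s, a), (y, h)) * (\<Sum>c\<in>carrier G. R ((inv a \<otimes> s \<otimes> a, inv a \<otimes> c), (b, g))))"
  proof (rule sum.cong[OF refl])
    fix a assume "a \<in> carrier G"
    then show "R ((s, a), (y, h)) * T (inv a \<otimes> s \<otimes> a) b g =
        R ((s, a), (y, h)) * (\<Sum>c\<in>carrier G. R ((inv a \<otimes> s \<otimes> a, inv a \<otimes> c), (b, g)))"
      using sum_mult_left[of "inv a" "\<lambda>c. R ((inv a \<otimes> s \<otimes> a, c), (b, g))"] by (simp only: T_def inv_closed)
  qed
  also have "\<dots> = (\<Sum>c\<in>carrier G. \<Sum>a\<in>carrier G. R ((s, a), (y, h)) * R ((inv a \<otimes> s \<otimes> a, inv a \<otimes> c), (b, g)))"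
    unfolding sum_distrib_left by (rule sum.swap)
  also have "\<dots> = (\<Sum>c\<in>carrier G. if g = h then R ((s, c), (y \<otimes> b, g)) else 0)"
    by (rule sum.cong) (use assms in \<open>auto simp: comult\<close>)
  finally show ?thesis by (simp add: T_def)
qed

lemma sum_r_mult:
  assumes "s \<in> carrier G" "t \<in> carrier G" "x \<in> carrier G"
  shows "(\<Sum>g\<in>carrier G. T s x g * r t (inv g \<otimes> x \<otimes> g)) = r (t \<otimes> s) x"
proof -
  have "(\<Sum>g\<in>carrier G. T s x g * r t (inv g \<otimes> x \<otimes> g)) =
    (\<Sum>g\<in>carrier G. \<Sum>a\<in>carrier G. \<Sum>a'\<in>carrier G. R ((s, a), (x, g)) * W t a' (inv g \<otimes> x \<otimes> g))"
    by (simp add: T_def r_def sum_product)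
  also have "\<dots> = (\<Sum>a\<in>carrier G. \<Sum>g\<in>carrier G. \<Sum>a'\<in>carrier G. R ((s, a), (x, g)) * W t a' (inv g \<otimes> x \<otimes> g))"
    by (rule sum.swap)
  also have "\<dots> = (\<Sum>a\<in>carrier G. \<Sum>a'\<in>carrier G. \<Sum>g\<in>carrier G. R ((s, a), (x, g)) * W t a' (inv g \<otimes> x \<otimes> g))"
    by (rule sum.cong[OF refl]) (rule sum.swap)
  also have "\<dots> = (\<Sum>a\<in>carrier G. \<Sum>a'\<in>carrier G. if a' = a then W (t \<otimes> s) a x else 0)"
    by (intro sum.cong refl) (use assms in \<open>auto simp: sum_W_mult\<close>)
  finally show ?thesis by (simp add: r_def sum.delta)
qed

lemma sum_r_comult:
  assumes "s \<in> carrier G" "b \<in> carrier G" "y \<in> carrier G"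
  shows "(\<Sum>a\<in>carrier G. W s a y * r (inv a \<otimes> s \<otimes> a) b) = r s (y \<otimes> b)"
proof -
  have "(\<Sum>a\<in>carrier G. W s a y * r (inv a \<otimes> s \<otimes> a) b) =
    (\<Sum>a\<in>carrier G. \<Sum>h\<in>carrier G. \<Sum>g\<in>carrier G. R ((s, a), (y, h)) * T (inv a \<otimes> s \<otimes> a) b g)"
    by (simp add: W_def r_sum_T sum_product)
  also have "\<dots> = (\<Sum>h\<in>carrier G. \<Sum>a\<in>carrier G. \<Sum>g\<in>carrier G. R ((s, a), (y, h)) * T (inv a \<otimes> s \<otimes> a) b g)"
    by (rule sum.swap)
  also have "\<dots> = (\<Sum>h\<in>carrier G. \<Sum>g\<in>carrier G. \<Sum>a\<in>carrier G. R ((s, a), (y, h)) * T (inv a \<otimes> s \<otimes> a) b g)"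
    by (rule sum.cong[OF refl]) (rule sum.swap)
  also have "\<dots> = (\<Sum>h\<in>carrier G. \<Sum>g\<in>carrier G. if g = h then T s (y \<otimes> b) h else 0)"
    by (intro sum.cong refl) (use assms in \<open>auto simp: sum_T_comult\<close>)
  finally show ?thesis by (simp add: r_sum_T sum.delta)
qed

lemma coeff_at_one:
  assumes "s \<in> carrier G" "a \<in> carrier G" "k \<in> carrier G"
  shows "R ((s, a), (\<one>, k)) = (\<Sum>g\<in>carrier G. R ((\<one>, a), (\<one>, g)) * V s (inv g \<otimes> k))"
  using sum_T_mult[OF one_closed assms(2,1) one_closed assms(3)] assms by (simp add: V_def T_def)

lemma coeff_at_one_central:
  assumes "R ((s, a), (\<one>, k)) \<noteq> 0" "s \<in> carrier G" "a \<in> carrier G" "k \<in> carrier G"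
  shows "a \<in> center G"
proof -
  have "(\<Sum>g\<in>carrier G. R ((\<one>, a), (\<one>, g)) * V s (inv g \<otimes> k)) \<noteq> 0"
    using assms coeff_at_one by simp
  then obtain g where "R ((\<one>, a), (\<one>, g)) * V s (inv g \<otimes> k) \<noteq> 0"
    by (rule sum.not_neutral_contains_not_neutral)
  then show ?thesis using central_coeff by auto
qed

lemma coeff_one:
  assumes "c \<in> carrier G" "y \<in> carrier G" "h \<in> carrier G"
  shows "R ((\<one>, c), (y, h)) = (\<Sum>a\<in>carrier G. R ((\<one>, a), (\<one>, h)) * U (inv a \<otimes> c) y)"
proof -
  have "R ((\<one>, c), (y, h)) = (\<Sum>a\<in>carrier G. R ((\<one>, a), (\<one>, h)) * W (inv a \<otimes> \<one> \<otimes> a) (inv a \<otimes> c) y)"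
    using sum_W_comult[OF one_closed assms(1,2) one_closed assms(3)] assms by simp
  also have "\<dots> = (\<Sum>a\<in>carrier G. R ((\<one>, a), (\<one>, h)) * U (inv a \<otimes> c) y)"
    by (rule sum.cong) (simp_all add: U_def W_def)
  finally show ?thesis .
qed

lemma coeff_one_central:
  assumes "R ((\<one>, c), (y, h)) \<noteq> 0" "c \<in> carrier G" "y \<in> carrier G" "h \<in> carrier G"
  shows "h \<in> center G"
proof -
  have "(\<Sum>a\<in>carrier G. R ((\<one>, a), (\<one>, h)) * U (inv a \<otimes> c) y) \<noteq> 0"
    using assms coeff_one by simp
  then obtain a where "R ((\<one>, a), (\<one>, h)) * U (inv a \<otimes> c) y \<noteq> 0"
    by (rule sum.not_neutral_contains_not_neutral)
  then show ?thesis using central_coeff by auto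
qed

lemma sum_U: "y \<in> carrier G \<Longrightarrow> (\<Sum>a\<in>carrier G. U a y) = 1"
  unfolding U_def by (subst sum.swap) (simp add: weak_coeffsD(4)[OF weak] sum.delta)

lemma sum_V: "s \<in> carrier G \<Longrightarrow> (\<Sum>h\<in>carrier G. V s h) = 1"
  unfolding V_def by (subst sum.swap) (simp add: weak_coeffsD(5)[OF weak] sum.delta)

text \<open>Since \<open>B\<close> is central, the factors \<open>p(e_b)\<close> do not act on the functions: the coordinates of
  $u(e_a)$ at \<open>y\<close> are orthogonal idempotents of the field.\<close>

lemma U_orthogonal:
  assumes "a \<in> carrier G" "b \<in> carrier G" "y \<in> carrier G"
  shows "U a y * U b y = (if a = b then U a y else 0)"
proof -
  have UW: "U = W \<one>" by (intro ext) (simp add: U_def W_def)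
  have "U a y * U b y = (\<Sum>g\<in>carrier G. R ((\<one>, a), (y, g)) * U b y)"
    by (subst U_def) (simp add: sum_distrib_right)
  also have "\<dots> = (\<Sum>g\<in>carrier G. R ((\<one>, a), (y, g)) * U b (inv g \<otimes> y \<otimes> g))"
  proof (rule sum.cong[OF refl])
    fix g assume g: "g \<in> carrier G"
    show "R ((\<one>, a), (y, g)) * U b y = R ((\<one>, a), (y, g)) * U b (inv g \<otimes> y \<otimes> g)"
      using coeff_one_central[OF _ assms(1,3) g] center_conj[OF _ assms(3)]
      by (cases "R ((\<one>, a), (y, g)) = 0") auto
  qed
  finally show ?thesis using sum_W_mult[OF one_closed assms(1) one_closed assms(2,3)] by (simp add: UW)
qed

text \<open>Dually, centrality of \<open>A\<close> makes \<open>v(s)\<close> a group-like element, that is, an element of \<open>G\<close>.\<close>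

lemma V_orthogonal:
  assumes "g \<in> carrier G" "h \<in> carrier G" "s \<in> carrier G"
  shows "V s g * V s h = (if g = h then V s g else 0)"
proof -
  have VT: "V s h = T s \<one> h" for s h by (simp add: V_def T_def)
  have "V s h * V s g = (\<Sum>a\<in>carrier G. R ((s, a), (\<one>, h)) * V s g)"
    by (subst V_def) (simp add: sum_distrib_right)
  also have "\<dots> = (\<Sum>a\<in>carrier G. R ((s, a), (\<one>, h)) * V (inv a \<otimes> s \<otimes> a) g)"
  proof (rule sum.cong[OF refl])
    fix a assume a: "a \<in> carrier G"
    show "R ((s, a), (\<one>, h)) * V s g = R ((s, a), (\<one>, h)) * V (inv a \<otimes> s \<otimes> a) g"
      using coeff_at_one_central[OF _ assms(3) a assms(2)] center_conj[OF _ assms(3)]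
      by (cases "R ((s, a), (\<one>, h)) = 0") auto
  qed
  finally show ?thesis using sum_T_comult[OF assms(3) one_closed assms(1) one_closed assms(2)]
    by (simp add: VT mult.commute)
qed

definition "\<phi> y = (SOME t. t \<in> carrier G \<and> (\<forall>a\<in>carrier G. U a y = (if a = t then 1 else 0)))"
definition "v s = (SOME t. t \<in> carrier G \<and> (\<forall>h\<in>carrier G. V s h = (if h = t then 1 else 0)))"

lemma \<phi>:
  assumes "y \<in> carrier G"
  shows "\<phi> y \<in> carrier G" "a \<in> carrier G \<Longrightarrow> U a y = (if a = \<phi> y then 1 else 0)"
proof -
  obtain t where "t \<in> carrier G" "\<And>a. a \<in> carrier G \<Longrightarrow> U a y = (if a = t then 1 else 0)"
    using orthogonal_idempotents[of "carrier G" "\<lambda>a. U a y"] U_orthogonal sum_U assms by metis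
  then have "\<exists>t. t \<in> carrier G \<and> (\<forall>a\<in>carrier G. U a y = (if a = t then 1 else 0))" by blast
  from someI_ex[OF this] show "\<phi> y \<in> carrier G" "a \<in> carrier G \<Longrightarrow> U a y = (if a = \<phi> y then 1 else 0)"
    unfolding \<phi>_def by blast+
qed

lemma v:
  assumes "s \<in> carrier G"
  shows "v s \<in> carrier G" "h \<in> carrier G \<Longrightarrow> V s h = (if h = v s then 1 else 0)"
proof -
  obtain t where "t \<in> carrier G" "\<And>h. h \<in> carrier G \<Longrightarrow> V s h = (if h = t then 1 else 0)"
    using orthogonal_idempotents[of "carrier G" "V s"] V_orthogonal sum_V assms by metis
  then have "\<exists>t. t \<in> carrier G \<and> (\<forall>h\<in>carrier G. V s h = (if h = t then 1 else 0))" by blast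
  from someI_ex[OF this] show "v s \<in> carrier G" "h \<in> carrier G \<Longrightarrow> V s h = (if h = v s then 1 else 0)"
    unfolding v_def by blast+
qed

text \<open>Apply the counit of the group algebra to
  $F(R)(e_a \# s) = F(R)(e_a \# 1)\, F(R)(\varepsilon \# s)$; centrality of \<open>B\<close> removes the action.\<close>

lemma W_eq:
  assumes "s \<in> carrier G" "a \<in> carrier G" "x \<in> carrier G"
  shows "W s a x = U a x * r s x"
proof -
  have "W s a x = (\<Sum>k\<in>carrier G. \<Sum>g\<in>carrier G. R ((\<one>, a), (x, g)) * T s (inv g \<otimes> x \<otimes> g) (inv g \<otimes> k))"
    unfolding W_def by (rule sum.cong) (use assms in \<open>simp_all add: sum_T_mult\<close>)
  also have "\<dots> = (\<Sum>k\<in>carrier G. \<Sum>g\<in>carrier G. R ((\<one>, a), (x, g)) * T s x (inv g \<otimes> k))"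
  proof (intro sum.cong refl)
    fix g k assume g: "g \<in> carrier G"
    show "R ((\<one>, a), (x, g)) * T s (inv g \<otimes> x \<otimes> g) (inv g \<otimes> k) = R ((\<one>, a), (x, g)) * T s x (inv g \<otimes> k)"
      using coeff_one_central[OF _ assms(2,3) g] center_conj[OF _ assms(3)]
      by (cases "R ((\<one>, a), (x, g)) = 0") auto
  qed
  also have "\<dots> = (\<Sum>g\<in>carrier G. \<Sum>k\<in>carrier G. R ((\<one>, a), (x, g)) * T s x (inv g \<otimes> k))"
    by (rule sum.swap)
  also have "\<dots> = (\<Sum>g\<in>carrier G. R ((\<one>, a), (x, g)) * r s x)"
    by (rule sum.cong[OF refl]) (simp add: r_sum_T sum_distrib_left[symmetric] sum_mult_left)
  finally show ?thesis by (simp add: U_def sum_distrib_right)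
qed

lemma T_eq:
  assumes "s \<in> carrier G" "b \<in> carrier G" "h \<in> carrier G"
  shows "T s b h = r s b * V s h"
proof -
  have "T s b h = (\<Sum>c\<in>carrier G. \<Sum>a\<in>carrier G. R ((s, a), (\<one>, h)) * W (inv a \<otimes> s \<otimes> a) (inv a \<otimes> c) b)"
    unfolding T_def by (rule sum.cong) (use assms in \<open>simp_all add: sum_W_comult\<close>)
  also have "\<dots> = (\<Sum>c\<in>carrier G. \<Sum>a\<in>carrier G. R ((s, a), (\<one>, h)) * W s (inv a \<otimes> c) b)"
  proof (intro sum.cong refl)
    fix a c assume a: "a \<in> carrier G"
    show "R ((s, a), (\<one>, h)) * W (inv a \<otimes> s \<otimes> a) (inv a \<otimes> c) b = R ((s, a), (\<one>, h)) * W s (inv a \<otimes> c) b"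
      using coeff_at_one_central[OF _ assms(1) a assms(3)] center_conj[OF _ assms(1)]
      by (cases "R ((s, a), (\<one>, h)) = 0") auto
  qed
  also have "\<dots> = (\<Sum>a\<in>carrier G. \<Sum>c\<in>carrier G. R ((s, a), (\<one>, h)) * W s (inv a \<otimes> c) b)"
    by (rule sum.swap)
  also have "\<dots> = (\<Sum>a\<in>carrier G. R ((s, a), (\<one>, h)) * r s b)"
    by (rule sum.cong[OF refl]) (simp add: r_def sum_distrib_left[symmetric] sum_mult_left[where f = "\<lambda>c. W s c b"])
  also have "\<dots> = V s h * r s b" by (simp only: V_def sum_distrib_right)
  finally show ?thesis by (simp only: mult.commute)
qed

text \<open>The factorization $F(R)(e_a \# s) = F(R)(e_a \# 1)\, F(R)(\varepsilon \# s)$ leaves one term, since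
  \<open>v(s)\<close> and the values of \<open>u\<^sup>*\<close> are single group elements.\<close>

lemma coeff_eq:
  assumes c: "s \<in> carrier G" "a \<in> carrier G" "y \<in> carrier G" "h \<in> carrier G"
  shows "R ((s, a), (y, h)) = r s y * pairing_of R (a \<otimes> inv (\<phi> y)) (h \<otimes> inv (v s))"
proof -
  have "R ((s, a), (y, h)) = (\<Sum>g\<in>carrier G. R ((\<one>, a), (y, g)) * T s (inv g \<otimes> y \<otimes> g) (inv g \<otimes> h))"
    using c by (simp add: sum_T_mult)
  also have "\<dots> = (\<Sum>g\<in>carrier G. if g = h \<otimes> inv (v s) then R ((\<one>, a), (y, h \<otimes> inv (v s))) * r s y else 0)"
  proof (rule sum.cong[OF refl])
    fix g assume g: "g \<in> carrier G"
    have "R ((\<one>, a), (y, g)) * T s (inv g \<otimes> y \<otimes> g) (inv g \<otimes> h) = R ((\<one>, a), (y, g)) * T s y (inv g \<otimes> h)"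
      using coeff_one_central[OF _ c(2,3) g] center_conj[OF _ c(3)]
      by (cases "R ((\<one>, a), (y, g)) = 0") auto
    also have "T s y (inv g \<otimes> h) = (if inv g \<otimes> h = v s then r s y else 0)"
      using c g by (simp add: T_eq v)
    also have "inv g \<otimes> h = v s \<longleftrightarrow> g = h \<otimes> inv (v s)"
      using c g v(1)[OF c(1)] by (metis inv_closed inv_inv mult_eq_iff_left mult_eq_iff_right)
    also have "R ((\<one>, a), (y, g)) * (if g = h \<otimes> inv (v s) then r s y else 0) =
      (if g = h \<otimes> inv (v s) then R ((\<one>, a), (y, h \<otimes> inv (v s))) * r s y else 0)" by auto
    finally show "R ((\<one>, a), (y, g)) * T s (inv g \<otimes> y \<otimes> g) (inv g \<otimes> h) =
      (if g = h \<otimes> inv (v s) then R ((\<one>, a), (y, h \<otimes> inv (v s))) * r s y else 0)" .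
  qed
  also have "\<dots> = R ((\<one>, a), (y, h \<otimes> inv (v s))) * r s y" using c v by (simp add: sum.delta)
  also have "R ((\<one>, a), (y, h \<otimes> inv (v s))) = (\<Sum>b\<in>carrier G. R ((\<one>, b), (\<one>, h \<otimes> inv (v s))) * U (inv b \<otimes> a) y)"
    using c v by (simp add: coeff_one)
  also have "\<dots> = (\<Sum>b\<in>carrier G. if b = a \<otimes> inv (\<phi> y) then R ((\<one>, a \<otimes> inv (\<phi> y)), (\<one>, h \<otimes> inv (v s))) else 0)"
  proof (rule sum.cong[OF refl])
    fix b assume b: "b \<in> carrier G"
    have "inv b \<otimes> a = \<phi> y \<longleftrightarrow> b = a \<otimes> inv (\<phi> y)"
      using c b \<phi>(1)[OF c(3)] by (metis inv_closed inv_inv mult_eq_iff_left mult_eq_iff_right)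
    then show "R ((\<one>, b), (\<one>, h \<otimes> inv (v s))) * U (inv b \<otimes> a) y =
      (if b = a \<otimes> inv (\<phi> y) then R ((\<one>, a \<otimes> inv (\<phi> y)), (\<one>, h \<otimes> inv (v s))) else 0)"
      using c b by (simp add: \<phi>)
  qed
  also have "\<dots> = R ((\<one>, a \<otimes> inv (\<phi> y)), (\<one>, h \<otimes> inv (v s)))" using c \<phi> by (simp add: sum.delta)
  finally show ?thesis by (simp add: mult.commute)
qed

lemma \<phi>_hom: "\<phi> \<in> hom G G"
proof (rule homI)
  fix y b assume c: "y \<in> carrier G" "b \<in> carrier G"
  let ?c = "\<phi> y \<otimes> \<phi> b"
  have UW: "U a y = W \<one> a y" for a y by (simp add: U_def W_def)
  have pc: "\<phi> y \<in> carrier G" "\<phi> b \<in> carrier G" using c \<phi> by auto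
  have "U ?c (y \<otimes> b) = (\<Sum>h\<in>carrier G. \<Sum>a\<in>carrier G. R ((\<one>, a), (y, h)) * W (inv a \<otimes> \<one> \<otimes> a) (inv a \<otimes> ?c) b)"
    unfolding U_def by (intro sum.cong refl sum_W_comult[symmetric]) (use c pc in simp_all)
  also have "\<dots> = (\<Sum>a\<in>carrier G. \<Sum>h\<in>carrier G. R ((\<one>, a), (y, h)) * W (inv a \<otimes> \<one> \<otimes> a) (inv a \<otimes> ?c) b)"
    by (rule sum.swap)
  also have "\<dots> = (\<Sum>a\<in>carrier G. U a y * U (inv a \<otimes> ?c) b)"
    by (rule sum.cong) (simp_all add: UW[of "inv _ \<otimes> _"] U_def[of _ y] sum_distrib_right)
  also have "\<dots> = (\<Sum>a\<in>carrier G. if a = \<phi> y then 1 else 0)"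
    by (rule sum.cong) (use c pc in \<open>auto simp: \<phi>\<close>)
  also have "\<dots> = 1" using pc by (simp add: sum.delta)
  finally show "\<phi> (y \<otimes> b) = \<phi> y \<otimes> \<phi> b" using \<phi>(2)[of "y \<otimes> b" ?c] c pc by (auto split: if_splits)
qed (rule \<phi>)

lemma v_mult:
  assumes "s \<in> carrier G" "t \<in> carrier G"
  shows "v (t \<otimes> s) = v s \<otimes> v t"
proof -
  let ?k = "v s \<otimes> v t"
  have vc: "v s \<in> carrier G" "v t \<in> carrier G" using assms v by auto
  have "V (t \<otimes> s) ?k = (\<Sum>a\<in>carrier G. \<Sum>g\<in>carrier G. R ((s, a), (\<one>, g)) * T t (inv g \<otimes> \<one> \<otimes> g) (inv g \<otimes> ?k))"
    unfolding V_def by (intro sum.cong refl sum_T_mult[symmetric]) (use assms vc in simp_all)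
  also have "\<dots> = (\<Sum>g\<in>carrier G. \<Sum>a\<in>carrier G. R ((s, a), (\<one>, g)) * T t (inv g \<otimes> \<one> \<otimes> g) (inv g \<otimes> ?k))"
    by (rule sum.swap)
  also have "\<dots> = (\<Sum>g\<in>carrier G. V s g * V t (inv g \<otimes> ?k))"
    by (rule sum.cong) (simp_all add: V_def T_def sum_distrib_right)
  also have "\<dots> = (\<Sum>g\<in>carrier G. if g = v s then 1 else 0)"
    by (rule sum.cong) (use assms vc in \<open>auto simp: v\<close>)
  also have "\<dots> = 1" using vc by (simp add: sum.delta)
  finally show ?thesis using v(2)[of "t \<otimes> s" ?k] assms vc by (auto split: if_splits)
qed

lemma r_one_left: "y \<in> carrier G \<Longrightarrow> r \<one> y = 1"
  using sum_U[of y] by (simp add: r_def U_def W_def)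

lemma r_one_right: "s \<in> carrier G \<Longrightarrow> r s \<one> = 1"
  using sum_V[of s] by (simp add: r_sum_T V_def T_def)

lemma r_mult_left:
  assumes "s \<in> carrier G" "t \<in> carrier G" "x \<in> carrier G"
  shows "r (t \<otimes> s) x = r s x * r t (inv (v s) \<otimes> x \<otimes> v s)"
proof -
  have "r (t \<otimes> s) x = (\<Sum>g\<in>carrier G. T s x g * r t (inv g \<otimes> x \<otimes> g))" using assms by (simp add: sum_r_mult)
  also have "\<dots> = (\<Sum>g\<in>carrier G. if g = v s then r s x * r t (inv (v s) \<otimes> x \<otimes> v s) else 0)"
    by (rule sum.cong) (use assms in \<open>auto simp: T_eq v\<close>)
  finally show ?thesis using assms v by (simp add: sum.delta)
qed

lemma r_mult_right:
  assumes "s \<in> carrier G" "y \<in> carrier G" "b \<in> carrier G"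
  shows "r s (y \<otimes> b) = r s y * r (inv (\<phi> y) \<otimes> s \<otimes> \<phi> y) b"
proof -
  have "r s (y \<otimes> b) = (\<Sum>a\<in>carrier G. W s a y * r (inv a \<otimes> s \<otimes> a) b)" using assms by (simp add: sum_r_comult)
  also have "\<dots> = (\<Sum>a\<in>carrier G. if a = \<phi> y then r s y * r (inv (\<phi> y) \<otimes> s \<otimes> \<phi> y) b else 0)"
    by (rule sum.cong) (use assms in \<open>auto simp: W_eq \<phi>\<close>)
  finally show ?thesis using assms \<phi> by (simp add: sum.delta)
qed

lemma r_nonzero:
  assumes "s \<in> carrier G" "x \<in> carrier G"
  shows "r s x \<noteq> 0"
  using r_mult_left[of s "inv s" x] r_one_left[of x] assms by auto

text \<open>The factors $F(R)(e_a \# 1)$ and $F(R)(\varepsilon \# s)$ commute; comparing the two orders of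
  multiplication shows that conjugation by \<open>v(s)\<close> is invisible to \<open>u\<^sup>*\<close>.\<close>

lemma \<phi>_conj_v:
  assumes "s \<in> carrier G" "x \<in> carrier G"
  shows "\<phi> (inv (v s) \<otimes> x \<otimes> v s) = \<phi> x"
proof -
  let ?x = "inv (v s) \<otimes> x \<otimes> v s"
  have c: "v s \<in> carrier G" "?x \<in> carrier G" "\<phi> x \<in> carrier G" using assms v \<phi> by auto
  have UW: "U a y = W \<one> a y" for a y by (simp add: U_def W_def)
  have "W s (\<phi> x) x = (\<Sum>a\<in>carrier G. if a = \<phi> x then W s (\<phi> x) x else 0)" using c by (simp add: sum.delta)
  also have "\<dots> = (\<Sum>a\<in>carrier G. \<Sum>g\<in>carrier G. R ((s, a), (x, g)) * U (\<phi> x) (inv g \<otimes> x \<otimes> g))"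
    by (rule sum.cong) (use assms c in \<open>auto simp: UW sum_W_mult\<close>)
  also have "\<dots> = (\<Sum>g\<in>carrier G. \<Sum>a\<in>carrier G. R ((s, a), (x, g)) * U (\<phi> x) (inv g \<otimes> x \<otimes> g))"
    by (rule sum.swap)
  also have "\<dots> = (\<Sum>g\<in>carrier G. T s x g * U (\<phi> x) (inv g \<otimes> x \<otimes> g))"
    by (simp add: T_def sum_distrib_right)
  also have "\<dots> = (\<Sum>g\<in>carrier G. if g = v s then r s x * U (\<phi> x) ?x else 0)"
    by (rule sum.cong) (use assms in \<open>auto simp: T_eq v\<close>)
  also have "\<dots> = r s x * U (\<phi> x) ?x" using c by (simp add: sum.delta)
  finally have "U (\<phi> x) ?x \<noteq> 0" using r_nonzero[OF assms] assms c by (auto simp: W_eq \<phi>)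
  then show ?thesis using \<phi>(2)[OF c(2,3)] by (auto split: if_splits)
qed

lemma v_conj_\<phi>:
  assumes "s \<in> carrier G" "y \<in> carrier G"
  shows "v (inv (\<phi> y) \<otimes> s \<otimes> \<phi> y) = v s"
proof -
  let ?s = "inv (\<phi> y) \<otimes> s \<otimes> \<phi> y"
  have c: "\<phi> y \<in> carrier G" "?s \<in> carrier G" "v s \<in> carrier G" using assms v \<phi> by auto
  have VT: "V s h = T s \<one> h" for s h by (simp add: V_def T_def)
  have "T s y (v s) = (\<Sum>h\<in>carrier G. if h = v s then T s y (v s) else 0)" using c by (simp add: sum.delta)
  also have "\<dots> = (\<Sum>h\<in>carrier G. \<Sum>a\<in>carrier G. R ((s, a), (y, h)) * V (inv a \<otimes> s \<otimes> a) (v s))"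
    by (rule sum.cong) (use assms c in \<open>auto simp: VT sum_T_comult\<close>)
  also have "\<dots> = (\<Sum>a\<in>carrier G. \<Sum>h\<in>carrier G. R ((s, a), (y, h)) * V (inv a \<otimes> s \<otimes> a) (v s))"
    by (rule sum.swap)
  also have "\<dots> = (\<Sum>a\<in>carrier G. W s a y * V (inv a \<otimes> s \<otimes> a) (v s))"
    by (simp add: W_def sum_distrib_right)
  also have "\<dots> = (\<Sum>a\<in>carrier G. if a = \<phi> y then r s y * V ?s (v s) else 0)"
    by (rule sum.cong) (use assms in \<open>auto simp: W_eq \<phi>\<close>)
  also have "\<dots> = r s y * V ?s (v s)" using c by (simp add: sum.delta)
  finally have "V ?s (v s) \<noteq> 0" using r_nonzero[OF assms] assms c by (auto simp: T_eq v)
  then show ?thesis using v(2)[OF c(2,3)] by (auto split: if_splits)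
qed

lemma weak_data_structure:
  "weak_data \<phi> (\<lambda>s. inv (v s)) r (pairing_of R)" "R = R_of \<phi> (\<lambda>s. inv (v s)) r (pairing_of R)"
proof -
  have "(\<lambda>s. inv (v s)) \<in> hom G G"
    by (rule homI) (use v in \<open>auto simp: v_mult inv_mult_group\<close>)
  then show "weak_data \<phi> (\<lambda>s. inv (v s)) r (pairing_of R)"
    unfolding weak_data_def
    using \<phi>_hom central v r_one_left r_one_right \<phi>_conj_v v_conj_\<phi> r_mult_left r_mult_right by auto
  show "R = R_of \<phi> (\<lambda>s. inv (v s)) r (pairing_of R)"
    using coeff_eq weak_coeffsD(1)[OF weak] by (auto simp: R_of_def fun_eq_iff)
qed

end

section \<open>From components to weak $R$-matrices\<close>

context finite_group
begin

lemma weak_dataD: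
  assumes "weak_data \<phi> w r P"
  shows "\<phi> \<in> hom G G" "w \<in> hom G G" "central_pairing P"
    and "s \<in> carrier G \<Longrightarrow> r s \<one> = 1" and "s \<in> carrier G \<Longrightarrow> r \<one> s = 1"
    and "s \<in> carrier G \<Longrightarrow> x \<in> carrier G \<Longrightarrow> \<phi> (w s \<otimes> x \<otimes> inv (w s)) = \<phi> x"
    and "s \<in> carrier G \<Longrightarrow> x \<in> carrier G \<Longrightarrow> w (inv (\<phi> x) \<otimes> s \<otimes> \<phi> x) = w s"
    and "s \<in> carrier G \<Longrightarrow> t \<in> carrier G \<Longrightarrow> x \<in> carrier G \<Longrightarrow> r (t \<otimes> s) x = r s x * r t (w s \<otimes> x \<otimes> inv (w s))"
    and "s \<in> carrier G \<Longrightarrow> y \<in> carrier G \<Longrightarrow> b \<in> carrier G \<Longrightarrow> r s (y \<otimes> b) = r s y * r (inv (\<phi> y) \<otimes> s \<otimes> \<phi> y) b"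
  using assms unfolding weak_data_def by blast+

lemma central_pairing_structure:
  fixes R :: "('g \<times> 'g) \<times> ('g \<times> 'g) \<Rightarrow> 'k::field"
  assumes "weak_coeffs R" "central_pairing (pairing_of R)"
  obtains \<phi> w r where "weak_data \<phi> w r (pairing_of R)" "R = R_of \<phi> w r (pairing_of R)"
proof -
  interpret c: centrally_supported G R by unfold_locales (use assms in auto)
  show ?thesis by (rule that[OF c.weak_data_structure])
qed

lemma R_of_apply:
  "s \<in> carrier G \<Longrightarrow> a \<in> carrier G \<Longrightarrow> y \<in> carrier G \<Longrightarrow> h \<in> carrier G \<Longrightarrow>
    R_of \<phi> w r P ((s, a), (y, h)) = r s y * P (a \<otimes> inv (\<phi> y)) (h \<otimes> w s)"
  by (simp add: R_of_def)

lemma R_of_cong: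
  assumes "\<And>x. x \<in> carrier G \<Longrightarrow> \<phi> x = \<phi>' x" "\<And>x. x \<in> carrier G \<Longrightarrow> w x = w' x"
  shows "R_of \<phi> w r P = R_of \<phi>' w' r P"
  using assms by (auto simp: R_of_def fun_eq_iff)

lemma central_pairing_conj:
  assumes P: "central_pairing P" and car: "x \<in> carrier G" "a \<in> carrier G" "h \<in> carrier G"
  shows "P a (inv x \<otimes> h \<otimes> x) = P a h" "P (inv x \<otimes> a \<otimes> x) h = P a h"
proof -
  have cc: "inv x \<otimes> z \<otimes> x = z" if z: "z \<in> carrier G" "z \<in> center G \<or> inv x \<otimes> z \<otimes> x \<in> center G" for z
  proof (cases "z \<in> center G")
    case True
    then show ?thesis using center_conj' car by blast
  next
    case False
    then have "inv x \<otimes> z \<otimes> x \<in> center G" using z(2) by blast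
    from center_conj'[OF this, of "inv x"] show ?thesis using car z(1) by (simp add: m_assoc)
  qed
  show "P a (inv x \<otimes> h \<otimes> x) = P a h"
    using cc[OF car(3)] central_pairingD(3)[OF P] by metis
  show "P (inv x \<otimes> a \<otimes> x) h = P a h"
    using cc[OF car(2)] central_pairingD(2)[OF P] by metis
qed

text \<open>In each of the two product sums only indices in a coset of the central support of \<open>P\<close>
  contribute.  Conjugation by such an index is conjugation by \<open>w(s)\<^sup>-\<^sup>1\<close> or by \<open>\<phi>(y)\<close>, and after shifting
  the summation index the sum is an axiom for \<open>P\<close>.\<close>

lemma weak_coeffs_R_of:
  fixes r P :: "'g \<Rightarrow> 'g \<Rightarrow> 'k::field"
  assumes wd: "weak_data \<phi> w r P"
  shows "weak_coeffs (R_of \<phi> w r P)"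
  unfolding weak_coeffs_def
proof (intro conjI ballI allI impI)
  note hom = weak_dataD(1,2)[OF wd]
  interpret \<phi>: group_hom G G \<phi> using hom is_group by (simp add: group_hom_def group_hom_axioms_def)
  interpret w: group_hom G G w using hom is_group by (simp add: group_hom_def group_hom_axioms_def)
  note cP = weak_dataD(3)[OF wd]
  note P = central_pairingD(1)[OF cP]
  let ?R = "R_of \<phi> w r P"
  show "?R ((s, a), (y, h)) = 0" if "\<not> (s \<in> carrier G \<and> a \<in> carrier G \<and> y \<in> carrier G \<and> h \<in> carrier G)" for s a y h
    using that by (auto simp: R_of_def)
  show "(\<Sum>a\<in>carrier G. ?R ((\<one>, a), (x, h))) = (if h = \<one> then 1 else 0)"
    if c: "x \<in> carrier G" "h \<in> carrier G" for x h
    using c sum_mult_right[of "inv (\<phi> x)" "\<lambda>a. P a h"] pairingD(4)[OF P c(2)]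
    by (simp add: R_of_apply weak_dataD(5)[OF wd])
  show "(\<Sum>h\<in>carrier G. ?R ((s, a), (\<one>, h))) = (if a = \<one> then 1 else 0)"
    if c: "s \<in> carrier G" "a \<in> carrier G" for s a
    using c sum_mult_right[of "w s" "\<lambda>h. P a h"] pairingD(5)[OF P c(2)]
    by (simp add: R_of_apply weak_dataD(4)[OF wd])
  show "(\<Sum>g\<in>carrier G. ?R ((s, a), (x, g)) * ?R ((s', a'), (inv g \<otimes> x \<otimes> g, inv g \<otimes> k))) =
      (if a = a' then ?R ((s' \<otimes> s, a), (x, k)) else 0)"
    if c: "s \<in> carrier G" "a \<in> carrier G" "s' \<in> carrier G" "a' \<in> carrier G" "x \<in> carrier G" "k \<in> carrier G"
    for s a s' a' x k
  proof -
    let ?m = "a \<otimes> inv (\<phi> x)" and ?m' = "a' \<otimes> inv (\<phi> x)" and ?x = "w s \<otimes> x \<otimes> inv (w s)"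
    have cl: "\<phi> x \<in> carrier G" "w s \<in> carrier G" "w s' \<in> carrier G" "?x \<in> carrier G" using c by auto
    have summand: "?R ((s, a), (x, g)) * ?R ((s', a'), (inv g \<otimes> x \<otimes> g, inv g \<otimes> k)) =
        r s x * r s' ?x * (P ?m (g \<otimes> w s) * P ?m' (inv (g \<otimes> w s) \<otimes> (k \<otimes> w (s' \<otimes> s))))"
      if g: "g \<in> carrier G" for g
    proof (cases "P ?m (g \<otimes> w s) = 0")
      case True
      then show ?thesis using c g by (simp add: R_of_apply)
    next
      case False
      let ?b = "g \<otimes> w s"
      have b: "?b \<in> center G" using central_pairingD(3)[OF cP False] .
      have bc: "?b \<in> carrier G" using g cl by simp
      have gb: "g = ?b \<otimes> inv (w s)" using g cl by (simp add: m_assoc)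
      have "inv g \<otimes> x \<otimes> g = inv ?b \<otimes> ?x \<otimes> ?b"
      proof -
        have "inv g \<otimes> x \<otimes> g = w s \<otimes> (inv ?b \<otimes> x \<otimes> ?b) \<otimes> inv (w s)"
          using g c cl by (simp add: group_word)
        then show ?thesis using center_conj[OF b c(5)] center_conj[OF b cl(4)] by simp
      qed
      then have gx: "inv g \<otimes> x \<otimes> g = ?x" using center_conj[OF b cl(4)] by simp
      have "P ?m' (inv g \<otimes> k \<otimes> w s') = P ?m' (inv (w s) \<otimes> (inv g \<otimes> k \<otimes> w s') \<otimes> w s)"
        using central_pairing_conj(1)[OF cP cl(2), of ?m' "inv g \<otimes> k \<otimes> w s'"] c g cl by simp
      also have "inv (w s) \<otimes> (inv g \<otimes> k \<otimes> w s') \<otimes> w s = inv ?b \<otimes> (k \<otimes> w (s' \<otimes> s))"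
        using c g cl by (simp add: group_word)
      finally have "P ?m' (inv g \<otimes> k \<otimes> w s') = P ?m' (inv ?b \<otimes> (k \<otimes> w (s' \<otimes> s)))" .
      moreover have "\<phi> ?x = \<phi> x" using weak_dataD(6)[OF wd] c by blast
      ultimately show ?thesis using c g cl gx by (simp add: R_of_apply m_assoc)
    qed
    have "(\<Sum>g\<in>carrier G. ?R ((s, a), (x, g)) * ?R ((s', a'), (inv g \<otimes> x \<otimes> g, inv g \<otimes> k))) =
      (\<Sum>g\<in>carrier G. r s x * r s' ?x * (P ?m (g \<otimes> w s) * P ?m' (inv (g \<otimes> w s) \<otimes> (k \<otimes> w (s' \<otimes> s)))))"
      by (rule sum.cong[OF refl]) (rule summand)
    also have "\<dots> = (\<Sum>b\<in>carrier G. r s x * r s' ?x * (P ?m b * P ?m' (inv b \<otimes> (k \<otimes> w (s' \<otimes> s)))))"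
      by (rule sum_mult_right[OF cl(2), where f = "\<lambda>b. r s x * r s' ?x * (P ?m b * P ?m' (inv b \<otimes> (k \<otimes> w (s' \<otimes> s))))"])
    also have "\<dots> = r s x * r s' ?x * (if ?m = ?m' then P ?m (k \<otimes> w (s' \<otimes> s)) else 0)"
      unfolding sum_distrib_left[symmetric] by (subst pairingD(2)[OF P]) (use c cl in simp_all)
    also have "?m = ?m' \<longleftrightarrow> a = a'" using c cl by simp
    also have "r s x * r s' ?x = r (s' \<otimes> s) x" using weak_dataD(8)[OF wd] c by simp
    finally show ?thesis using c by (simp add: R_of_apply)
  qed
  show "(\<Sum>a\<in>carrier G. ?R ((s, a), (y, h)) * ?R ((inv a \<otimes> s \<otimes> a, inv a \<otimes> c), (b, g))) =
      (if g = h then ?R ((s, c), (y \<otimes> b, g)) else 0)"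
    if c: "s \<in> carrier G" "c \<in> carrier G" "b \<in> carrier G" "g \<in> carrier G" "y \<in> carrier G" "h \<in> carrier G"
    for s c b g y h
  proof -
    let ?h = "h \<otimes> w s" and ?g = "g \<otimes> w s" and ?s = "inv (\<phi> y) \<otimes> s \<otimes> \<phi> y"
    have cl: "\<phi> y \<in> carrier G" "\<phi> b \<in> carrier G" "w s \<in> carrier G" "?s \<in> carrier G" using c by auto
    have summand: "?R ((s, a), (y, h)) * ?R ((inv a \<otimes> s \<otimes> a, inv a \<otimes> c), (b, g)) =
        r s y * r ?s b * (P (a \<otimes> inv (\<phi> y)) ?h * P (inv (a \<otimes> inv (\<phi> y)) \<otimes> (c \<otimes> inv (\<phi> (y \<otimes> b)))) ?g)"
      if a: "a \<in> carrier G" for a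
    proof (cases "P (a \<otimes> inv (\<phi> y)) ?h = 0")
      case True
      then show ?thesis using c a by (simp add: R_of_apply)
    next
      case False
      let ?z = "a \<otimes> inv (\<phi> y)"
      have z: "?z \<in> center G" using central_pairingD(2)[OF cP False] .
      have zc: "?z \<in> carrier G" using a cl by simp
      have "inv a \<otimes> s \<otimes> a = inv (\<phi> y) \<otimes> (inv ?z \<otimes> s \<otimes> ?z) \<otimes> \<phi> y"
        using a c cl by (simp add: group_word)
      then have as: "inv a \<otimes> s \<otimes> a = ?s" using center_conj[OF z c(1)] by simp
      have "P (inv a \<otimes> c \<otimes> inv (\<phi> b)) ?g = P (inv (inv (\<phi> y)) \<otimes> (inv a \<otimes> c \<otimes> inv (\<phi> b)) \<otimes> inv (\<phi> y)) ?g"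
        using central_pairing_conj(2)[OF cP, of "inv (\<phi> y)" "inv a \<otimes> c \<otimes> inv (\<phi> b)" ?g] c a cl by simp
      also have "inv (inv (\<phi> y)) \<otimes> (inv a \<otimes> c \<otimes> inv (\<phi> b)) \<otimes> inv (\<phi> y) = inv ?z \<otimes> (c \<otimes> inv (\<phi> (y \<otimes> b)))"
        using c a cl by (simp add: group_word)
      finally have "P (inv a \<otimes> c \<otimes> inv (\<phi> b)) ?g = P (inv ?z \<otimes> (c \<otimes> inv (\<phi> (y \<otimes> b)))) ?g" .
      moreover have "w ?s = w s" using weak_dataD(7)[OF wd] c by blast
      ultimately show ?thesis using c a cl as by (simp add: R_of_apply)
    qed
    have "(\<Sum>a\<in>carrier G. ?R ((s, a), (y, h)) * ?R ((inv a \<otimes> s \<otimes> a, inv a \<otimes> c), (b, g))) =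
      (\<Sum>a\<in>carrier G. r s y * r ?s b * (P (a \<otimes> inv (\<phi> y)) ?h * P (inv (a \<otimes> inv (\<phi> y)) \<otimes> (c \<otimes> inv (\<phi> (y \<otimes> b)))) ?g))"
      by (rule sum.cong[OF refl]) (rule summand)
    also have "\<dots> = (\<Sum>a\<in>carrier G. r s y * r ?s b * (P a ?h * P (inv a \<otimes> (c \<otimes> inv (\<phi> (y \<otimes> b)))) ?g))"
      by (rule sum_mult_right[OF inv_closed[OF cl(1)], where f = "\<lambda>a. r s y * r ?s b * (P a ?h * P (inv a \<otimes> (c \<otimes> inv (\<phi> (y \<otimes> b)))) ?g)"])
    also have "\<dots> = r s y * r ?s b * (if ?h = ?g then P (c \<otimes> inv (\<phi> (y \<otimes> b))) ?h else 0)"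
      unfolding sum_distrib_left[symmetric] by (subst pairingD(3)[OF P]) (use c cl in simp_all)
    also have "?h = ?g \<longleftrightarrow> g = h" using c cl by auto
    also have "r s y * r ?s b = r s (y \<otimes> b)" using weak_dataD(9)[OF wd] c by simp
    finally show ?thesis using c by (simp add: R_of_apply)
  qed
qed

lemma R_of_sums:
  assumes wd: "weak_data \<phi> w r P"
  shows "a \<in> carrier G \<Longrightarrow> y \<in> carrier G \<Longrightarrow> (\<Sum>h\<in>carrier G. R_of \<phi> w r P ((\<one>, a), (y, h))) = (if a = \<phi> y then 1 else 0)"
    and "s \<in> carrier G \<Longrightarrow> h \<in> carrier G \<Longrightarrow> (\<Sum>a\<in>carrier G. R_of \<phi> w r P ((s, a), (\<one>, h))) = (if h = inv (w s) then 1 else 0)"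
    and "s \<in> carrier G \<Longrightarrow> y \<in> carrier G \<Longrightarrow> (\<Sum>a\<in>carrier G. \<Sum>h\<in>carrier G. R_of \<phi> w r P ((s, a), (y, h))) = r s y"
    and "R_of \<phi> w r P ((\<one>, a), (\<one>, h)) = P a h"
proof -
  note hom = weak_dataD(1,2)[OF wd]
  interpret \<phi>: group_hom G G \<phi> using hom is_group by (simp add: group_hom_def group_hom_axioms_def)
  interpret w: group_hom G G w using hom is_group by (simp add: group_hom_def group_hom_axioms_def)
  note P = central_pairingD(1)[OF weak_dataD(3)[OF wd]]
  note r1 = weak_dataD(4,5)[OF wd]
  have right: "(\<Sum>h\<in>carrier G. P a (h \<otimes> w s)) = (\<Sum>h\<in>carrier G. P a h)" if "s \<in> carrier G" for a s
    using that sum_mult_right[of "w s" "P a"] by simp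
  have left: "(\<Sum>a\<in>carrier G. P (a \<otimes> inv (\<phi> y)) h) = (\<Sum>a\<in>carrier G. P a h)" if "y \<in> carrier G" for y h
    using that sum_mult_right[of "inv (\<phi> y)" "\<lambda>a. P a h"] by simp
  show "(\<Sum>h\<in>carrier G. R_of \<phi> w r P ((\<one>, a), (y, h))) = (if a = \<phi> y then 1 else 0)" if c: "a \<in> carrier G" "y \<in> carrier G"
  proof -
    have "a \<otimes> inv (\<phi> y) = \<one> \<longleftrightarrow> a = \<phi> y" using c by (simp add: mult_eq_iff_right)
    then show ?thesis using c by (simp add: R_of_apply r1 pairingD(5)[OF P])
  qed
  show "(\<Sum>a\<in>carrier G. R_of \<phi> w r P ((s, a), (\<one>, h))) = (if h = inv (w s) then 1 else 0)" if c: "s \<in> carrier G" "h \<in> carrier G"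
  proof -
    have "h \<otimes> w s = \<one> \<longleftrightarrow> h = inv (w s)" using c by (simp add: mult_eq_iff_right)
    then show ?thesis using c by (simp add: R_of_apply r1 pairingD(4)[OF P])
  qed
  show "(\<Sum>a\<in>carrier G. \<Sum>h\<in>carrier G. R_of \<phi> w r P ((s, a), (y, h))) = r s y" if c: "s \<in> carrier G" "y \<in> carrier G"
  proof -
    have "(\<Sum>a\<in>carrier G. \<Sum>h\<in>carrier G. R_of \<phi> w r P ((s, a), (y, h))) =
      r s y * (\<Sum>a\<in>carrier G. \<Sum>h\<in>carrier G. P (a \<otimes> inv (\<phi> y)) (h \<otimes> w s))"
      using c by (simp add: R_of_apply sum_distrib_left)
    also have "(\<Sum>a\<in>carrier G. \<Sum>h\<in>carrier G. P (a \<otimes> inv (\<phi> y)) (h \<otimes> w s)) = (\<Sum>a\<in>carrier G. \<Sum>h\<in>carrier G. P a h)"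
      unfolding right[OF c(1)]
      using c sum_mult_right[of "inv (\<phi> y)" "\<lambda>a. \<Sum>h\<in>carrier G. P a h"] by simp
    also have "\<dots> = (\<Sum>a\<in>carrier G. if a = \<one> then 1 else 0)"
      by (rule sum.cong) (simp_all add: pairingD(5)[OF P])
    finally show ?thesis by (simp add: sum.delta)
  qed
  show "R_of \<phi> w r P ((\<one>, a), (\<one>, h)) = P a h"
    using pairingD(1)[OF P, of a h] r1(1)[OF one_closed] by (cases "a \<in> carrier G \<and> h \<in> carrier G") (auto simp: R_of_def)
qed

lemma weak_data_r_nonzero:
  assumes wd: "weak_data \<phi> w r P" and c: "s \<in> carrier G" "x \<in> carrier G"
  shows "r s x \<noteq> 0"
  using weak_dataD(8)[OF wd c(1) inv_closed[OF c(1)] c(2)] weak_dataD(5)[OF wd c(2)] c by auto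

definition bicharacter :: "('g \<Rightarrow> 'g \<Rightarrow> 'k::field) \<Rightarrow> bool" where
  "bicharacter r \<longleftrightarrow> (\<forall>s\<in>carrier G. \<forall>y\<in>carrier G. r s y \<noteq> 0 \<and>
     (\<forall>t\<in>carrier G. r (s \<otimes> t) y = r s y * r t y \<and> r s (y \<otimes> t) = r s y * r s t))"

lemma bicharacterD:
  assumes "bicharacter r"
  shows "s \<in> carrier G \<Longrightarrow> y \<in> carrier G \<Longrightarrow> r s y \<noteq> 0"
    and "s \<in> carrier G \<Longrightarrow> y \<in> carrier G \<Longrightarrow> t \<in> carrier G \<Longrightarrow> r (s \<otimes> t) y = r s y * r t y"
    and "s \<in> carrier G \<Longrightarrow> y \<in> carrier G \<Longrightarrow> t \<in> carrier G \<Longrightarrow> r s (y \<otimes> t) = r s y * r s t"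
  using assms unfolding bicharacter_def by blast+

lemma multiplicative_conj:
  fixes f :: "'g \<Rightarrow> 'k::field"
  assumes mult: "\<And>x y. x \<in> carrier G \<Longrightarrow> y \<in> carrier G \<Longrightarrow> f (x \<otimes> y) = f x * f y"
    and one: "f \<one> = 1" and c: "x \<in> carrier G" "g \<in> carrier G"
  shows "f (inv g \<otimes> x \<otimes> g) = f x" "f (g \<otimes> x \<otimes> inv g) = f x"
proof -
  have "f (inv g) * f g = 1" using mult[of "inv g" g] one c by simp
  then show "f (inv g \<otimes> x \<otimes> g) = f x" "f (g \<otimes> x \<otimes> inv g) = f x"
    using mult c by (simp_all add: mult_ac)
qed

lemma bicharacter_one:
  assumes "bicharacter r" "s \<in> carrier G"
  shows "r s \<one> = 1" "r \<one> s = 1"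
  using bicharacterD(1)[OF assms(1), of s \<one>] bicharacterD(3)[OF assms(1), of s \<one> \<one>]
    bicharacterD(1)[OF assms(1), of \<one> s] bicharacterD(2)[OF assms(1), of \<one> s \<one>] assms(2) by auto

lemma bicharacter_conj:
  assumes r: "bicharacter r" and c: "s \<in> carrier G" "y \<in> carrier G" "g \<in> carrier G"
  shows "r (inv g \<otimes> s \<otimes> g) y = r s y" "r s (inv g \<otimes> y \<otimes> g) = r s y" "r s (g \<otimes> y \<otimes> inv g) = r s y"
  using multiplicative_conj[where f = "\<lambda>s. r s y" and x = s and g = g] multiplicative_conj[where f = "r s" and x = y and g = g]
    bicharacterD(2,3)[OF r] bicharacter_one[OF r] c by simp_all

definition normal_data :: "('g \<Rightarrow> 'g) \<Rightarrow> ('g \<Rightarrow> 'g) \<Rightarrow> ('g \<Rightarrow> 'g \<Rightarrow> 'k::field) \<Rightarrow> ('g \<Rightarrow> 'g \<Rightarrow> 'k) \<Rightarrow> bool" where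
  "normal_data \<phi> w r P \<longleftrightarrow> normal_endo G \<phi> \<and> normal_endo G w \<and> bicharacter r \<and> central_pairing P \<and>
    (\<forall>x\<in>carrier G. \<forall>y\<in>carrier G. w x \<otimes> \<phi> y = \<phi> y \<otimes> w x)"

lemma normal_dataD:
  assumes "normal_data \<phi> w r P"
  shows "normal_endo G \<phi>" "normal_endo G w" "bicharacter r" "central_pairing P"
    and "x \<in> carrier G \<Longrightarrow> y \<in> carrier G \<Longrightarrow> w x \<otimes> \<phi> y = \<phi> y \<otimes> w x"
  using assms unfolding normal_data_def by blast+

lemma normal_data_weak_data:
  assumes nd: "normal_data \<phi> w r P"
  shows "weak_data \<phi> w r P"
proof -
  note n = normal_dataD[OF nd]
  have cl: "\<phi> x \<in> carrier G" "w x \<in> carrier G" if "x \<in> carrier G" for x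
    using hom_in_carrier[OF normal_endo_hom[OF n(1)] that] hom_in_carrier[OF normal_endo_hom[OF n(2)] that] .
  have "\<phi> (w s \<otimes> x \<otimes> inv (w s)) = \<phi> x" if c: "s \<in> carrier G" "x \<in> carrier G" for s x
  proof -
    have "\<phi> (w s \<otimes> x \<otimes> inv (w s)) = w s \<otimes> \<phi> x \<otimes> inv (w s)" using normal_endo_conj[OF n(1)] c cl by blast
    then show ?thesis using n(5)[OF c] c cl by (simp add: m_assoc)
  qed
  moreover have "w (inv (\<phi> x) \<otimes> s \<otimes> \<phi> x) = w s" if c: "s \<in> carrier G" "x \<in> carrier G" for s x
  proof -
    have "w (inv (\<phi> x) \<otimes> s \<otimes> \<phi> x) = inv (\<phi> x) \<otimes> w s \<otimes> \<phi> x"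
      using normal_endo_conj[OF n(2), of "inv (\<phi> x)" s] c cl by simp
    then show ?thesis using n(5)[OF c] c cl by (simp add: m_assoc)
  qed
  ultimately show ?thesis
    unfolding weak_data_def
    using n normal_endo_hom bicharacter_one[OF n(3)] bicharacterD(2,3)[OF n(3)] bicharacter_conj[OF n(3)] cl
    by (simp add: mult.commute)
qed

text \<open>By normality \<open>\<phi>(w(s) x w(s)\<^sup>-\<^sup>1) = w(s) \<phi>(x) w(s)\<^sup>-\<^sup>1\<close>, so the compatibility of \<open>\<phi>\<close> with conjugation by
  \<open>w(s)\<close> says that the images of \<open>w\<close> and \<open>\<phi>\<close> commute.\<close>

lemma weak_data_normal_data:
  assumes wd: "weak_data \<phi> w r P" and \<phi>: "normal_endo G \<phi>" and w: "normal_endo G w" and r: "bicharacter r"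
  shows "normal_data \<phi> w r P"
proof -
  have cl: "\<phi> x \<in> carrier G" "w x \<in> carrier G" if "x \<in> carrier G" for x
    using hom_in_carrier[OF normal_endo_hom[OF \<phi>] that] hom_in_carrier[OF normal_endo_hom[OF w] that] .
  have "w s \<otimes> \<phi> x = \<phi> x \<otimes> w s" if c: "s \<in> carrier G" "x \<in> carrier G" for s x
  proof -
    have "w s \<otimes> \<phi> x \<otimes> inv (w s) = \<phi> x"
      using normal_endo_conj[OF \<phi> cl(2)[OF c(1)] c(2)] weak_dataD(6)[OF wd c] by simp
    then show ?thesis using mult_eq_iff_right[of "w s \<otimes> \<phi> x" "inv (w s)" "\<phi> x"] c cl by simp
  qed
  then show ?thesis using assms weak_dataD(3)[OF wd] by (simp add: normal_data_def)
qed

text \<open>On \<open>G \<times> im \<phi>\<close> the twists in the multiplicativity of \<open>r\<close> disappear, so \<open>r\<close> is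
  bimultiplicative there and trivial on \<open>\<phi> [b, y]\<close>.  Conjugating an argument by \<open>\<phi> y\<close> changes it
  by such a value.\<close>

lemma weak_data_bicharacter:
  fixes r :: "'g \<Rightarrow> 'g \<Rightarrow> 'k::field"
  assumes wd: "weak_data \<phi> w r P" and \<phi>: "normal_endo G \<phi>"
    and conj: "\<And>g s y. g \<in> carrier G \<Longrightarrow> s \<in> carrier G \<Longrightarrow> y \<in> carrier G \<Longrightarrow>
      r (inv g \<otimes> s \<otimes> g) (inv g \<otimes> y \<otimes> g) = r s y"
  shows "bicharacter r"
proof -
  note d = weak_dataD[OF wd]
  interpret \<phi>: group_hom G G \<phi> using d(1) is_group by (simp add: group_hom_def group_hom_axioms_def)
  interpret w: group_hom G G w using d(2) is_group by (simp add: group_hom_def group_hom_axioms_def)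
  have im_left: "r (t \<otimes> s) (\<phi> x) = r t (\<phi> x) * r s (\<phi> x)"
    if c: "s \<in> carrier G" "t \<in> carrier G" "x \<in> carrier G" for s t x
  proof -
    have "w s \<otimes> \<phi> x \<otimes> inv (w s) = \<phi> x"
      using normal_endo_conj[OF \<phi> w.hom_closed[OF c(1)] c(3)] d(6)[OF c(1,3)] by simp
    then show ?thesis using d(8)[OF c(1,2) \<phi>.hom_closed[OF c(3)]] by (simp add: mult.commute)
  qed
  have im_conj: "r (inv g \<otimes> s \<otimes> g) (\<phi> x) = r s (\<phi> x)"
    if c: "s \<in> carrier G" "g \<in> carrier G" "x \<in> carrier G" for s g x
    using multiplicative_conj(1)[where f = "\<lambda>s. r s (\<phi> x)"] im_left d(5) c by simp
  have im_right: "r s (\<phi> (x \<otimes> y)) = r s (\<phi> x) * r s (\<phi> y)"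
    if c: "s \<in> carrier G" "x \<in> carrier G" "y \<in> carrier G" for s x y
    using d(9)[of s "\<phi> x" "\<phi> y"] im_conj[of s "\<phi> (\<phi> x)" y] c by simp
  have im_gcomm: "r s (\<phi> (gcomm G x y)) = 1"
    if c: "s \<in> carrier G" "x \<in> carrier G" "y \<in> carrier G" for s x y
  proof -
    have 1: "r s (\<phi> \<one>) = 1" using d(4) c by simp
    have "r s (\<phi> (gcomm G x y)) = r s (\<phi> (x \<otimes> y \<otimes> inv x)) * r s (\<phi> (inv y))"
      unfolding gcomm_def using c by (intro im_right) auto
    also have "r s (\<phi> (x \<otimes> y \<otimes> inv x)) = r s (\<phi> y)"
      by (rule multiplicative_conj(2)[where f = "\<lambda>z. r s (\<phi> z)"]) (use im_right 1 c in auto)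
    also have "r s (\<phi> y) * r s (\<phi> (inv y)) = 1" using im_right[of s y "inv y"] 1 c by simp
    finally show ?thesis .
  qed
  have twist: "r (inv (\<phi> y) \<otimes> s \<otimes> \<phi> y) b = r s b"
    if c: "s \<in> carrier G" "y \<in> carrier G" "b \<in> carrier G" for s y b
  proof -
    \<comment> \<open>Conjugating \<open>b\<close> by \<open>\<phi> y\<close> multiplies it by \<open>\<phi> [b\<^sup>-\<^sup>1, y]\<close>.\<close>
    let ?k = "gcomm G (inv b) y"
    have "\<phi> y \<otimes> b \<otimes> inv (\<phi> y) = b \<otimes> \<phi> ?k"
      using normal_endo_gcomm(1)[OF \<phi>, of "inv b" y] c by (simp add: gcomm_def m_assoc)
    moreover have "inv (\<phi> y) \<otimes> (\<phi> y \<otimes> b \<otimes> inv (\<phi> y)) \<otimes> \<phi> y = b" using c by (simp add: m_assoc)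
    ultimately have "r (inv (\<phi> y) \<otimes> s \<otimes> \<phi> y) b = r s (b \<otimes> \<phi> ?k)"
      using conj[of "\<phi> y" s "\<phi> y \<otimes> b \<otimes> inv (\<phi> y)"] c by simp
    also have "\<dots> = r s b" using d(9)[of s b "\<phi> ?k"] im_gcomm c by simp
    finally show ?thesis .
  qed
  have right: "r s (y \<otimes> b) = r s y * r s b" if c: "s \<in> carrier G" "y \<in> carrier G" "b \<in> carrier G" for s y b
    using d(9)[OF c] twist[OF c] by simp
  have left: "r (t \<otimes> s) x = r t x * r s x" if c: "s \<in> carrier G" "t \<in> carrier G" "x \<in> carrier G" for s t x
    using d(8)[OF c] multiplicative_conj(2)[where f = "r t" and x = x and g = "w s"] right d(4) c
    by (simp add: mult.commute)
  show ?thesis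
    unfolding bicharacter_def by (intro ballI conjI weak_data_r_nonzero[OF wd] left right)
qed

text \<open>The maps \<open>\<phi>\<close>, \<open>w\<close> and \<open>r\<close> can be read off from sums of coefficients over indices that
  conjugation permutes, so they inherit the conjugation invariance of the coefficients.\<close>

lemma conj_invariant_normal_data:
  fixes r :: "'g \<Rightarrow> 'g \<Rightarrow> 'k::field"
  assumes wd: "weak_data \<phi> w r P" and law: "support_law m (R_of \<phi> w r P)"
  shows "normal_data \<phi> w r P"
proof -
  note d = weak_dataD[OF wd]
  interpret \<phi>: group_hom G G \<phi> using d(1) is_group by (simp add: group_hom_def group_hom_axioms_def)
  interpret w: group_hom G G w using d(2) is_group by (simp add: group_hom_def group_hom_axioms_def)
  let ?R = "R_of \<phi> w r P"
  have inv: "?R ((inv g \<otimes> s \<otimes> g, inv g \<otimes> a \<otimes> g), (inv g \<otimes> y \<otimes> g, inv g \<otimes> h \<otimes> g)) = ?R ((s, a), (y, h))"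
    if "g \<in> carrier G" "s \<in> carrier G" "a \<in> carrier G" "y \<in> carrier G" "h \<in> carrier G" for g s a y h
    using law that unfolding support_law_def by blast
  have sum_conj': "(\<Sum>h\<in>carrier G. f (inv g \<otimes> h \<otimes> g)) = (\<Sum>h\<in>carrier G. f h)" if "g \<in> carrier G" for f :: "'g \<Rightarrow> 'k" and g
    using sum_conj[of "inv g" f] that by simp
  have \<phi>_conj: "\<phi> (inv g \<otimes> y \<otimes> g) = inv g \<otimes> \<phi> y \<otimes> g" if c: "g \<in> carrier G" "y \<in> carrier G" for g y
  proof -
    let ?a = "inv g \<otimes> \<phi> y \<otimes> g"
    have "(\<Sum>h\<in>carrier G. ?R ((\<one>, ?a), (inv g \<otimes> y \<otimes> g, h))) =
      (\<Sum>h\<in>carrier G. ?R ((inv g \<otimes> \<one> \<otimes> g, ?a), (inv g \<otimes> y \<otimes> g, inv g \<otimes> h \<otimes> g)))"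
      using sum_conj'[OF c(1), of "\<lambda>h. ?R ((\<one>, ?a), (inv g \<otimes> y \<otimes> g, h))"] c by simp
    also have "\<dots> = (\<Sum>h\<in>carrier G. ?R ((\<one>, \<phi> y), (y, h)))"
      by (intro sum.cong refl inv) (use c in auto)
    also have "\<dots> = 1" using R_of_sums(1)[OF wd, of "\<phi> y" y] c by simp
    finally show ?thesis
      using R_of_sums(1)[OF wd, of ?a "inv g \<otimes> y \<otimes> g"] c by (auto split: if_splits)
  qed
  have w_conj: "w (inv g \<otimes> s \<otimes> g) = inv g \<otimes> w s \<otimes> g" if c: "g \<in> carrier G" "s \<in> carrier G" for g s
  proof -
    let ?h = "inv g \<otimes> inv (w s) \<otimes> g"
    have "(\<Sum>a\<in>carrier G. ?R ((inv g \<otimes> s \<otimes> g, a), (\<one>, ?h))) =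
      (\<Sum>a\<in>carrier G. ?R ((inv g \<otimes> s \<otimes> g, inv g \<otimes> a \<otimes> g), (inv g \<otimes> \<one> \<otimes> g, ?h)))"
      using sum_conj'[OF c(1), of "\<lambda>a. ?R ((inv g \<otimes> s \<otimes> g, a), (\<one>, ?h))"] c by simp
    also have "\<dots> = (\<Sum>a\<in>carrier G. ?R ((s, a), (\<one>, inv (w s))))"
      by (intro sum.cong refl inv) (use c in auto)
    also have "\<dots> = 1" using R_of_sums(2)[OF wd, of s "inv (w s)"] c by simp
    finally have "?h = inv (w (inv g \<otimes> s \<otimes> g))"
      using R_of_sums(2)[OF wd, of "inv g \<otimes> s \<otimes> g" ?h] c by (auto split: if_splits)
    moreover have "?h = inv (inv g \<otimes> w s \<otimes> g)" using c by (simp add: group_word)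
    ultimately show ?thesis using c inv_inv by (metis inv_closed m_closed w.hom_closed)
  qed
  have r_conj: "r (inv g \<otimes> s \<otimes> g) (inv g \<otimes> y \<otimes> g) = r s y"
    if c: "g \<in> carrier G" "s \<in> carrier G" "y \<in> carrier G" for g s y
  proof -
    have "r (inv g \<otimes> s \<otimes> g) (inv g \<otimes> y \<otimes> g) =
      (\<Sum>a\<in>carrier G. \<Sum>h\<in>carrier G. ?R ((inv g \<otimes> s \<otimes> g, a), (inv g \<otimes> y \<otimes> g, h)))"
      using R_of_sums(3)[OF wd] c by simp
    also have "\<dots> = (\<Sum>a\<in>carrier G. \<Sum>h\<in>carrier G. ?R ((inv g \<otimes> s \<otimes> g, inv g \<otimes> a \<otimes> g), (inv g \<otimes> y \<otimes> g, inv g \<otimes> h \<otimes> g)))"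
      using sum_conj'[OF c(1), of "\<lambda>a. \<Sum>h\<in>carrier G. ?R ((inv g \<otimes> s \<otimes> g, a), (inv g \<otimes> y \<otimes> g, h))"]
        sum_conj'[OF c(1), of "\<lambda>h. ?R ((inv g \<otimes> s \<otimes> g, _), (inv g \<otimes> y \<otimes> g, h))"] by simp
    also have "\<dots> = (\<Sum>a\<in>carrier G. \<Sum>h\<in>carrier G. ?R ((s, a), (y, h)))"
      by (intro sum.cong refl inv) (use c in auto)
    also have "\<dots> = r s y" using R_of_sums(3)[OF wd] c by simp
    finally show ?thesis .
  qed
  have n\<phi>: "normal_endo G \<phi>"
    unfolding normal_endo_def
  proof (intro conjI ballI d(1))
    fix g x assume "g \<in> carrier G" "x \<in> carrier G"
    then show "\<phi> (g \<otimes> x \<otimes> inv g) = g \<otimes> \<phi> x \<otimes> inv g" using \<phi>_conj[of "inv g" x] by (simp only: inv_inv inv_closed)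
  qed
  have nw: "normal_endo G w"
    unfolding normal_endo_def
  proof (intro conjI ballI d(2))
    fix g x assume "g \<in> carrier G" "x \<in> carrier G"
    then show "w (g \<otimes> x \<otimes> inv g) = g \<otimes> w x \<otimes> inv g" using w_conj[of "inv g" x] by (simp only: inv_inv inv_closed)
  qed
  show ?thesis by (rule weak_data_normal_data[OF wd n\<phi> nw weak_data_bicharacter[OF wd n\<phi> r_conj]])
qed

text \<open>The support law compares \<open>m s y\<close> with \<open>w(s) y w(s)\<^sup>-\<^sup>1 \<phi>(y)\<^sup>-\<^sup>1 s \<phi>(y)\<close>; by normality the latter is
  \<open>w(c) \<phi>(c) y s\<close> for the commutator \<open>c = [s, y]\<close>.\<close>

lemma support_law_R_of:
  fixes r :: "'g \<Rightarrow> 'g \<Rightarrow> 'k::field"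
  assumes nd: "normal_data \<phi> w r P"
  shows "support_law m (R_of \<phi> w r P) \<longleftrightarrow>
    (\<forall>s\<in>carrier G. \<forall>y\<in>carrier G. m s y = w (gcomm G s y) \<otimes> \<phi> (gcomm G s y) \<otimes> (y \<otimes> s))"
proof -
  note n = normal_dataD[OF nd]
  note wd = normal_data_weak_data[OF nd]
  note hom = weak_dataD(1,2)[OF wd]
  interpret \<phi>: group_hom G G \<phi> using hom is_group by (simp add: group_hom_def group_hom_axioms_def)
  interpret w: group_hom G G w using hom is_group by (simp add: group_hom_def group_hom_axioms_def)
  note P = central_pairingD(1)[OF n(4)]
  let ?R = "R_of \<phi> w r P"
  have law_value: "(w s \<otimes> y \<otimes> inv (w s)) \<otimes> (inv (\<phi> y) \<otimes> s \<otimes> \<phi> y) = w (gcomm G s y) \<otimes> \<phi> (gcomm G s y) \<otimes> (y \<otimes> s)"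
    if c: "s \<in> carrier G" "y \<in> carrier G" for s y
  proof -
    let ?c = "gcomm G s y"
    have "\<phi> (inv y \<otimes> ?c \<otimes> y) = inv y \<otimes> \<phi> ?c \<otimes> y"
      using normal_endo_conj[OF n(1), of "inv y" ?c] c by simp
    then have 1: "inv (\<phi> y) \<otimes> \<phi> ?c \<otimes> \<phi> y = inv y \<otimes> \<phi> ?c \<otimes> y" using c by simp
    have "w s \<otimes> y \<otimes> inv (w s) = w ?c \<otimes> y"
      using normal_endo_gcomm(2)[OF n(2) c] c by (simp add: gcomm_def m_assoc)
    moreover have "inv (\<phi> y) \<otimes> s \<otimes> \<phi> y = (inv (\<phi> y) \<otimes> \<phi> ?c \<otimes> \<phi> y) \<otimes> s"
      using normal_endo_gcomm(1)[OF n(1) c] c by (simp add: gcomm_def m_assoc)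
    ultimately show ?thesis unfolding 1 using c by (simp add: m_assoc)
  qed
  have conj_value: "(inv h \<otimes> y \<otimes> h) \<otimes> (inv a \<otimes> s \<otimes> a) = w (gcomm G s y) \<otimes> \<phi> (gcomm G s y) \<otimes> (y \<otimes> s)"
    if c: "s \<in> carrier G" "a \<in> carrier G" "y \<in> carrier G" "h \<in> carrier G"
      and z: "a \<otimes> inv (\<phi> y) \<in> center G" "h \<otimes> w s \<in> center G" for s a y h
  proof -
    have "inv h \<otimes> y \<otimes> h = w s \<otimes> (inv (h \<otimes> w s) \<otimes> y \<otimes> (h \<otimes> w s)) \<otimes> inv (w s)"
      using c by (simp add: group_word)
    moreover have "inv a \<otimes> s \<otimes> a = inv (\<phi> y) \<otimes> (inv (a \<otimes> inv (\<phi> y)) \<otimes> s \<otimes> (a \<otimes> inv (\<phi> y))) \<otimes> \<phi> y"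
      using c by (simp add: group_word)
    ultimately show ?thesis
      using center_conj[OF z(1) c(1)] center_conj[OF z(2) c(3)] law_value[OF c(1,3)] by simp
  qed
  show ?thesis
  proof
    assume law: "support_law m ?R"
    show "\<forall>s\<in>carrier G. \<forall>y\<in>carrier G. m s y = w (gcomm G s y) \<otimes> \<phi> (gcomm G s y) \<otimes> (y \<otimes> s)"
    proof (intro ballI)
      fix s y assume c: "s \<in> carrier G" "y \<in> carrier G"
      \<comment> \<open>Some coefficient is non-zero for these \<open>s\<close> and \<open>y\<close>, namely at \<open>a = \<phi> y\<close>.\<close>
      obtain b where b: "P \<one> b \<noteq> 0" using one_in_supp[OF P] by (auto simp: supp_def)
      have bc: "b \<in> carrier G" using pairingD(1)[OF P, of \<one> b] b by blast
      have z: "\<phi> y \<otimes> inv (\<phi> y) \<in> center G" "b \<otimes> inv (w s) \<otimes> w s \<in> center G"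
        using central_pairingD(2,3)[OF n(4) b] c bc by (simp_all add: m_assoc)
      have "?R ((s, \<phi> y), (y, b \<otimes> inv (w s))) \<noteq> 0"
        using bicharacterD(1)[OF n(3)] b bc c by (simp add: R_of_apply m_assoc)
      then have "m s y = (inv (b \<otimes> inv (w s)) \<otimes> y \<otimes> (b \<otimes> inv (w s))) \<otimes> (inv (\<phi> y) \<otimes> s \<otimes> \<phi> y)"
        using law c bc unfolding support_law_def by (metis \<phi>.hom_closed inv_closed m_closed w.hom_closed)
      then show "m s y = w (gcomm G s y) \<otimes> \<phi> (gcomm G s y) \<otimes> (y \<otimes> s)"
        using conj_value[OF c(1) _ c(2) _ z] c bc by simp
    qed
  next
    assume m: "\<forall>s\<in>carrier G. \<forall>y\<in>carrier G. m s y = w (gcomm G s y) \<otimes> \<phi> (gcomm G s y) \<otimes> (y \<otimes> s)"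
    show "support_law m ?R"
      unfolding support_law_def
    proof (intro ballI conjI impI)
      fix s a y h assume c: "s \<in> carrier G" "a \<in> carrier G" "y \<in> carrier G" "h \<in> carrier G"
      show "m s y = (inv h \<otimes> y \<otimes> h) \<otimes> (inv a \<otimes> s \<otimes> a)" if "?R ((s, a), (y, h)) \<noteq> 0"
      proof -
        have "P (a \<otimes> inv (\<phi> y)) (h \<otimes> w s) \<noteq> 0" using that c by (simp add: R_of_apply)
        from central_pairingD(2,3)[OF n(4) this] show ?thesis using conj_value[OF c] m c by simp
      qed
      fix g assume g: "g \<in> carrier G"
      have 1: "\<phi> (inv g \<otimes> y \<otimes> g) = inv g \<otimes> \<phi> y \<otimes> g" "w (inv g \<otimes> s \<otimes> g) = inv g \<otimes> w s \<otimes> g"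
        using normal_endo_conj[OF n(1), of "inv g" y] normal_endo_conj[OF n(2), of "inv g" s] c g by simp_all
      have 2: "r (inv g \<otimes> s \<otimes> g) (inv g \<otimes> y \<otimes> g) = r s y"
        using bicharacter_conj[OF n(3)] c g by simp
      have 3: "inv g \<otimes> a \<otimes> g \<otimes> inv (inv g \<otimes> \<phi> y \<otimes> g) = inv g \<otimes> (a \<otimes> inv (\<phi> y)) \<otimes> g"
        "inv g \<otimes> h \<otimes> g \<otimes> (inv g \<otimes> w s \<otimes> g) = inv g \<otimes> (h \<otimes> w s) \<otimes> g"
        using c g by (simp_all add: group_word)
      have "?R ((inv g \<otimes> s \<otimes> g, inv g \<otimes> a \<otimes> g), (inv g \<otimes> y \<otimes> g, inv g \<otimes> h \<otimes> g)) =
        r s y * P (inv g \<otimes> (a \<otimes> inv (\<phi> y)) \<otimes> g) (inv g \<otimes> (h \<otimes> w s) \<otimes> g)"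
        using c g by (simp only: R_of_apply m_closed inv_closed 1 2 3)
      also have "\<dots> = ?R ((s, a), (y, h))"
        using central_pairing_conj[OF n(4)] c g by (simp add: R_of_apply)
      finally show "?R ((inv g \<otimes> s \<otimes> g, inv g \<otimes> a \<otimes> g), (inv g \<otimes> y \<otimes> g, inv g \<otimes> h \<otimes> g)) = ?R ((s, a), (y, h))" .
    qed
  qed
qed

lemma law_quasitriangular:
  assumes "normal_data \<phi> w r P"
  shows "support_law (\<lambda>s y. s \<otimes> y) (R_of \<phi> w r P) \<longleftrightarrow>
    (\<forall>s\<in>carrier G. \<forall>y\<in>carrier G. w (gcomm G s y) \<otimes> \<phi> (gcomm G s y) = gcomm G s y)"
proof -
  note hom = weak_dataD(1,2)[OF normal_data_weak_data[OF assms]]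
  have "s \<otimes> y = w (gcomm G s y) \<otimes> \<phi> (gcomm G s y) \<otimes> (y \<otimes> s) \<longleftrightarrow>
      w (gcomm G s y) \<otimes> \<phi> (gcomm G s y) = gcomm G s y"
    if c: "s \<in> carrier G" "y \<in> carrier G" for s y
  proof -
    let ?c = "gcomm G s y"
    have e: "s \<otimes> y = ?c \<otimes> (y \<otimes> s)" using c by (simp add: gcomm_def m_assoc)
    have "s \<otimes> y = w ?c \<otimes> \<phi> ?c \<otimes> (y \<otimes> s) \<longleftrightarrow> ?c \<otimes> (y \<otimes> s) = w ?c \<otimes> \<phi> ?c \<otimes> (y \<otimes> s)"
      by (rule arg_cong[where f = "\<lambda>z. z = w ?c \<otimes> \<phi> ?c \<otimes> (y \<otimes> s)", OF e])
    also have "\<dots> \<longleftrightarrow> ?c = w ?c \<otimes> \<phi> ?c"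
      using c hom_in_carrier[OF hom(1)] hom_in_carrier[OF hom(2)] by (intro right_cancel) auto
    also have "\<dots> \<longleftrightarrow> w ?c \<otimes> \<phi> ?c = ?c" by (rule eq_commute)
    finally show ?thesis .
  qed
  then show ?thesis unfolding support_law_R_of[OF assms] by blast
qed

text \<open>If \<open>w(c) \<phi>(c) = \<one>\<close> on commutators then \<open>w(y) \<phi>(y)\<close> is central; as the images of \<open>w\<close> and \<open>\<phi>\<close>
  commute, the image of \<open>w\<close> is abelian, so \<open>w\<close> kills commutators.\<close>

lemma law_central:
  assumes nd: "normal_data \<phi> w r P"
  shows "support_law (\<lambda>s y. y \<otimes> s) (R_of \<phi> w r P) \<longleftrightarrow>
    (\<forall>x\<in>carrier G. \<phi> x \<in> center G \<and> w x \<in> center G)"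
proof -
  note n = normal_dataD[OF nd]
  note hom = weak_dataD(1,2)[OF normal_data_weak_data[OF nd]]
  interpret \<phi>: group_hom G G \<phi> using hom is_group by (simp add: group_hom_def group_hom_axioms_def)
  interpret w: group_hom G G w using hom is_group by (simp add: group_hom_def group_hom_axioms_def)
  have iff: "support_law (\<lambda>s y. y \<otimes> s) (R_of \<phi> w r P) \<longleftrightarrow>
    (\<forall>s\<in>carrier G. \<forall>y\<in>carrier G. w (gcomm G s y) \<otimes> \<phi> (gcomm G s y) = \<one>)"
  proof -
    have "y \<otimes> s = w (gcomm G s y) \<otimes> \<phi> (gcomm G s y) \<otimes> (y \<otimes> s) \<longleftrightarrow>
        w (gcomm G s y) \<otimes> \<phi> (gcomm G s y) = \<one>" if c: "s \<in> carrier G" "y \<in> carrier G" for s y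
    proof -
      have "\<one> \<otimes> (y \<otimes> s) = w (gcomm G s y) \<otimes> \<phi> (gcomm G s y) \<otimes> (y \<otimes> s) \<longleftrightarrow>
          \<one> = w (gcomm G s y) \<otimes> \<phi> (gcomm G s y)" using c by (intro right_cancel) auto
      then show ?thesis using c by auto
    qed
    then show ?thesis unfolding support_law_R_of[OF nd] by blast
  qed
  show ?thesis
    unfolding iff
  proof
    assume kill: "\<forall>s\<in>carrier G. \<forall>y\<in>carrier G. w (gcomm G s y) \<otimes> \<phi> (gcomm G s y) = \<one>"
    have central: "w y \<otimes> \<phi> y \<in> center G" if y: "y \<in> carrier G" for y
      unfolding center_gcomm
    proof (intro conjI ballI)
      show "w y \<otimes> \<phi> y \<in> carrier G" using y by simp
      fix g assume g: "g \<in> carrier G"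
      let ?c = "gcomm G g y"
      have "w ?c \<otimes> \<phi> ?c = (w (g \<otimes> y \<otimes> inv g) \<otimes> w (inv y)) \<otimes> (\<phi> (g \<otimes> y \<otimes> inv g) \<otimes> \<phi> (inv y))"
        unfolding gcomm_def using y g by (simp only: w.hom_mult \<phi>.hom_mult m_closed inv_closed)
      also have "\<dots> = w (g \<otimes> y \<otimes> inv g) \<otimes> (w (inv y) \<otimes> \<phi> (g \<otimes> y \<otimes> inv g)) \<otimes> \<phi> (inv y)"
        using y g by (simp only: m_assoc w.hom_closed \<phi>.hom_closed m_closed inv_closed)
      also have "\<dots> = w (g \<otimes> y \<otimes> inv g) \<otimes> (\<phi> (g \<otimes> y \<otimes> inv g) \<otimes> w (inv y)) \<otimes> \<phi> (inv y)"
        using n(5)[of "inv y" "g \<otimes> y \<otimes> inv g"] y g by simp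
      also have "\<dots> = (g \<otimes> w y \<otimes> inv g) \<otimes> (g \<otimes> \<phi> y \<otimes> inv g) \<otimes> (w (inv y) \<otimes> \<phi> (inv y))"
        unfolding normal_endo_conj[OF n(1) g y] normal_endo_conj[OF n(2) g y] using y g
        by (simp only: m_assoc w.hom_closed \<phi>.hom_closed m_closed inv_closed)
      also have "w (inv y) \<otimes> \<phi> (inv y) = \<phi> (inv y) \<otimes> w (inv y)" by (rule n(5)) (use y in auto)
      also have "(g \<otimes> w y \<otimes> inv g) \<otimes> (g \<otimes> \<phi> y \<otimes> inv g) \<otimes> (\<phi> (inv y) \<otimes> w (inv y)) = gcomm G g (w y \<otimes> \<phi> y)"
        unfolding gcomm_def using y g by (simp add: group_word)
      finally show "gcomm G g (w y \<otimes> \<phi> y) = \<one>" using kill y g by simp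
    qed
    have "w (gcomm G x y) = \<one>" if c: "x \<in> carrier G" "y \<in> carrier G" for x y
    proof -
      have "w x \<otimes> (w y \<otimes> \<phi> y) = (w y \<otimes> \<phi> y) \<otimes> w x" using centerD(2)[OF central[OF c(2)], of "w x"] c by simp
      then have "w x \<otimes> w y \<otimes> \<phi> y = w y \<otimes> (\<phi> y \<otimes> w x)" using c by (simp add: m_assoc)
      also have "\<dots> = w y \<otimes> w x \<otimes> \<phi> y" using n(5)[OF c] c by (simp add: m_assoc)
      finally have "w x \<otimes> w y = w y \<otimes> w x" using c by simp
      then show ?thesis using hom_gcomm[OF is_group hom(2) c] c by (simp add: gcomm_eq_one_iff)
    qed
    then have wz: "\<forall>x\<in>carrier G. w x \<in> center G" using kills_gcomm_iff[OF n(2)] by blast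
    have "\<phi> x \<in> center G" if x: "x \<in> carrier G" for x
    proof -
      have "\<phi> x = inv (w x) \<otimes> (w x \<otimes> \<phi> x)" using x by simp
      then show ?thesis using center_mult[OF center_inv[OF bspec[OF wz x]] central[OF x]] by simp
    qed
    then show "\<forall>x\<in>carrier G. \<phi> x \<in> center G \<and> w x \<in> center G" using wz by blast
  next
    assume z: "\<forall>x\<in>carrier G. \<phi> x \<in> center G \<and> w x \<in> center G"
    then have "w (gcomm G s y) = \<one>" "\<phi> (gcomm G s y) = \<one>" if "s \<in> carrier G" "y \<in> carrier G" for s y
      using kills_gcomm_iff[OF n(1)] kills_gcomm_iff[OF n(2)] that by blast+
    then show "\<forall>s\<in>carrier G. \<forall>y\<in>carrier G. w (gcomm G s y) \<otimes> \<phi> (gcomm G s y) = \<one>" by simp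
  qed
qed

lemma support_law_structure:
  assumes R: "weak_coeffs R" and law: "support_law m R"
    and m: "\<And>s. s \<in> carrier G \<Longrightarrow> m s \<one> = s" "\<And>y. y \<in> carrier G \<Longrightarrow> m \<one> y = y"
  obtains \<phi> w r where "normal_data \<phi> w r (pairing_of R)" "R = R_of \<phi> w r (pairing_of R)"
proof -
  obtain \<phi> w r where wd: "weak_data \<phi> w r (pairing_of R)" and eq: "R = R_of \<phi> w r (pairing_of R)"
    using central_pairing_structure[OF R support_law_central_pairing[OF R law m]] by blast
  have "support_law m (R_of \<phi> w r (pairing_of R))" using law eq by simp
  then show ?thesis using that conj_invariant_normal_data[OF wd] eq by blast
qed

end

section \<open>Components of weak $R$-matrices with central $A$ and $B$\<close>

context finite_group
begin

lemma u_comp_R_of: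
  fixes r P :: "'g \<Rightarrow> 'g \<Rightarrow> 'k::field"
  assumes wd: "weak_data \<phi> w r P" and c: "a \<in> carrier G" "y \<in> carrier G"
  shows "u_comp G (R_of \<phi> w r P) (delta a) y = (if a = \<phi> y then 1 else 0)"
proof -
  let ?R = "R_of \<phi> w r P"
  have hash: "hash G (delta a) (delta \<one>) z = z (\<one>, a)" for z :: "'g \<times> 'g \<Rightarrow> 'k"
  proof -
    have "hash G (delta a) (delta \<one>) z = (\<Sum>p\<in>carrier G \<times> carrier G. if p = (\<one>, a) then z (\<one>, a) else 0)"
      unfolding hash_def by (rule sum.cong) (auto simp: delta_def split: if_splits)
    then show ?thesis using c by (simp add: sum.delta)
  qed
  have "u_comp G ?R (delta a) y = (\<Sum>h\<in>carrier G. ?R ((\<one>, a), (y, h)))"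
    by (simp add: u_comp_def id_counit_def counit_def group_alg_def F_map_def hash)
  then show ?thesis using R_of_sums(1)[OF wd c] by simp
qed

lemma r_comp_R_of:
  fixes r P :: "'g \<Rightarrow> 'g \<Rightarrow> 'k::field"
  assumes wd: "weak_data \<phi> w r P" and c: "s \<in> carrier G"
  shows "r_comp G (R_of \<phi> w r P) (delta s) = (\<lambda>y. if y \<in> carrier G then r s y else 0)"
proof
  fix y
  let ?R = "R_of \<phi> w r P"
  have hash: "hash G (bunit (fun_alg G)) (delta s) z = (\<Sum>a\<in>carrier G. z (s, a))" for z :: "'g \<times> 'g \<Rightarrow> 'k"
  proof -
    have "hash G (bunit (fun_alg G)) (delta s) z = (\<Sum>t\<in>carrier G. \<Sum>a\<in>carrier G. if t = s then z (s, a) else 0)"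
      unfolding hash_def sum.cartesian_product[symmetric] by (intro sum.cong refl) (auto simp: delta_def fun_alg_def)
    also have "\<dots> = (\<Sum>a\<in>carrier G. \<Sum>t\<in>carrier G. if t = s then z (s, a) else 0)" by (rule sum.swap)
    finally show ?thesis using c by (simp add: sum.delta)
  qed
  have "r_comp G ?R (delta s) y = (\<Sum>h\<in>carrier G. \<Sum>a\<in>carrier G. ?R ((s, a), (y, h)))"
    by (simp add: r_comp_def id_counit_def counit_def group_alg_def[of G] F_map_def hash)
  also have "\<dots> = (\<Sum>a\<in>carrier G. \<Sum>h\<in>carrier G. ?R ((s, a), (y, h)))" by (rule sum.swap)
  also have "\<dots> = (if y \<in> carrier G then r s y else 0)"
    using R_of_sums(3)[OF wd c] by (simp add: R_of_def)
  finally show "r_comp G ?R (delta s) y = (if y \<in> carrier G then r s y else 0)" .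
qed

lemma v_comp_R_of:
  fixes r P :: "'g \<Rightarrow> 'g \<Rightarrow> 'k::field"
  assumes wd: "weak_data \<phi> w r P"
  shows "v_comp G (R_of \<phi> w r P) y = (\<lambda>h. \<Sum>s\<in>carrier G. y s * delta (inv (w s)) h)"
proof
  fix h
  let ?R = "R_of \<phi> w r P"
  have w: "w s \<in> carrier G" if "s \<in> carrier G" for s using hom_in_carrier[OF weak_dataD(2)[OF wd] that] .
  have "v_comp G ?R y h = (\<Sum>s\<in>carrier G. y s * (\<Sum>a\<in>carrier G. ?R ((s, a), (\<one>, h))))"
    unfolding v_comp_def ev1_id_def F_map_def hash_def sum.cartesian_product[symmetric] sum_distrib_left
    by (intro sum.cong refl) (simp add: fun_alg_def mult_ac)
  also have "\<dots> = (\<Sum>s\<in>carrier G. y s * delta (inv (w s)) h)"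
  proof (rule sum.cong[OF refl])
    fix s assume s: "s \<in> carrier G"
    show "y s * (\<Sum>a\<in>carrier G. ?R ((s, a), (\<one>, h))) = y s * delta (inv (w s)) h"
    proof (cases "h \<in> carrier G")
      case True
      then show ?thesis using R_of_sums(2)[OF wd s True] by (simp add: delta_def)
    next
      case False
      then have "h \<noteq> inv (w s)" using w[OF s] by auto
      then show ?thesis using False by (simp add: delta_def R_of_def)
    qed
  qed
  finally show "v_comp G ?R y h = (\<Sum>s\<in>carrier G. y s * delta (inv (w s)) h)" .
qed

lemma p_comp_R_of:
  fixes r P :: "'g \<Rightarrow> 'g \<Rightarrow> 'k::field"
  assumes wd: "weak_data \<phi> w r P" and a: "a \<in> carrier G"
  shows "p_comp G (R_of \<phi> w r P) (delta a) = P a"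
  by (simp add: p_comp_eq pairing_map_def R_of_sums(4)[OF wd] delta_def
      if_distrib[of "\<lambda>x. x * _"] a cong: if_cong)

lemma linear_extension_iff:
  "(us \<in> hom G G \<and> (\<forall>y\<in>bspace (group_alg G).
      (\<lambda>h. \<Sum>g\<in>carrier G. y g * delta (f g) h) = (\<lambda>h. \<Sum>g\<in>carrier G. y g * (delta (us g) h :: 'k::field)))) \<longleftrightarrow>
    us \<in> hom G G \<and> (\<forall>x\<in>carrier G. us x = f x)"
proof (intro conj_cong refl iffI ballI)
  fix x assume x: "x \<in> carrier G"
    and L: "\<forall>y\<in>bspace (group_alg G). (\<lambda>h. \<Sum>g\<in>carrier G. y g * delta (f g) h) =
      (\<lambda>h. \<Sum>g\<in>carrier G. y g * (delta (us g) h :: 'k))"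
  have sum: "(\<Sum>g\<in>carrier G. delta x g * delta (k g) h) = (delta (k x) h :: 'k)" for k :: "'g \<Rightarrow> 'g" and h
    using x by (simp add: delta_def[of x] if_distrib[of "\<lambda>x. x * _"] cong: if_cong)
  have "(delta x :: 'g \<Rightarrow> 'k) \<in> bspace (group_alg G)" using x by (auto simp: bspace_def group_alg_def delta_def)
  from fun_cong[OF bspec[OF L this], of "us x"] have "delta (f x) (us x) = (1 :: 'k)"
    unfolding sum by (simp add: delta_def)
  then show "us x = f x" by (auto simp: delta_def split: if_splits)
next
  fix y :: "'g \<Rightarrow> 'k" assume "\<forall>x\<in>carrier G. us x = f x"
  then show "(\<lambda>h. \<Sum>g\<in>carrier G. y g * delta (f g) h) = (\<lambda>h. \<Sum>g\<in>carrier G. y g * delta (us g) h)"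
    by (intro ext sum.cong refl) simp
qed

lemma extends_endo_u_comp:
  fixes r P :: "'g \<Rightarrow> 'g \<Rightarrow> 'k::field"
  assumes wd: "weak_data \<phi> w r P"
  shows "extends_endo G (transpose_map G (u_comp G (R_of \<phi> w r P))) us \<longleftrightarrow>
    us \<in> hom G G \<and> (\<forall>x\<in>carrier G. us x = \<phi> x)"
proof -
  have \<phi>: "\<phi> s \<in> carrier G" if "s \<in> carrier G" for s using hom_in_carrier[OF weak_dataD(1)[OF wd] that] .
  have eq: "transpose_map G (u_comp G (R_of \<phi> w r P)) y = (\<lambda>h. \<Sum>g\<in>carrier G. y g * delta (\<phi> g) h)" for y
  proof
    fix h
    show "transpose_map G (u_comp G (R_of \<phi> w r P)) y h = (\<Sum>g\<in>carrier G. y g * delta (\<phi> g) h)"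
    proof (cases "h \<in> carrier G")
      case True
      then show ?thesis by (simp add: transpose_map_def u_comp_R_of[OF wd]) (simp add: delta_def)
    next
      case False
      then have "delta (\<phi> g) h = (0 :: 'k)" if "g \<in> carrier G" for g using \<phi>[OF that] by (auto simp: delta_def)
      then show ?thesis using False by (simp add: transpose_map_def)
    qed
  qed
  show ?thesis unfolding extends_endo_def eq by (rule linear_extension_iff)
qed

lemma extends_endo_Sv_comp:
  fixes r P :: "'g \<Rightarrow> 'g \<Rightarrow> 'k::field"
  assumes wd: "weak_data \<phi> w r P"
  shows "extends_endo G (\<lambda>y. group_alg_antipode G (v_comp G (R_of \<phi> w r P) y)) Sv \<longleftrightarrow>
    Sv \<in> hom G G \<and> (\<forall>x\<in>carrier G. Sv x = w x)"
proof -
  have w: "w s \<in> carrier G" if "s \<in> carrier G" for s using hom_in_carrier[OF weak_dataD(2)[OF wd] that] .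
  have eq: "group_alg_antipode G (v_comp G (R_of \<phi> w r P) y) = (\<lambda>h. \<Sum>g\<in>carrier G. y g * delta (w g) h)" for y
  proof
    fix h
    have "group_alg_antipode G (v_comp G (R_of \<phi> w r P) y) h =
      (\<Sum>g\<in>carrier G. \<Sum>s\<in>carrier G. y s * delta (inv (w s)) g * delta (inv g) h)"
      by (simp add: group_alg_antipode_def v_comp_R_of[OF wd] sum_distrib_right)
    also have "\<dots> = (\<Sum>s\<in>carrier G. \<Sum>g\<in>carrier G. y s * delta (inv (w s)) g * delta (inv g) h)"
      by (rule sum.swap)
    also have "\<dots> = (\<Sum>s\<in>carrier G. y s * delta (w s) h)"
    proof (rule sum.cong[OF refl])
      fix s assume s: "s \<in> carrier G"
      have "(\<Sum>g\<in>carrier G. y s * delta (inv (w s)) g * delta (inv g) h) =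
        (\<Sum>g\<in>carrier G. if g = inv (w s) then y s * delta (w s) h else 0)"
        by (rule sum.cong) (use w[OF s] in \<open>auto simp: delta_def\<close>)
      then show "(\<Sum>g\<in>carrier G. y s * delta (inv (w s)) g * delta (inv g) h) = y s * delta (w s) h"
        using w[OF s] by (simp add: sum.delta)
    qed
    finally show "group_alg_antipode G (v_comp G (R_of \<phi> w r P) y) h = (\<Sum>g\<in>carrier G. y g * delta (w g) h)" .
  qed
  show ?thesis unfolding extends_endo_def eq by (rule linear_extension_iff)
qed

lemma r_comp_hom_iff:
  fixes r P :: "'g \<Rightarrow> 'g \<Rightarrow> 'k::field"
  assumes wd: "weak_data \<phi> w r P"
  shows "(\<lambda>g. r_comp G (R_of \<phi> w r P) (delta g)) \<in> hom G (character_group G) \<longleftrightarrow> bicharacter r"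
proof
  assume L: "(\<lambda>g. r_comp G (R_of \<phi> w r P) (delta g)) \<in> hom G (character_group G)"
  show "bicharacter r"
    unfolding bicharacter_def
  proof (intro ballI conjI)
    fix s y assume s: "s \<in> carrier G" and y: "y \<in> carrier G"
    show "r s y \<noteq> 0" by (rule weak_data_r_nonzero[OF wd s y])
    fix t assume t: "t \<in> carrier G"
    have "r_comp G (R_of \<phi> w r P) (delta (s \<otimes> t)) =
        hmult (fun_alg G) (r_comp G (R_of \<phi> w r P) (delta s)) (r_comp G (R_of \<phi> w r P) (delta t))"
      using hom_mult[OF L s t] by (simp add: character_group_def)
    from fun_cong[OF this, of y] show "r (s \<otimes> t) y = r s y * r t y"
      using s t y by (simp add: r_comp_R_of[OF wd] hmult_fun_alg)
    have "r_comp G (R_of \<phi> w r P) (delta s) \<in> hom G field_units"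
      using hom_in_carrier[OF L s] by (simp add: character_group_def)
    from hom_mult[OF this y t] show "r s (y \<otimes> t) = r s y * r s t"
      using s t y by (simp add: r_comp_R_of[OF wd] field_units_def)
  qed
next
  assume r: "bicharacter r"
  show "(\<lambda>g. r_comp G (R_of \<phi> w r P) (delta g)) \<in> hom G (character_group G)"
  proof (rule homI)
    fix s assume s: "s \<in> carrier G"
    have "(\<lambda>y. if y \<in> carrier G then r s y else 0) \<in> hom G field_units"
      by (rule homI) (use s bicharacterD[OF r] in \<open>auto simp: field_units_def\<close>)
    then show "r_comp G (R_of \<phi> w r P) (delta s) \<in> carrier (character_group G)"
      using s by (simp add: character_group_def r_comp_R_of[OF wd] bspace_def fun_alg_def)
  next
    fix s t assume st: "s \<in> carrier G" "t \<in> carrier G"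
    show "r_comp G (R_of \<phi> w r P) (delta (s \<otimes> t)) =
        r_comp G (R_of \<phi> w r P) (delta s) \<otimes>\<^bsub>character_group G\<^esub> r_comp G (R_of \<phi> w r P) (delta t)"
      using st bicharacterD(2)[OF r]
      by (auto simp: character_group_def r_comp_R_of[OF wd] hmult_fun_alg fun_eq_iff)
  qed
qed

lemma nested_if_zero:
  "\<not> (d \<and> a \<and> b \<and> c) \<Longrightarrow> (if a then if b then if c then if d then x else 0 else 0 else 0 else 0) = (0 :: 'k::field)"
  by (cases a; cases b; cases c; cases d) simp_all

lemma R_of_expansion:
  fixes r P :: "'g \<Rightarrow> 'g \<Rightarrow> 'k::field"
  assumes wd: "weak_data \<phi> w r P"
  defines "R \<equiv> R_of \<phi> w r P"
  shows "R = (\<lambda>z. \<Sum>a\<in>carrier G. \<Sum>b\<in>carrier G. \<Sum>s\<in>carrier G.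
    pure_tensor (pure_tensor (delta s) (delta (a \<otimes> b)))
      (pure_tensor (hmult (fun_alg G) (r_comp G R (delta s)) (u_comp G R (delta b)))
         (hmult (group_alg G) (p_comp G R (delta a)) (v_comp G R (delta s)))) z)"
proof
  fix z :: "('g \<times> 'g) \<times> ('g \<times> 'g)"
  let ?t = "\<lambda>a b s. pure_tensor (pure_tensor (delta s) (delta (a \<otimes> b)))
      (pure_tensor (hmult (fun_alg G) (r_comp G R (delta s)) (u_comp G R (delta b)))
         (hmult (group_alg G) (p_comp G R (delta a)) (v_comp G R (delta s)))) z"
  obtain t c y h where z: "z = ((t, c), (y, h))" by (metis prod.exhaust)
  note P = central_pairingD(1)[OF weak_dataD(3)[OF wd]]
  have \<phi>: "\<phi> x \<in> carrier G" and w: "w x \<in> carrier G" if "x \<in> carrier G" for x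
    using hom_in_carrier[OF weak_dataD(1)[OF wd] that] hom_in_carrier[OF weak_dataD(2)[OF wd] that] .
  have fa: "hmult (fun_alg G) (r_comp G R (delta s)) (u_comp G R (delta b)) y =
      (if y \<in> carrier G then if b = \<phi> y then r s y else 0 else 0)"
    if "s \<in> carrier G" "b \<in> carrier G" for s b
    using that by (simp add: hmult_fun_alg R_def r_comp_R_of[OF wd] u_comp_R_of[OF wd])
  have ga: "hmult (group_alg G) (p_comp G R (delta a)) (v_comp G R (delta s)) h =
      (if h \<in> carrier G then P a (h \<otimes> w s) else 0)"
    if s: "s \<in> carrier G" and a: "a \<in> carrier G" for s a
  proof -
    have v: "v_comp G R (delta s) = delta (inv (w s))"
      unfolding R_def v_comp_R_of[OF wd] delta_def[of s] using s
      by (simp add: if_distrib[of "\<lambda>x. x * _"] cong: if_cong)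
    have "hmult (group_alg (G\<lparr>carrier := carrier G\<rparr>)) (P a) (delta (inv (w s))) h =
        (if h \<in> carrier G then \<Sum>g\<in>carrier G. P a g * delta (inv (w s)) (inv g \<otimes> h) else 0)"
      by (rule hmult_group_alg_subgroup[OF subgroup_self])
        (use pairingD(1)[OF P] w[OF s] in \<open>auto simp: delta_def\<close>)
    moreover have "(\<Sum>g\<in>carrier G. P a g * delta (inv (w s)) (inv g \<otimes> h)) = P a (h \<otimes> w s)" if h: "h \<in> carrier G"
    proof -
      have "(\<Sum>g\<in>carrier G. P a g * delta (inv (w s)) (inv g \<otimes> h)) =
        (\<Sum>g\<in>carrier G. if g = h \<otimes> w s then P a (h \<otimes> w s) else 0)"
      proof (rule sum.cong[OF refl])
        fix g assume g: "g \<in> carrier G"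
        have "inv g \<otimes> h = inv (w s) \<longleftrightarrow> g = h \<otimes> w s"
          using g h w[OF s] by (metis inv_closed inv_inv mult_eq_iff_left mult_eq_iff_right)
        then show "P a g * delta (inv (w s)) (inv g \<otimes> h) = (if g = h \<otimes> w s then P a (h \<otimes> w s) else 0)"
          by (simp add: delta_def)
      qed
      then show ?thesis using h w[OF s] by (simp add: sum.delta)
    qed
    ultimately show ?thesis using p_comp_R_of[OF wd a] v by (simp add: R_def)
  qed
  let ?v = "r t y * P (c \<otimes> inv (\<phi> y)) (h \<otimes> w t)"
  let ?in = "t \<in> carrier G \<and> c \<in> carrier G \<and> y \<in> carrier G \<and> h \<in> carrier G"
  have summand: "?t a b s =
      (if s = t then if b = \<phi> y then if a = c \<otimes> inv (\<phi> y) then if ?in then ?v else 0 else 0 else 0 else 0)"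
    if c': "a \<in> carrier G" "b \<in> carrier G" "s \<in> carrier G" for a b s
  proof -
    have E: "?t a b s =
      delta s t * delta (a \<otimes> b) c * ((if y \<in> carrier G then if b = \<phi> y then r s y else 0 else 0) *
        (if h \<in> carrier G then P a (h \<otimes> w s) else 0))"
      unfolding z pure_tensor_def prod.case fa[OF c'(3,2)] ga[OF c'(3,1)] ..
    show ?thesis
    proof (cases "?in \<and> s = t \<and> b = \<phi> y \<and> a = c \<otimes> inv (\<phi> y)")
      case True
      then have "c = a \<otimes> b" using \<phi>[of y] by (simp add: m_assoc)
      then have d: "delta (a \<otimes> b) c = (1 :: 'k)" by (simp add: delta_def)
      have st: "delta s t = (1 :: 'k)" using True by (simp add: delta_def)
      have b: "b = \<phi> y" and a: "a = c \<otimes> inv (\<phi> y)" and s: "s = t" and i: ?in using True by blast+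
      show ?thesis unfolding E d st unfolding s b a using i by (simp only: if_True simp_thms mult_1)
    next
      case False
      have "delta s t = (0 :: 'k) \<or> delta (a \<otimes> b) c = (0 :: 'k) \<or> y \<notin> carrier G \<or> b \<noteq> \<phi> y \<or> h \<notin> carrier G"
      proof (rule ccontr)
        assume "\<not> ?thesis"
        then have "s = t" "c = a \<otimes> b" and y: "y \<in> carrier G" "b = \<phi> y" "h \<in> carrier G"
          by (auto simp: delta_def split: if_splits)
        moreover from this have "a = c \<otimes> inv (\<phi> y)" using c' by (simp add: m_assoc)
        ultimately show False using False c' m_closed by blast
      qed
      then have "delta s t * delta (a \<otimes> b) c * ((if y \<in> carrier G then if b = \<phi> y then r s y else 0 else 0) *
        (if h \<in> carrier G then P a (h \<otimes> w s) else 0)) = 0" by (elim disjE) simp_all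
      moreover have "(if s = t then if b = \<phi> y then if a = c \<otimes> inv (\<phi> y) then if ?in then ?v else 0 else 0 else 0 else 0) = 0"
        using nested_if_zero[OF False, of ?v] .
      ultimately show ?thesis unfolding E by simp
    qed
  qed
  have "(\<Sum>a\<in>carrier G. \<Sum>b\<in>carrier G. \<Sum>s\<in>carrier G.
    ?t a b s) =
    (\<Sum>a\<in>carrier G. \<Sum>b\<in>carrier G. \<Sum>s\<in>carrier G.
      if s = t then if b = \<phi> y then if a = c \<otimes> inv (\<phi> y) then if ?in then ?v else 0 else 0 else 0 else 0)"
    by (intro sum.cong refl summand)
  also have "\<dots> = (if ?in then ?v else 0)"
  proof (cases ?in)
    case True
    then have "c \<otimes> inv (\<phi> y) \<in> carrier G" "\<phi> y \<in> carrier G" using \<phi> by auto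
    then show ?thesis using True by (simp add: sum.delta)
  next
    case False
    have zero: "(if s = t then if b = \<phi> y then if a = c \<otimes> inv (\<phi> y) then if ?in then ?v else 0 else 0 else 0 else 0) = 0" for a b s
      using False by (simp only: if_False if_cancel)
    show ?thesis unfolding zero using False by (simp only: if_False sum.neutral_const)
  qed
  also have "\<dots> = R z" by (simp add: R_def R_of_def z)
  finally show "R z = (\<Sum>a\<in>carrier G. \<Sum>b\<in>carrier G. \<Sum>s\<in>carrier G.
    ?t a b s)" by simp
qed

lemma quasitriangular_eq_central_if_comm:
  assumes "comm_group G"
  shows "quasitriangular_structures (D :: ('g \<times> 'g, 'k::field) bialg) = central_weak_R_matrices D"
proof -
  have comm: "s \<otimes> y = y \<otimes> s" if "s \<in> carrier G" "y \<in> carrier G" for s y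
    using comm_groupE(4)[OF assms that] .
  have "support_law (\<lambda>s y. s \<otimes> y) R \<longleftrightarrow> support_law (\<lambda>s y. y \<otimes> s) R" for R :: "('g \<times> 'g) \<times> ('g \<times> 'g) \<Rightarrow> 'k"
    unfolding support_law_def by (intro ball_cong refl) (simp only: comm)
  then show ?thesis by (auto simp: quasitriangular_iff central_weak_iff)
qed

lemma normal_endo_cong:
  assumes "\<And>x. x \<in> carrier G \<Longrightarrow> f x = f' x" "normal_endo G f"
  shows "normal_endo G f'"
proof -
  have f: "f \<in> hom G G" using normal_endo_hom[OF assms(2)] .
  have e: "f' x = f x" if "x \<in> carrier G" for x using assms(1)[OF that] by (rule sym)
  have "f' \<in> hom G G" by (rule homI) (simp_all add: e hom_in_carrier[OF f] hom_mult[OF f])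
  moreover have "f' (g \<otimes> x \<otimes> inv g) = g \<otimes> f' x \<otimes> inv g" if "g \<in> carrier G" "x \<in> carrier G" for g x
    using normal_endo_conj[OF assms(2) that] that by (simp only: e m_closed inv_closed)
  ultimately show ?thesis by (simp add: normal_endo_def)
qed

lemma normal_endo_mult_central:
  assumes f: "f \<in> hom G G" "\<And>x. x \<in> carrier G \<Longrightarrow> f x \<in> center G" and h: "normal_endo G h"
  shows "normal_endo G (\<lambda>x. f x \<otimes> h x)"
proof -
  have fc: "f x \<in> carrier G" and hc: "h x \<in> carrier G" if "x \<in> carrier G" for x
    using hom_in_carrier[OF f(1) that] hom_in_carrier[OF normal_endo_hom[OF h] that] .
  have fz: "f x \<otimes> g = g \<otimes> f x" if "x \<in> carrier G" "g \<in> carrier G" for x g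
    using centerD(2)[OF f(2)[OF that(1)] that(2)] .
  have nf: "normal_endo G f" by (rule normal_endo_into_center[OF f])
  show ?thesis
    unfolding normal_endo_def
  proof (intro conjI ballI)
    show "(\<lambda>x. f x \<otimes> h x) \<in> hom G G"
    proof (rule homI)
      fix x y assume c: "x \<in> carrier G" "y \<in> carrier G"
      have "f (x \<otimes> y) \<otimes> h (x \<otimes> y) = f x \<otimes> (f y \<otimes> h x) \<otimes> h y"
        using c fc hc by (simp add: hom_mult[OF f(1)] hom_mult[OF normal_endo_hom[OF h]] m_assoc)
      also have "\<dots> = f x \<otimes> (h x \<otimes> f y) \<otimes> h y" using fz[OF c(2) hc[OF c(1)]] by simp
      also have "\<dots> = (f x \<otimes> h x) \<otimes> (f y \<otimes> h y)" using c fc hc by (simp add: m_assoc)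
      finally show "f (x \<otimes> y) \<otimes> h (x \<otimes> y) = (f x \<otimes> h x) \<otimes> (f y \<otimes> h y)" .
    qed (use fc hc in auto)
    fix g x assume c: "g \<in> carrier G" "x \<in> carrier G"
    show "f (g \<otimes> x \<otimes> inv g) \<otimes> h (g \<otimes> x \<otimes> inv g) = g \<otimes> (f x \<otimes> h x) \<otimes> inv g"
      unfolding normal_endo_conj[OF nf c] normal_endo_conj[OF h c] using c fc hc by (simp add: m_assoc)
  qed
qed

lemma central_quotient_hom:
  assumes f: "f \<in> hom G G" and h: "h \<in> hom G G" and z: "\<And>x. x \<in> carrier G \<Longrightarrow> inv (h x) \<otimes> f x \<in> center G"
  shows "(\<lambda>x. inv (h x) \<otimes> f x) \<in> hom G G"
proof (rule homI)
  have fc: "f x \<in> carrier G" and hc: "h x \<in> carrier G" if "x \<in> carrier G" for x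
    using hom_in_carrier[OF f that] hom_in_carrier[OF h that] .
  then show "inv (h x) \<otimes> f x \<in> carrier G" if "x \<in> carrier G" for x using that by simp
  fix x y assume c: "x \<in> carrier G" "y \<in> carrier G"
  have "inv (h (x \<otimes> y)) \<otimes> f (x \<otimes> y) = inv (h y) \<otimes> ((inv (h x) \<otimes> f x) \<otimes> f y)"
    using c fc hc by (simp add: hom_mult[OF f] hom_mult[OF h] group_word)
  also have "\<dots> = inv (h y) \<otimes> (f y \<otimes> (inv (h x) \<otimes> f x))" using centerD(2)[OF z[OF c(1)] fc[OF c(2)]] by simp
  also have "\<dots> = (inv (h y) \<otimes> f y) \<otimes> (inv (h x) \<otimes> f x)" using c fc hc by (simp add: m_assoc)
  also have "\<dots> = (inv (h x) \<otimes> f x) \<otimes> (inv (h y) \<otimes> f y)"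
    using centerD(2)[OF z[OF c(1)], of "inv (h y) \<otimes> f y"] c fc hc by simp
  finally show "inv (h (x \<otimes> y)) \<otimes> f (x \<otimes> y) = (inv (h x) \<otimes> f x) \<otimes> (inv (h y) \<otimes> f y)" .
qed

end

section \<open>Quasitriangular structures\<close>

sublocale factored_group \<subseteq> finite_group G
  by unfold_locales (rule finite_carrier)

context factored_group
begin

text \<open>Under either side \<open>A\<close> and \<open>B\<close> are central, which yields \<open>R = R_of \<phi> w r P\<close>.  The support law then
  becomes an identity on commutators, and this is the condition on the diagonal components.\<close>

lemma quasitriangular_characterization:
  fixes R :: "('g \<times> 'g) \<times> ('g \<times> 'g) \<Rightarrow> 'k::field"
  assumes R: "R \<in> weak_R_matrices D"
  shows "R \<in> quasitriangular_structures D \<longleftrightarrow>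
    A_subgroup G R \<subseteq> center G \<and> B_subgroup G R \<subseteq> center G \<and>
    (\<lambda>g. r_comp G R (delta g)) \<in> hom G (character_group G) \<and>
    (\<exists>us Sv.
       extends_endo G (transpose_map G (u_comp G R)) us \<and>
       extends_endo G (\<lambda>y. group_alg_antipode G (v_comp G R y)) Sv \<and>
       normal_endo G us \<and> normal_endo G Sv \<and>
       (\<forall>i\<in>{1..n}.
          let a = (diag Sv i \<in> homs_to_center (K i) \<and> diag us i \<in> central_auts (K i));
              b = (diag Sv i \<in> central_auts (K i) \<and> diag us i \<in> homs_to_center (K i))
          in a \<and> \<not> b \<or> \<not> a \<and> b))" (is "?L \<longleftrightarrow> ?Rt")
proof
  have weak: "weak_coeffs R" using R by (simp add: weak_R_matrices_double_iff)
  assume ?L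
  then have law: "support_law (\<lambda>s y. s \<otimes> y) R" by (simp add: quasitriangular_iff)
  obtain \<phi> w r where nd: "normal_data \<phi> w r (pairing_of R)" and eq: "R = R_of \<phi> w r (pairing_of R)"
    using support_law_structure[OF weak law] by auto
  note n = normal_dataD[OF nd] and wd = normal_data_weak_data[OF nd]
  have "\<forall>x\<in>carrier G. \<forall>y\<in>carrier G. w (gcomm G x y) \<otimes> \<phi> (gcomm G x y) = gcomm G x y"
    using law law_quasitriangular[OF nd] eq by simp
  then have ab: "\<forall>i\<in>{1..n}. diag w i \<in> homs_to_center (K i) \<and> diag \<phi> i \<in> central_auts (K i) \<or>
       diag w i \<in> central_auts (K i) \<and> diag \<phi> i \<in> homs_to_center (K i)"
    using gcomm_identity_iff[OF n(2,1,5)] by blast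
  have xor: "\<forall>i\<in>{1..n}.
          let a = (diag w i \<in> homs_to_center (K i) \<and> diag \<phi> i \<in> central_auts (K i));
              b = (diag w i \<in> central_auts (K i) \<and> diag \<phi> i \<in> homs_to_center (K i))
          in a \<and> \<not> b \<or> \<not> a \<and> b"
  proof
    fix i assume i: "i \<in> {1..n}"
    then have "\<not> (diag w i \<in> central_auts (K i) \<and> diag w i \<in> homs_to_center (K i))"
      using not_central_aut_and_hom[OF i diag_normal[OF n(2)]] by auto
    then show "let a = (diag w i \<in> homs_to_center (K i) \<and> diag \<phi> i \<in> central_auts (K i));
              b = (diag w i \<in> central_auts (K i) \<and> diag \<phi> i \<in> homs_to_center (K i))
          in a \<and> \<not> b \<or> \<not> a \<and> b"
      using bspec[OF ab i] unfolding Let_def by blast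
  qed
  have us: "extends_endo G (transpose_map G (u_comp G R)) \<phi>"
    using extends_endo_u_comp[OF wd, of \<phi>] weak_dataD(1)[OF wd] eq by simp
  have Sv: "extends_endo G (\<lambda>y. group_alg_antipode G (v_comp G R y)) w"
    using extends_endo_Sv_comp[OF wd, of w] weak_dataD(2)[OF wd] eq by simp
  have rc: "(\<lambda>g. r_comp G R (delta g)) \<in> hom G (character_group G)"
    using r_comp_hom_iff[OF wd] n(3) eq by simp
  have AB: "A_subgroup G R \<subseteq> center G" "B_subgroup G R \<subseteq> center G"
    using n(4) by (simp_all add: A_B_subgroup_eq[OF weak] central_pairing_def)
  show ?Rt using AB rc us Sv n(1,2) xor by blast
next
  have weak: "weak_coeffs R" using R by (simp add: weak_R_matrices_double_iff)
  assume ?Rt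
  then obtain us Sv where AB: "A_subgroup G R \<subseteq> center G" "B_subgroup G R \<subseteq> center G"
    and rc: "(\<lambda>g. r_comp G R (delta g)) \<in> hom G (character_group G)"
    and us: "extends_endo G (transpose_map G (u_comp G R)) us"
    and Sv: "extends_endo G (\<lambda>y. group_alg_antipode G (v_comp G R y)) Sv"
    and n: "normal_endo G us" "normal_endo G Sv"
    and xor: "\<forall>i\<in>{1..n}.
          let a = (diag Sv i \<in> homs_to_center (K i) \<and> diag us i \<in> central_auts (K i));
              b = (diag Sv i \<in> central_auts (K i) \<and> diag us i \<in> homs_to_center (K i))
          in a \<and> \<not> b \<or> \<not> a \<and> b" by blast
  have "central_pairing (pairing_of R)"
    using AB pairing_pairing_of[OF weak] by (simp add: A_B_subgroup_eq[OF weak] central_pairing_def)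
  then obtain \<phi> w r where wd: "weak_data \<phi> w r (pairing_of R)" and eq: "R = R_of \<phi> w r (pairing_of R)"
    using central_pairing_structure[OF weak] by blast
  have \<phi>: "us x = \<phi> x" and w: "Sv x = w x" if "x \<in> carrier G" for x
    using us Sv extends_endo_u_comp[OF wd] extends_endo_Sv_comp[OF wd] eq that by auto
  have nd: "normal_data \<phi> w r (pairing_of R)"
    using weak_data_normal_data[OF wd normal_endo_cong[OF \<phi> n(1)] normal_endo_cong[OF w n(2)]]
      r_comp_hom_iff[OF wd] rc eq by simp
  have commute: "Sv x \<otimes> us y = us y \<otimes> Sv x" if "x \<in> carrier G" "y \<in> carrier G" for x y
    using normal_dataD(5)[OF nd that] \<phi> w that by simp
  have "\<forall>i\<in>{1..n}. diag Sv i \<in> homs_to_center (K i) \<and> diag us i \<in> central_auts (K i) \<or>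
       diag Sv i \<in> central_auts (K i) \<and> diag us i \<in> homs_to_center (K i)"
    using xor unfolding Let_def by blast
  then have "\<forall>x\<in>carrier G. \<forall>y\<in>carrier G. Sv (gcomm G x y) \<otimes> us (gcomm G x y) = gcomm G x y"
    using gcomm_identity_iff[OF n(2,1) commute] by blast
  then have "support_law (\<lambda>s y. s \<otimes> y) (R_of \<phi> w r (pairing_of R))"
    unfolding law_quasitriangular[OF nd] using \<phi> w by simp
  then show ?L using weak eq by (simp add: quasitriangular_iff)
qed

lemma quasitriangular_expansion:
  fixes R :: "('g \<times> 'g) \<times> ('g \<times> 'g) \<Rightarrow> 'k::field"
  assumes R: "R \<in> quasitriangular_structures D"
  shows "R = (\<lambda>z. \<Sum>a\<in>carrier G. \<Sum>b\<in>carrier G. \<Sum>s\<in>carrier G.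
    pure_tensor (pure_tensor (delta s) (delta (a \<otimes> b)))
      (pure_tensor (hmult (fun_alg G) (r_comp G R (delta s)) (u_comp G R (delta b)))
         (hmult (group_alg G) (p_comp G R (delta a)) (v_comp G R (delta s)))) z)"
proof -
  have weak: "weak_coeffs R" and law: "support_law (\<lambda>s y. s \<otimes> y) R" using R by (simp_all add: quasitriangular_iff)
  obtain \<phi> w r where nd: "normal_data \<phi> w r (pairing_of R)" and eq: "R = R_of \<phi> w r (pairing_of R)"
    using support_law_structure[OF weak law] by auto
  show ?thesis using R_of_expansion[OF normal_data_weak_data[OF nd]] unfolding eq[symmetric] .
qed

section \<open>The correspondence with central weak $R$-matrices\<close>

text \<open>In terms of components, the twist multiplies central-valued \<open>\<phi>\<close> and \<open>w\<close> by the projections onto the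
  factors in \<open>I\<close> and onto the other non-abelian factors.\<close>

definition twist :: "nat set \<Rightarrow> (('g \<times> 'g) \<times> ('g \<times> 'g) \<Rightarrow> 'k::field) \<Rightarrow> ('g \<times> 'g) \<times> ('g \<times> 'g) \<Rightarrow> 'k" where
  "twist I R = (\<lambda>((s, a), (y, h)).
     if s \<in> carrier G \<and> a \<in> carrier G \<and> y \<in> carrier G \<and> h \<in> carrier G
     then R ((s, a \<otimes> inv (proj_on I y)), (y, h \<otimes> proj_on ({1..n} - I) s)) else 0)"

lemma twist_R_of:
  assumes "\<And>x. x \<in> carrier G \<Longrightarrow> \<phi> x \<in> center G" "\<And>x. x \<in> carrier G \<Longrightarrow> w x \<in> center G"
  shows "twist I (R_of \<phi> w r P) = R_of (\<lambda>x. \<phi> x \<otimes> proj_on I x) (\<lambda>x. w x \<otimes> proj_on ({1..n} - I) x) r P"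
proof (rule ext, clarify)
  fix s a y h
  let ?J = "{1..n} - I"
  show "twist I (R_of \<phi> w r P) ((s, a), (y, h)) =
    R_of (\<lambda>x. \<phi> x \<otimes> proj_on I x) (\<lambda>x. w x \<otimes> proj_on ?J x) r P ((s, a), (y, h))"
  proof (cases "s \<in> carrier G \<and> a \<in> carrier G \<and> y \<in> carrier G \<and> h \<in> carrier G")
    case True
    then have c: "s \<in> carrier G" "a \<in> carrier G" "y \<in> carrier G" "h \<in> carrier G" by auto
    have cl: "\<phi> y \<in> carrier G" "w s \<in> carrier G" using centerD(1) assms c by auto
    have "w s \<otimes> proj_on ?J s = proj_on ?J s \<otimes> w s" using centerD(2)[OF assms(2)[OF c(1)]] c by simp
    then show ?thesis using c cl by (simp add: twist_def R_of_apply inv_mult_group m_assoc)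
  qed (auto simp: twist_def R_of_def)
qed

lemma central_structure:
  fixes C :: "('g \<times> 'g) \<times> ('g \<times> 'g) \<Rightarrow> 'k::field"
  assumes "C \<in> central_weak_R_matrices D"
  obtains \<phi> w r where "normal_data \<phi> w r (pairing_of C)" "C = R_of \<phi> w r (pairing_of C)"
    "\<And>x. x \<in> carrier G \<Longrightarrow> \<phi> x \<in> center G" "\<And>x. x \<in> carrier G \<Longrightarrow> w x \<in> center G"
proof -
  have C: "weak_coeffs C" and law: "support_law (\<lambda>s y. y \<otimes> s) C" using assms by (simp_all add: central_weak_iff)
  obtain \<phi> w r where nd: "normal_data \<phi> w r (pairing_of C)" and eq: "C = R_of \<phi> w r (pairing_of C)"
    using support_law_structure[OF C law] by auto
  have "\<forall>x\<in>carrier G. \<phi> x \<in> center G \<and> w x \<in> center G"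
    using law law_central[OF nd] eq by simp
  then show ?thesis using that[OF nd eq] by blast
qed

lemma normal_data_twist:
  assumes nd: "normal_data \<phi> w r P" and I: "I \<subseteq> {1..n}"
    and z: "\<And>x. x \<in> carrier G \<Longrightarrow> \<phi> x \<in> center G" "\<And>x. x \<in> carrier G \<Longrightarrow> w x \<in> center G"
  shows "normal_data (\<lambda>x. \<phi> x \<otimes> proj_on I x) (\<lambda>x. w x \<otimes> proj_on ({1..n} - I) x) r P"
  unfolding normal_data_def
proof (intro conjI ballI)
  note n = normal_dataD[OF nd]
  let ?J = "{1..n} - I"
  show "normal_endo G (\<lambda>x. \<phi> x \<otimes> proj_on I x)"
    by (rule normal_endo_mult_central[OF normal_endo_hom[OF n(1)] z(1) proj_on_normal])
  show "normal_endo G (\<lambda>x. w x \<otimes> proj_on ?J x)"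
    by (rule normal_endo_mult_central[OF normal_endo_hom[OF n(2)] z(2) proj_on_normal])
  show "bicharacter r" "central_pairing P" by (fact n)+
  fix x y assume c: "x \<in> carrier G" "y \<in> carrier G"
  have cl: "\<phi> y \<in> carrier G" "w x \<in> carrier G" using centerD(1) z c by auto
  have "w x \<otimes> proj_on ?J x \<otimes> (\<phi> y \<otimes> proj_on I y) = w x \<otimes> (\<phi> y \<otimes> proj_on I y) \<otimes> proj_on ?J x"
  proof -
    have "proj_on ?J x \<otimes> (\<phi> y \<otimes> proj_on I y) = proj_on ?J x \<otimes> \<phi> y \<otimes> proj_on I y"
      using c cl by (simp add: m_assoc)
    also have "\<dots> = \<phi> y \<otimes> proj_on ?J x \<otimes> proj_on I y"
      using centerD(2)[OF z(1)[OF c(2)], of "proj_on ?J x"] c by simp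
    also have "\<dots> = \<phi> y \<otimes> proj_on I y \<otimes> proj_on ?J x"
      using proj_on_commute[OF Diff_disjoint[of I "{1..n}", unfolded Int_commute[of I]] c] c cl
      by (simp add: m_assoc)
    finally show ?thesis using c cl by (simp add: m_assoc)
  qed
  also have "\<dots> = \<phi> y \<otimes> proj_on I y \<otimes> w x \<otimes> proj_on ?J x"
    using centerD(2)[OF z(2)[OF c(1)], of "\<phi> y \<otimes> proj_on I y"] c cl by simp
  finally show "w x \<otimes> proj_on ?J x \<otimes> (\<phi> y \<otimes> proj_on I y) = \<phi> y \<otimes> proj_on I y \<otimes> (w x \<otimes> proj_on ?J x)"
    using c cl by (simp add: m_assoc)
qed

lemma twist_quasitriangular:
  fixes C :: "('g \<times> 'g) \<times> ('g \<times> 'g) \<Rightarrow> 'k::field"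
  assumes C: "C \<in> central_weak_R_matrices D" and I: "I \<subseteq> {1..n}"
  shows "twist I C \<in> quasitriangular_structures D"
proof -
  obtain \<phi> w r where nd: "normal_data \<phi> w r (pairing_of C)" and eq: "C = R_of \<phi> w r (pairing_of C)"
    and z: "\<And>x. x \<in> carrier G \<Longrightarrow> \<phi> x \<in> center G" "\<And>x. x \<in> carrier G \<Longrightarrow> w x \<in> center G"
    using central_structure[OF C] by metis
  note n = normal_dataD[OF nd]
  let ?\<phi> = "\<lambda>x. \<phi> x \<otimes> proj_on I x" and ?w = "\<lambda>x. w x \<otimes> proj_on ({1..n} - I) x"
  have nd': "normal_data ?\<phi> ?w r (pairing_of C)" by (rule normal_data_twist[OF nd I z])
  have "\<phi> (gcomm G s y) = \<one>" "w (gcomm G s y) = \<one>" if "s \<in> carrier G" "y \<in> carrier G" for s y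
    using kills_gcomm_iff[OF n(1)] kills_gcomm_iff[OF n(2)] z that by blast+
  then have "\<forall>s\<in>carrier G. \<forall>y\<in>carrier G. ?w (gcomm G s y) \<otimes> ?\<phi> (gcomm G s y) = gcomm G s y"
    using gcomm_eq_proj_on[OF I] by simp
  then have "support_law (\<lambda>s y. s \<otimes> y) (R_of ?\<phi> ?w r (pairing_of C))"
    using law_quasitriangular[OF nd'] by blast
  then have "R_of ?\<phi> ?w r (pairing_of C) \<in> quasitriangular_structures D"
    using weak_coeffs_R_of[OF normal_data_weak_data[OF nd']] by (simp add: quasitriangular_iff)
  moreover have "twist I C = R_of ?\<phi> ?w r (pairing_of C)"
    by (subst eq) (rule twist_R_of[OF z])
  ultimately show ?thesis by simp
qed

text \<open>Modulo the center, \<open>\<phi>\<close> is the projection onto the factors with \<open>u\<^sup>*\<close> a central automorphism, and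
  \<open>w\<close> the one onto the other non-abelian factors.  Dividing by these projections leaves components
  with values in the center.\<close>

lemma quasitriangular_is_twist:
  fixes R :: "('g \<times> 'g) \<times> ('g \<times> 'g) \<Rightarrow> 'k::field"
  assumes R: "R \<in> quasitriangular_structures D"
  obtains I C where "I \<subseteq> {1..n}" "C \<in> central_weak_R_matrices D" "twist I C = R"
proof -
  have weak: "weak_coeffs R" and law: "support_law (\<lambda>s y. s \<otimes> y) R" using R by (simp_all add: quasitriangular_iff)
  obtain \<phi> w r where nd: "normal_data \<phi> w r (pairing_of R)" and eq: "R = R_of \<phi> w r (pairing_of R)"
    using support_law_structure[OF weak law] by auto
  note n = normal_dataD[OF nd]
  have "\<forall>x\<in>carrier G. \<forall>y\<in>carrier G. w (gcomm G x y) \<otimes> \<phi> (gcomm G x y) = gcomm G x y"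
    using law law_quasitriangular[OF nd] eq by simp
  then have ab: "\<forall>i\<in>{1..n}. diag w i \<in> homs_to_center (K i) \<and> diag \<phi> i \<in> central_auts (K i) \<or>
       diag w i \<in> central_auts (K i) \<and> diag \<phi> i \<in> homs_to_center (K i)"
    using gcomm_identity_iff[OF n(2,1,5)] by blast
  define I where "I = {i \<in> {1..n}. diag w i \<in> homs_to_center (K i)}"
  let ?J = "{1..n} - I"
  have I: "I \<subseteq> {1..n}" by (auto simp: I_def)
  have not_both: "\<not> (diag w i \<in> central_auts (K i) \<and> diag w i \<in> homs_to_center (K i))" if "i \<in> {1..n}" for i
    using not_central_aut_and_hom[OF that diag_normal[OF n(2)]] that by auto
  have aI: "diag w i \<in> homs_to_center (K i)" "diag \<phi> i \<in> central_auts (K i)" if "i \<in> I" for i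
    using that ab not_both by (auto simp: I_def)
  have aJ: "diag w i \<in> central_auts (K i)" "diag \<phi> i \<in> homs_to_center (K i)" if "i \<in> ?J" for i
    using that ab by (auto simp: I_def)
  have JJ: "{1..n} - ?J = I" using I by auto
  let ?\<phi> = "\<lambda>x. inv (proj_on I x) \<otimes> \<phi> x" and ?w = "\<lambda>x. inv (proj_on ?J x) \<otimes> w x"
  have z\<phi>: "?\<phi> x \<in> center G" if "x \<in> carrier G" for x
    by (rule inv_proj_on_central[OF n(1) I aI(2) aJ(2) that])
  have zw: "?w x \<in> center G" if "x \<in> carrier G" for x
    by (rule inv_proj_on_central[OF n(2) _ aJ(1) aI(1) that]) (use JJ in auto)
  have h: "?\<phi> \<in> hom G G" "?w \<in> hom G G"
    by (rule central_quotient_hom[OF normal_endo_hom[OF n(1)] proj_on_hom], rule z\<phi>, assumption)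
      (rule central_quotient_hom[OF normal_endo_hom[OF n(2)] proj_on_hom], rule zw)
  have nd': "normal_data ?\<phi> ?w r (pairing_of R)"
    unfolding normal_data_def
  proof (intro conjI ballI n(3,4))
    show "normal_endo G ?\<phi>" by (rule normal_endo_into_center[OF h(1) z\<phi>])
    show "normal_endo G ?w" by (rule normal_endo_into_center[OF h(2) zw])
    fix x y assume c: "x \<in> carrier G" "y \<in> carrier G"
    show "?w x \<otimes> ?\<phi> y = ?\<phi> y \<otimes> ?w x" by (rule centerD(2)[OF zw[OF c(1)] centerD(1)[OF z\<phi>[OF c(2)]]])
  qed
  let ?C = "R_of ?\<phi> ?w r (pairing_of R)"
  have "support_law (\<lambda>s y. y \<otimes> s) ?C" using law_central[OF nd'] z\<phi> zw by blast
  then have C: "?C \<in> central_weak_R_matrices D"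
    using weak_coeffs_R_of[OF normal_data_weak_data[OF nd']] by (simp add: central_weak_iff)
  have "twist I ?C = R_of (\<lambda>x. ?\<phi> x \<otimes> proj_on I x) (\<lambda>x. ?w x \<otimes> proj_on ?J x) r (pairing_of R)"
    by (rule twist_R_of[OF z\<phi> zw])
  also have "\<dots> = R_of \<phi> w r (pairing_of R)"
  proof (rule R_of_cong)
    fix x assume x: "x \<in> carrier G"
    have c: "\<phi> x \<in> carrier G" "w x \<in> carrier G"
      using hom_in_carrier[OF normal_endo_hom[OF n(1)] x] hom_in_carrier[OF normal_endo_hom[OF n(2)] x] .
    show "?\<phi> x \<otimes> proj_on I x = \<phi> x" using centerD(2)[OF z\<phi>[OF x], of "proj_on I x"] x c by simp
    show "?w x \<otimes> proj_on ?J x = w x" using centerD(2)[OF zw[OF x], of "proj_on ?J x"] x c by simp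
  qed
  finally have "twist I ?C = R" using eq by simp
  then show ?thesis using that I C by blast
qed

text \<open>The factors in \<open>I\<close> are the non-abelian ones on which \<open>u\<^sup>*\<close> of the twist has non-central
  values, so \<open>I\<close> can be recovered; and for a given \<open>I\<close> the twist is a change of indices.\<close>

lemma twist_inj:
  fixes C C' :: "('g \<times> 'g) \<times> ('g \<times> 'g) \<Rightarrow> 'k::field"
  assumes C: "C \<in> central_weak_R_matrices D" "C' \<in> central_weak_R_matrices D"
    and I: "I \<subseteq> {1..n}" "I' \<subseteq> {1..n}" and eq: "twist I C = twist I' C'"
  shows "I = I'" "C = C'"
proof -
  obtain \<phi> w r where nd: "normal_data \<phi> w r (pairing_of C)" and Ceq: "C = R_of \<phi> w r (pairing_of C)"
    and z: "\<And>x. x \<in> carrier G \<Longrightarrow> \<phi> x \<in> center G" "\<And>x. x \<in> carrier G \<Longrightarrow> w x \<in> center G"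
    using central_structure[OF C(1)] by metis
  obtain \<phi>' w' r' where nd': "normal_data \<phi>' w' r' (pairing_of C')" and Ceq': "C' = R_of \<phi>' w' r' (pairing_of C')"
    and z': "\<And>x. x \<in> carrier G \<Longrightarrow> \<phi>' x \<in> center G" "\<And>x. x \<in> carrier G \<Longrightarrow> w' x \<in> center G"
    using central_structure[OF C(2)] by metis
  have tw: "twist I C = R_of (\<lambda>x. \<phi> x \<otimes> proj_on I x) (\<lambda>x. w x \<otimes> proj_on ({1..n} - I) x) r (pairing_of C)"
    by (subst Ceq) (rule twist_R_of[OF z])
  have tw': "twist I' C' = R_of (\<lambda>x. \<phi>' x \<otimes> proj_on I' x) (\<lambda>x. w' x \<otimes> proj_on ({1..n} - I') x) r' (pairing_of C')"
    by (subst Ceq') (rule twist_R_of[OF z'])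
  have wd: "weak_data (\<lambda>x. \<phi> x \<otimes> proj_on I x) (\<lambda>x. w x \<otimes> proj_on ({1..n} - I) x) r (pairing_of C)"
    by (rule normal_data_weak_data, rule normal_data_twist[OF nd I(1) z])
  have wd': "weak_data (\<lambda>x. \<phi>' x \<otimes> proj_on I' x) (\<lambda>x. w' x \<otimes> proj_on ({1..n} - I') x) r' (pairing_of C')"
    by (rule normal_data_weak_data, rule normal_data_twist[OF nd' I(2) z'])
  note s = R_of_sums(1)[OF wd, folded tw] and s' = R_of_sums(1)[OF wd', folded tw']
  have \<phi>eq: "\<phi> x \<otimes> proj_on I x = \<phi>' x \<otimes> proj_on I' x" if x: "x \<in> carrier G" for x
  proof -
    have "\<phi> x \<otimes> proj_on I x \<in> carrier G" using centerD(1)[OF z(1)[OF x]] x by simp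
    from s[OF this x] s'[OF this x] show ?thesis using eq by (auto split: if_splits)
  qed
  show II: "I = I'"
    using proj_on_central_twist_subset[OF z(1) z'(1) \<phi>eq I(1)]
      proj_on_central_twist_subset[OF z'(1) z(1) \<phi>eq[symmetric] I(2)] by (rule equalityI)
  show "C = C'"
  proof (rule ext, clarify)
    fix s a y h
    show "C ((s, a), (y, h)) = C' ((s, a), (y, h))"
    proof (cases "s \<in> carrier G \<and> a \<in> carrier G \<and> y \<in> carrier G \<and> h \<in> carrier G")
      case True
      let ?J = "{1..n} - I"
      have "twist I C ((s, a \<otimes> proj_on I y), (y, h \<otimes> inv (proj_on ?J s))) =
        twist I C' ((s, a \<otimes> proj_on I y), (y, h \<otimes> inv (proj_on ?J s)))" using eq II by simp
      then show ?thesis using True by (simp add: twist_def m_assoc)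
    next
      case False
      have "weak_coeffs C" "weak_coeffs C'" using C by (simp_all add: central_weak_iff)
      then show ?thesis using False weak_coeffsD(1) by metis
    qed
  qed
qed

lemma twist_correspondence:
  fixes Q Z :: "(('g \<times> 'g) \<times> ('g \<times> 'g) \<Rightarrow> 'k::field) set"
  defines "Q \<equiv> quasitriangular_structures D" and "Z \<equiv> central_weak_R_matrices D"
  shows "\<exists>\<Phi>. \<Phi> ` Q = Z \<and> (\<forall>C\<in>Z. card {R \<in> Q. \<Phi> R = C} = 2 ^ n)"
proof -
  define \<Phi> where "\<Phi> R = (SOME C. C \<in> Z \<and> (\<exists>I. I \<subseteq> {1..n} \<and> twist I C = R))" for R
  have \<Phi>_twist: "\<Phi> (twist I C) = C" if "C \<in> Z" "I \<subseteq> {1..n}" for C I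
  proof -
    have "\<exists>C'. C' \<in> Z \<and> (\<exists>I'. I' \<subseteq> {1..n} \<and> twist I' C' = twist I C)" using that by blast
    from someI_ex[OF this] obtain I' where "\<Phi> (twist I C) \<in> Z" "I' \<subseteq> {1..n}" "twist I' (\<Phi> (twist I C)) = twist I C"
      unfolding \<Phi>_def by blast
    then show ?thesis using twist_inj(2) that unfolding Z_def by blast
  qed
  have fibre: "{R \<in> Q. \<Phi> R = C} = (\<lambda>I. twist I C) ` Pow {1..n}" if C: "C \<in> Z" for C
  proof
    show "(\<lambda>I. twist I C) ` Pow {1..n} \<subseteq> {R \<in> Q. \<Phi> R = C}"
      using \<Phi>_twist[OF C] twist_quasitriangular C unfolding Q_def Z_def by auto
    show "{R \<in> Q. \<Phi> R = C} \<subseteq> (\<lambda>I. twist I C) ` Pow {1..n}"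
    proof clarify
      fix R assume R: "R \<in> Q" "C = \<Phi> R"
      obtain I C' where "I \<subseteq> {1..n}" "C' \<in> Z" "twist I C' = R"
        using quasitriangular_is_twist R(1) unfolding Q_def Z_def by metis
      then show "R \<in> (\<lambda>I. twist I (\<Phi> R)) ` Pow {1..n}" using \<Phi>_twist by auto
    qed
  qed
  have "card {R \<in> Q. \<Phi> R = C} = 2 ^ n" if C: "C \<in> Z" for C
  proof -
    have "inj_on (\<lambda>I. twist I C) (Pow {1..n})"
      by (rule inj_onI) (use twist_inj(1) C in \<open>unfold Z_def, blast\<close>)
    then show ?thesis by (simp add: fibre[OF C] card_image card_Pow)
  qed
  moreover have "\<Phi> ` Q = Z"
  proof
    show "\<Phi> ` Q \<subseteq> Z"
    proof clarify
      fix R assume "R \<in> Q"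
      then obtain I C where "I \<subseteq> {1..n}" "C \<in> Z" "twist I C = R"
        using quasitriangular_is_twist unfolding Q_def Z_def by metis
      then show "\<Phi> R \<in> Z" using \<Phi>_twist by auto
    qed
    show "Z \<subseteq> \<Phi> ` Q"
    proof
      fix C assume C: "C \<in> Z"
      then have "twist {} C \<in> Q" using twist_quasitriangular[of C "{}"] unfolding Q_def Z_def by simp
      then show "C \<in> \<Phi> ` Q" using \<Phi>_twist[OF C, of "{}"] by (metis empty_subsetI image_eqI)
    qed
  qed
  ultimately show ?thesis by blast
qed

end

theorem theorem5p3:
  fixes G :: "('g, 'm) monoid_scheme"
    and K :: "nat \<Rightarrow> ('a, 'l) monoid_scheme"
    and n :: nat
    and \<theta> :: "(nat \<Rightarrow> 'a) \<Rightarrow> 'g"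
    and D :: "('g \<times> 'g, 'k::field) bialg"
  defines "D \<equiv> double G"
  assumes "group G" and "finite (carrier G)"
    and "comm_group (K 0)"
    and "\<And>i. i \<in> {1..n} \<Longrightarrow> group (K i) \<and> \<not> comm_group (K i) \<and> indecomposable (K i)"
    and "\<theta> \<in> iso (product_group {..n} K) G"
  shows
    "(\<forall>R\<in>weak_R_matrices D.
        (R \<in> quasitriangular_structures D \<longleftrightarrow>
           A_subgroup G R \<subseteq> center G \<and> B_subgroup G R \<subseteq> center G \<and>
           (\<lambda>g. r_comp G R (delta g)) \<in> hom G (character_group G) \<and>
           (\<exists>us Sv.
              extends_endo G (transpose_map G (u_comp G R)) us \<and>
              extends_endo G (\<lambda>y. group_alg_antipode G (v_comp G R y)) Sv \<and>
              normal_endo G us \<and> normal_endo G Sv \<and>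
              (\<forall>i\<in>{1..n}.
                 let a = (diag_comp K n \<theta> i Sv \<in> homs_to_center (K i) \<and>
                          diag_comp K n \<theta> i us \<in> central_auts (K i));
                     b = (diag_comp K n \<theta> i Sv \<in> central_auts (K i) \<and>
                          diag_comp K n \<theta> i us \<in> homs_to_center (K i))
                 in a \<and> \<not> b \<or> \<not> a \<and> b))) \<and>
        (R \<in> quasitriangular_structures D \<longrightarrow>
           R = (\<lambda>z. \<Sum>a\<in>carrier G. \<Sum>b\<in>carrier G. \<Sum>s\<in>carrier G.
                  pure_tensor
                    (pure_tensor (delta s) (delta (a \<otimes>\<^bsub>G\<^esub> b)))
                    (pure_tensor
                       (hmult (fun_alg G) (r_comp G R (delta s)) (u_comp G R (delta b)))
                       (hmult (group_alg G) (p_comp G R (delta a)) (v_comp G R (delta s)))) z))) \<and>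
     (\<exists>\<Phi>. \<Phi> ` quasitriangular_structures D = central_weak_R_matrices D \<and>
        (\<forall>C\<in>central_weak_R_matrices D.
           card {R \<in> quasitriangular_structures D. \<Phi> R = C} = 2 ^ n)) \<and>
     (comm_group G \<longrightarrow> quasitriangular_structures D = central_weak_R_matrices D)"
proof -
  interpret f: factored_group G K n \<theta>
    by (intro factored_group.intro factored_group_axioms.intro assms)
  show ?thesis
    unfolding D_def
    by (intro conjI ballI impI f.quasitriangular_characterization f.quasitriangular_expansion
        f.twist_correspondence f.quasitriangular_eq_central_if_comm)
qed

end
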